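(* Let $t_1,t_2,t_3,t_4$ be four triangles in $\mathbb{R}^3$ that are in (algebraic) general position. Then the number $n(t_1,t_2,t_3,t_4)$ of lines in $\mathbb{R}^3$ tangent to all four triangles is even.
   Context: A triangle in $\mathbb{R}^3$ is the convex hull of three distinct non-collinear points of $\mathbb{R}^3$; its three edges are the (closed) segments joining pairs of these points. A line in $\mathbb{R}^3$ is tangent to a triangle if it meets an edge of the triangle. The supporting line of an edge is the line containing it, regarded also as a line in $\mathbb{C}\mathbb{P}^3$. A transversal in $\mathbb{C}\mathbb{P}^3$ to four lines is a line of $\mathbb{C}\mathbb{P}^3$ meeting all four. Choosing one edge from each of four triangles gives $3^4=81$ quadruples of supporting lines. Four triangles $t_1,t_2,t_3,t_4$ are in (algebraic) general position if each of the 81 quadruples of supporting lines has exactly two transversals in $\mathbb{C}\mathbb{P}^3$, and all $162$ transversals so obtained are distinct. In that case the number $n(t_1,t_2,t_3,t_4)$ of lines in $\mathbb{R}^3$ tangent to each of the four triangles is finite. *)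

theory Defs
  imports "HOL-Analysis.Analysis"
begin

definition is_triangle :: "(real^3) set \<Rightarrow> bool" where
  "is_triangle T \<longleftrightarrow> (\<exists>a b c. \<not> collinear {a, b, c} \<and> T = convex hull {a, b, c})"

(* The points a, b, c range over all orderings of the vertices of T. *)
definition triangle_edges :: "(real^3) set \<Rightarrow> (real^3) set set" where
  "triangle_edges T =
     {closed_segment a b |a b. \<exists>c. \<not> collinear {a, b, c} \<and> T = convex hull {a, b, c}}"

definition is_line :: "(real^3) set \<Rightarrow> bool" where
  "is_line L \<longleftrightarrow> affine L \<and> aff_dim L = 1"

definition tangent_to :: "(real^3) set \<Rightarrow> (real^3) set \<Rightarrow> bool" where
  "tangent_to L T \<longleftrightarrow> is_line L \<and> (\<exists>e \<in> triangle_edges T. L \<inter> e \<noteq> {})"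

definition tangent_lines ::
  "(real^3) set \<Rightarrow> (real^3) set \<Rightarrow> (real^3) set \<Rightarrow> (real^3) set \<Rightarrow> (real^3) set set" where
  "tangent_lines t1 t2 t3 t4 =
     {L. tangent_to L t1 \<and> tangent_to L t2 \<and> tangent_to L t3 \<and> tangent_to L t4}"

(* Points and lines of complex projective 3-space are the 1- and 2-dimensional
   complex linear subspaces of C^4; incidence is inclusion. *)
definition CP3_point :: "(complex^4) set \<Rightarrow> bool" where
  "CP3_point P \<longleftrightarrow> vec.subspace P \<and> vec.dim P = 1"

definition CP3_line :: "(complex^4) set \<Rightarrow> bool" where
  "CP3_line M \<longleftrightarrow> vec.subspace M \<and> vec.dim M = 2"

definition CP3_meet :: "(complex^4) set \<Rightarrow> (complex^4) set \<Rightarrow> bool" where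
  "CP3_meet M N \<longleftrightarrow> (\<exists>P. CP3_point P \<and> P \<subseteq> M \<and> P \<subseteq> N)"

(* The affine chart R^3 -> CP^3 sending (x, y, z) to [x : y : z : 1]. *)
definition homogenize :: "real^3 \<Rightarrow> complex^4" where
  "homogenize x =
     vector [complex_of_real (x$1), complex_of_real (x$2), complex_of_real (x$3), 1]"

(* The projective line spanned by the points of a line of R^3. *)
definition complexify :: "(real^3) set \<Rightarrow> (complex^4) set" where
  "complexify L = vec.span (homogenize ` L)"

definition supporting_line :: "(real^3) set \<Rightarrow> (real^3) set" where
  "supporting_line e = affine hull e"

definition CP3_transversals ::
  "(complex^4) set \<Rightarrow> (complex^4) set \<Rightarrow> (complex^4) set \<Rightarrow> (complex^4) set
     \<Rightarrow> (complex^4) set set" where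
  "CP3_transversals M1 M2 M3 M4 =
     {M. CP3_line M \<and> CP3_meet M M1 \<and> CP3_meet M M2 \<and> CP3_meet M M3 \<and> CP3_meet M M4}"

fun edge_transversals ::
  "(real^3) set \<times> (real^3) set \<times> (real^3) set \<times> (real^3) set \<Rightarrow> (complex^4) set set" where
  "edge_transversals (e1, e2, e3, e4) =
     CP3_transversals
       (complexify (supporting_line e1)) (complexify (supporting_line e2))
       (complexify (supporting_line e3)) (complexify (supporting_line e4))"

definition edge_quadruples ::
  "(real^3) set \<Rightarrow> (real^3) set \<Rightarrow> (real^3) set \<Rightarrow> (real^3) set
     \<Rightarrow> ((real^3) set \<times> (real^3) set \<times> (real^3) set \<times> (real^3) set) set" where
  "edge_quadruples t1 t2 t3 t4 =
     triangle_edges t1 \<times> triangle_edges t2 \<times> triangle_edges t3 \<times> triangle_edges t4"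

(* All 162 transversals are distinct: each quadruple contributes two of them, and
   no two different quadruples share one. *)
definition general_position ::
  "(real^3) set \<Rightarrow> (real^3) set \<Rightarrow> (real^3) set \<Rightarrow> (real^3) set \<Rightarrow> bool" where
  "general_position t1 t2 t3 t4 \<longleftrightarrow>
     (\<forall>q \<in> edge_quadruples t1 t2 t3 t4. card (edge_transversals q) = 2) \<and>
     disjoint_family_on edge_transversals (edge_quadruples t1 t2 t3 t4)"

end

theory Submission
  imports Defs
begin

text \<open>Consider the curve of all lines meeting the boundaries of the second, third and fourth triangle.
  Each such line cuts the plane of the first triangle in one point, and these points trace a closed
  curve, which crosses the boundary of the first triangle an even number of times. Concretely, for every
  choice of edges of the last three triangles, the lines meeting them are parametrised by a point
  moving along the edge of the second triangle; the property of meeting all three edges and the inside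
  of the first triangle changes at the tangent lines to be counted and at lines through vertices, and
  each line through a vertex is counted for both edges at that vertex.

  General position does not exclude that edges of the last three triangles meet, or that a line
  through two vertices meets an edge. The vertices are therefore first moved slightly in the direction
  of points on the moment curve. The transversals of four edges are the zeros of the Klein quadric on a
  two-dimensional kernel, and since the discriminant does not vanish, the count does not change.\<close>

section \<open>Line coordinates\<close>

text \<open>Distinctness of the 162 transversals makes the problem strict: a transversal through a
  vertex of one triangle would meet two of its supporting lines and belong to two quadruples. So
  each tangent line meets exactly one edge of each triangle, in an interior point, and the count
  splits into 81 disjoint problems of strict signs. That each quadruple has exactly two complex
  transversals says that its equation is a true quadratic with nonzero discriminant; this keeps the
  number of real solutions locally constant, also where it is 0. The obstacle is that a point
  sliding along an edge may reach positions about which general position says nothing, such as a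
  vertex whose plane with an edge contains another vertex. Excluding them is a polynomial condition,
  which holds for all small nonzero parameters of a suitable motion. The motion takes place in
  \<open>real^4\<close>: moved vertices need not have last coordinate 1. Hence the parity argument
  is stated for arbitrary vectors, and being between two vertices or inside a triangle is expressed
  by signs of products that do not change when the coordinates of the line are scaled.\<close>

lemma exhaust_6:
  fixes x :: 6
  shows "x = 1 \<or> x = 2 \<or> x = 3 \<or> x = 4 \<or> x = 5 \<or> x = 6"
proof (induct x)
  case (of_int z)
  then have "0 \<le> z" and "z < 6" by simp_all
  then have "z = 0 \<or> z = 1 \<or> z = 2 \<or> z = 3 \<or> z = 4 \<or> z = 5" by arith
  then show ?case by auto
qed

lemma forall_6: "(\<forall>i::6. P i) \<longleftrightarrow> P 1 \<and> P 2 \<and> P 3 \<and> P 4 \<and> P 5 \<and> P 6"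
  by (metis exhaust_6)

definition vec6 :: "'a \<Rightarrow> 'a \<Rightarrow> 'a \<Rightarrow> 'a \<Rightarrow> 'a \<Rightarrow> 'a \<Rightarrow> 'a^6" where
  "vec6 a b c d e f = (\<chi> i. if i = 1 then a else if i = 2 then b else if i = 3 then c
     else if i = 4 then d else if i = 5 then e else f)"

lemma vec6_nth [simp]:
  "vec6 a b c d e f $ 1 = a" "vec6 a b c d e f $ 2 = b" "vec6 a b c d e f $ 3 = c"
  "vec6 a b c d e f $ 4 = d" "vec6 a b c d e f $ 5 = e" "vec6 a b c d e f $ 6 = f"
  by (simp_all add: vec6_def)

lemma vector_4 [simp]:
  "(vector [a, b, c, d] :: 'a::zero^4)$1 = a" "(vector [a, b, c, d] :: 'a^4)$2 = b"
  "(vector [a, b, c, d] :: 'a^4)$3 = c" "(vector [a, b, c, d] :: 'a^4)$4 = d"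
  by (simp_all add: vector_def)

lemma vec4_eq_iff: "(x::'a^4) = y \<longleftrightarrow> x$1 = y$1 \<and> x$2 = y$2 \<and> x$3 = y$3 \<and> x$4 = y$4"
  by (simp add: vec_eq_iff forall_4)

lemma vec6_eq_iff:
  "(x::'a^6) = y \<longleftrightarrow> x$1 = y$1 \<and> x$2 = y$2 \<and> x$3 = y$3 \<and> x$4 = y$4 \<and> x$5 = y$5 \<and> x$6 = y$6"
  by (simp add: vec_eq_iff forall_6)

text \<open>The coordinates of a line are ordered 12, 13, 14, 34, 42, 23, so that the wedge product becomes
  the pairing of the first three entries with the last three.\<close>

definition plucker :: "'a::comm_ring_1^4 \<Rightarrow> 'a^4 \<Rightarrow> 'a^6" where
  "plucker x y = vec6 (x$1 * y$2 - x$2 * y$1) (x$1 * y$3 - x$3 * y$1) (x$1 * y$4 - x$4 * y$1)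
     (x$3 * y$4 - x$4 * y$3) (x$4 * y$2 - x$2 * y$4) (x$2 * y$3 - x$3 * y$2)"

definition pair :: "'a::comm_ring_1^6 \<Rightarrow> 'a^6 \<Rightarrow> 'a" where
  "pair U V = U$1 * V$4 + U$4 * V$1 + U$2 * V$5 + U$5 * V$2 + U$3 * V$6 + U$6 * V$3"

definition bracket :: "'a::comm_ring_1^4 \<Rightarrow> 'a^4 \<Rightarrow> 'a^4 \<Rightarrow> 'a^4 \<Rightarrow> 'a" where
  "bracket x y a b = pair (plucker x y) (plucker a b)"

lemmas plucker_coords = plucker_def pair_def bracket_def

lemma pair_commute: "pair U V = pair V U"
  by (simp add: pair_def algebra_simps)

lemma pair_linear [simp]:
  "pair (U + U') V = pair U V + pair U' V" "pair V (U + U') = pair V U + pair V U'"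
  "pair (U - U') V = pair U V - pair U' V" "pair V (U - U') = pair V U - pair V U'"
  "pair (c *s U) V = c * pair U V" "pair V (c *s U) = c * pair V U"
  "pair (- U) V = - pair U V" "pair V (- U) = - pair V U"
  "pair 0 V = 0" "pair V 0 = 0"
  by (simp_all add: pair_def algebra_simps)

lemma plucker_linear [simp]:
  "plucker (x + x') y = plucker x y + plucker x' y" "plucker y (x + x') = plucker y x + plucker y x'"
  "plucker (x - x') y = plucker x y - plucker x' y" "plucker y (x - x') = plucker y x - plucker y x'"
  "plucker (c *s x) y = c *s plucker x y" "plucker y (c *s x) = c *s plucker y x"
  "plucker (- x) y = - plucker x y" "plucker y (- x) = - plucker y x"
  "plucker 0 y = 0" "plucker y 0 = 0" "plucker x x = 0"
  by (simp_all add: plucker_def vec6_eq_iff algebra_simps)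

lemma plucker_swap: "plucker y x = - plucker x y"
  by (simp add: plucker_def vec6_eq_iff)

lemma bracket_linear [simp]:
  "bracket (x + x') y a b = bracket x y a b + bracket x' y a b"
  "bracket y (x + x') a b = bracket y x a b + bracket y x' a b"
  "bracket a b (x + x') y = bracket a b x y + bracket a b x' y"
  "bracket a b y (x + x') = bracket a b y x + bracket a b y x'"
  "bracket (x - x') y a b = bracket x y a b - bracket x' y a b"
  "bracket y (x - x') a b = bracket y x a b - bracket y x' a b"
  "bracket a b (x - x') y = bracket a b x y - bracket a b x' y"
  "bracket a b y (x - x') = bracket a b y x - bracket a b y x'"
  "bracket (c *s x) y a b = c * bracket x y a b"
  "bracket y (c *s x) a b = c * bracket y x a b"
  "bracket a b (c *s x) y = c * bracket a b x y"
  "bracket a b y (c *s x) = c * bracket a b y x"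
  "bracket 0 y a b = 0" "bracket y 0 a b = 0" "bracket a b 0 y = 0" "bracket a b y 0 = 0"
  by (simp_all add: bracket_def)

lemma bracket_repeat [simp]:
  "bracket x x a b = 0" "bracket x y a a = 0" "bracket x y x b = 0" "bracket x y a x = 0"
  "bracket x y y b = 0" "bracket x y a y = 0"
  by (simp_all add: plucker_coords algebra_simps)

lemma bracket_swap:
  "bracket y x a b = - bracket x y a b" "bracket x y b a = - bracket x y a b"
  "bracket x a y b = - bracket x y a b" "bracket a b x y = bracket x y a b"
  by (simp_all add: plucker_coords algebra_simps)

lemma pair_plucker_self [simp]: "pair (plucker x y) (plucker x y) = 0"
  by (simp add: plucker_coords algebra_simps)

text \<open>Five vectors of a 4-dimensional space are dependent, with their complementary
  determinants as coefficients. Below this relation rewrites a point in terms of other spanning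
  vectors.\<close>

lemma bracket_cramer:
  "bracket a b c d *s p - bracket p b c d *s a + bracket p a c d *s b
     - bracket p a b d *s c + bracket p a b c *s d = 0"
  by (simp add: vec4_eq_iff plucker_coords algebra_simps)

lemma isotropic_imp_plucker:
  fixes U :: "'a::field_char_0^6"
  assumes "pair U U = 0"
  obtains x y where "U = plucker x y"
proof -
  have q: "U$1 * U$4 + U$2 * U$5 + U$3 * U$6 = 0"
  proof -
    have "2 * (U$1 * U$4 + U$2 * U$5 + U$3 * U$6) = 0"
      using assms by (simp add: pair_def algebra_simps)
    then show ?thesis by (metis mult_eq_0_iff zero_neq_numeral)
  qed
  let ?v = "\<lambda>a b c d. vector [a, b, c, d] :: 'a^4"
  let ?r1 = "?v 0 (U$1) (U$2) (U$3)"
  let ?r2 = "?v (- U$1) 0 (U$6) (- U$5)"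
  let ?r3 = "?v (- U$2) (- U$6) 0 (U$4)"
  let ?r4 = "?v (- U$3) (U$5) (- U$4) 0"
  note D = plucker_def vec6_eq_iff field_simps vector_4
  consider "U = 0" | "U$1 \<noteq> 0" | "U$2 \<noteq> 0" | "U$3 \<noteq> 0" | "U$4 \<noteq> 0" | "U$5 \<noteq> 0" | "U$6 \<noteq> 0"
    by (auto simp: vec6_eq_iff)
  then show ?thesis
  proof cases
    case 1 then have "U = plucker 0 0" by simp
    then show ?thesis by (rule that)
  next
    case 2
    have "U = plucker (inverse (U$1) *s ?r1) ?r2" using q 2 apply (simp add: D) by algebra
    then show ?thesis by (rule that)
  next
    case 3
    have "U = plucker (inverse (U$2) *s ?r1) ?r3" using q 3 apply (simp add: D) by algebra
    then show ?thesis by (rule that)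
  next
    case 4
    have "U = plucker (inverse (U$3) *s ?r1) ?r4" using q 4 apply (simp add: D) by algebra
    then show ?thesis by (rule that)
  next
    case 5
    have "U = plucker (inverse (U$4) *s ?r3) ?r4" using q 5 apply (simp add: D) by algebra
    then show ?thesis by (rule that)
  next
    case 6
    have "U = plucker (inverse (U$5) *s ?r4) ?r2" using q 6 apply (simp add: D) by algebra
    then show ?thesis by (rule that)
  next
    case 7
    have "U = plucker (inverse (U$6) *s ?r2) ?r3" using q 7 apply (simp add: D) by algebra
    then show ?thesis by (rule that)
  qed
qed

lemma plucker_eq_0_imp_dependent:
  fixes x y :: "'a::field^4"
  assumes "plucker x y = 0"
  obtains a b where "a *s x + b *s y = 0" "a \<noteq> 0 \<or> b \<noteq> 0"
proof (cases "x = 0")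
  case True
  then show ?thesis using that[of 1 0] by simp
next
  case False
  then obtain i where i: "x$i \<noteq> 0" by (auto simp: vec_eq_iff)
  have "x$i * y$j - x$j * y$i = 0" for j
    using assms exhaust_4[of i] exhaust_4[of j]
    by (elim disjE) (simp_all add: plucker_def vec6_eq_iff algebra_simps)
  then have "(- y$i) *s x + x$i *s y = 0"
    by (simp add: vec_eq_iff algebra_simps)
  then show ?thesis using that i by blast
qed

lemma plucker_nonzero_imp_independent:
  fixes x y :: "'a::field^4"
  assumes "a *s x + b *s y = 0" "plucker x y \<noteq> 0"
  shows "a = 0 \<and> b = 0"
proof -
  have "plucker (a *s x + b *s y) y = a *s plucker x y" "plucker x (a *s x + b *s y) = b *s plucker x y"
    by simp_all
  then show ?thesis using assms(2) unfolding assms(1) by simp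
qed

lemma det_4:
  fixes A :: "'a::comm_ring_1^4^4"
  shows "det A = bracket (A$1) (A$2) (A$3) (A$4)"
proof -
  have f1: "finite {2::4, 3, 4}" "1 \<notin> {2::4, 3, 4}" by auto
  have f2: "finite {3::4, 4}" "2 \<notin> {3::4, 4}" by auto
  have f3: "finite {4::4}" "3 \<notin> {4::4}" by auto
  show ?thesis
    unfolding det_def UNIV_4
    unfolding sum_over_permutations_insert[OF f1]
    unfolding sum_over_permutations_insert[OF f2]
    unfolding sum_over_permutations_insert[OF f3]
    unfolding permutes_sing
    by (simp add: sign_swap_id permutation_swap_id sign_compose sign_id swap_id_eq plucker_coords
        permutation_compose transpose_def algebra_simps)
qed

text \<open>A vanishing determinant gives a dependency among the four vectors. Since neither pair is
  dependent by itself, the coefficients on each side are nontrivial, so the dependency is a common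
  point of the two lines.\<close>

lemma bracket_eq_0_imp_meet:
  fixes x y a b :: "'a::field^4"
  assumes "bracket x y a b = 0" "plucker x y \<noteq> 0" "plucker a b \<noteq> 0"
  obtains \<alpha> \<beta> \<gamma> \<delta> where "\<alpha> *s x + \<beta> *s y = \<gamma> *s a + \<delta> *s b" "\<alpha> \<noteq> 0 \<or> \<beta> \<noteq> 0" "\<gamma> \<noteq> 0 \<or> \<delta> \<noteq> 0"
proof -
  define A :: "'a^4^4" where "A = vector [x, y, - a, - b]"
  have "det (transpose A) = 0"
    using assms(1) unfolding det_transpose by (simp add: det_4 A_def bracket_def)
  then have "\<not> invertible (transpose A)" by (simp add: invertible_det_nz)
  then obtain v where v: "transpose A *v v = 0" "v \<noteq> 0"
    by (metis invertible_left_inverse matrix_left_invertible_ker)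
  then have e: "v$1 *s x + v$2 *s y = v$3 *s a + v$4 *s b"
    unfolding matrix_mult_sum column_transpose
    by (simp add: sum_4 A_def row_def vec_eq_iff[of "_ :: 'a^4" 0] vec_eq_iff algebra_simps add_eq_0_iff)
  have v0: "\<not> (v$1 = 0 \<and> v$2 = 0 \<and> v$3 = 0 \<and> v$4 = 0)"
    using v(2) by (metis vec4_eq_iff zero_index)
  have "v$1 \<noteq> 0 \<or> v$2 \<noteq> 0"
  proof (rule ccontr)
    assume "\<not> ?thesis"
    moreover from this have "v$3 *s a + v$4 *s b = 0" using e by simp
    ultimately show False using plucker_nonzero_imp_independent[OF _ assms(3)] v0 by blast
  qed
  moreover have "v$3 \<noteq> 0 \<or> v$4 \<noteq> 0"
  proof (rule ccontr)
    assume "\<not> ?thesis"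
    moreover from this have "v$1 *s x + v$2 *s y = 0" using e by simp
    ultimately show False using plucker_nonzero_imp_independent[OF _ assms(2)] v0 by blast
  qed
  ultimately show ?thesis using that[OF e] by blast
qed

section \<open>Sign changes on an interval\<close>

text \<open>Induction on the largest point of \<open>Z\<close>: the interval is cut just to the left
  of it.\<close>

lemma jump_parity:
  fixes F :: "real \<Rightarrow> bool"
  assumes "finite Z" "Z \<subseteq> {a<..<b}" "a < b"
    and const: "\<And>x y. \<lbrakk>a \<le> x; x < y; y \<le> b; {x..y} \<inter> Z = {}\<rbrakk> \<Longrightarrow> F x = F y"
    and jump: "\<And>z. z \<in> Z \<Longrightarrow> \<exists>d>0. \<forall>x\<in>{z-d<..<z}. \<forall>y\<in>{z<..<z+d}. (F x \<noteq> F y) = D z"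
  shows "(F a \<noteq> F b) = odd (card {z \<in> Z. D z})"
  using assms
proof (induction Z arbitrary: b rule: finite_linorder_max_induct)
  case empty
  then show ?case using empty(3)[of a b] by auto
next
  case (insert z Z)
  obtain d where d: "d > 0" "\<And>x y. x \<in> {z-d<..<z} \<Longrightarrow> y \<in> {z<..<z+d} \<Longrightarrow> (F x \<noteq> F y) = D z"
    using insert.prems(4)[of z] by auto
  have z: "a < z" "z < b" using insert.prems by auto
  \<comment> \<open>Any \<open>x\<close> between \<open>l\<close> and \<open>z\<close> lies to the
    right of \<open>a\<close> and of all earlier points, and within distance \<open>d\<close> of
    \<open>z\<close>.\<close>
  define l where "l = Max (insert a (insert (z - d) Z))"
  have l: "l < z" "a \<le> l" "z - d \<le> l" "\<And>w. w \<in> Z \<Longrightarrow> w \<le> l"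
  proof -
    have fin: "finite (insert a (insert (z - d) Z))" using insert.hyps by simp
    show "l < z" using insert.hyps d(1) z by (auto simp: l_def)
    show "a \<le> l" "z - d \<le> l" "\<And>w. w \<in> Z \<Longrightarrow> w \<le> l"
      unfolding l_def by (rule Max_ge[OF fin], blast)+
  qed
  define x where "x = (l + z) / 2"
  have x: "l < x" "x < z" using l by (auto simp: x_def)
  define y where "y = (z + min b (z + d)) / 2"
  have y: "z < y" "y < b" "y < z + d" using z d by (auto simp: y_def min_def)
  have 1: "(F a \<noteq> F x) = odd (card {z \<in> Z. D z})"
  proof (rule insert.IH)
    show "Z \<subseteq> {a<..<x}" using insert.prems(1) l x by fastforce
    show "a < x" using l x by auto
    show "F u = F w" if "a \<le> u" "u < w" "w \<le> x" "{u..w} \<inter> Z = {}" for u w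
      using insert.prems(3)[of u w] that x z by force
    show "\<exists>d>0. \<forall>x\<in>{w - d<..<w}. \<forall>y\<in>{w<..<w + d}. (F x \<noteq> F y) = D w" if "w \<in> Z" for w
      using insert.prems(4) that by auto
  qed
  have 2: "(F x \<noteq> F y) = D z" using d(2)[of x y] x y l by auto
  have 3: "F y = F b" using insert.prems(3)[of y b] y z l by fastforce
  define A where "A = {w \<in> Z. D w}"
  have A: "finite A" "z \<notin> A" using insert.hyps by (auto simp: A_def)
  have "{w \<in> insert z Z. D w} = (if D z then insert z A else A)" by (auto simp: A_def)
  then have "card {w \<in> insert z Z. D w} = (if D z then Suc (card A) else card A)"
    using A by simp
  then show ?case using 1 2 3 unfolding A_def[symmetric] by auto
qed

text \<open>A zero of \<open>f i\<close> is simple and shared with no other function, so passing it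
  flips the sign with index \<open>i\<close> alone. Whether \<open>B\<close> changes there depends
  on the other signs, hence the comparison of two updated patterns; the entry
  \<open>\<sigma> z i\<close>, which is \<open>False\<close> at the zero, is overwritten in
  both.\<close>

lemma sign_pattern_parity:
  fixes f :: "'i \<Rightarrow> real \<Rightarrow> real" and B :: "('i \<Rightarrow> bool) \<Rightarrow> bool"
  defines "\<sigma> \<equiv> \<lambda>x i. 0 < f i x"
  assumes I: "finite I" and B: "\<And>s t. (\<And>i. i \<in> I \<Longrightarrow> s i = t i) \<Longrightarrow> B s = B t"
    and ab: "a < b"
    and cont: "\<And>i x. i \<in> I \<Longrightarrow> isCont (f i) x"
    and fin: "\<And>i. i \<in> I \<Longrightarrow> finite {z \<in> {a<..<b}. f i z = 0}"
    and ends: "\<And>i. i \<in> I \<Longrightarrow> f i a \<noteq> 0 \<and> f i b \<noteq> 0"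
    and simple: "\<And>i z. \<lbrakk>i \<in> I; a < z; z < b; f i z = 0\<rbrakk> \<Longrightarrow> \<exists>D. D \<noteq> 0 \<and> (f i has_real_derivative D) (at z)"
    and distinct: "\<And>i j z. \<lbrakk>i \<in> I; j \<in> I; a < z; z < b; f i z = 0; f j z = 0\<rbrakk> \<Longrightarrow> i = j"
  shows "even (of_bool (B (\<sigma> a)) + of_bool (B (\<sigma> b))
    + (\<Sum>i\<in>I. card {z \<in> {a<..<b}. f i z = 0 \<and> B ((\<sigma> z)(i := True)) \<noteq> B ((\<sigma> z)(i := False))}))"
proof -
  define Z where "Z = (\<Union>i\<in>I. {z \<in> {a<..<b}. f i z = 0})"
  define D where "D z \<longleftrightarrow> (\<exists>i\<in>I. f i z = 0 \<and> B ((\<sigma> z)(i := True)) \<noteq> B ((\<sigma> z)(i := False)))" for z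
  have contS: "continuous_on S (f i)" if "i \<in> I" for i S
    using cont[OF that] by (simp add: continuous_at_imp_continuous_on)
  have "(B (\<sigma> a) \<noteq> B (\<sigma> b)) = odd (card {z \<in> Z. D z})"
  proof (rule jump_parity[where F = "\<lambda>x. B (\<sigma> x)"])
    show "finite Z" using I fin by (auto simp: Z_def)
    show "Z \<subseteq> {a<..<b}" by (auto simp: Z_def)
    show "B (\<sigma> x) = B (\<sigma> y)" if xy: "a \<le> x" "x < y" "y \<le> b" "{x..y} \<inter> Z = {}" for x y
    proof (rule B)
      fix i assume i: "i \<in> I"
      have nz: "f i w \<noteq> 0" if "w \<in> {x..y}" for w
      proof
        assume "f i w = 0"
        then have "w \<noteq> a" "w \<noteq> b" using ends[OF i] by auto
        then have "w \<in> Z" using i that xy \<open>f i w = 0\<close> by (auto simp: Z_def)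
        then show False using that xy by auto
      qed
      show "\<sigma> x i = \<sigma> y i"
      proof (rule ccontr)
        assume "\<sigma> x i \<noteq> \<sigma> y i"
        then have "(f i x \<le> 0 \<and> 0 \<le> f i y) \<or> (f i y \<le> 0 \<and> 0 \<le> f i x)" by (auto simp: \<sigma>_def)
        then obtain w where "x \<le> w" "w \<le> y" "f i w = 0"
          using IVT'[of "f i" x 0 y] IVT2'[of "f i" y 0 x] xy contS[OF i] by auto
        then show False using nz[of w] by auto
      qed
    qed
    fix z assume "z \<in> Z"
    then obtain i where i: "i \<in> I" "a < z" "z < b" "f i z = 0" by (auto simp: Z_def)
    obtain m where m: "m \<noteq> 0" "(f i has_real_derivative m) (at z)" using simple[OF i] by auto
    have Dz: "D z = (B ((\<sigma> z)(i := True)) \<noteq> B ((\<sigma> z)(i := False)))"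
      unfolding D_def using i distinct by blast
    have "\<forall>j\<in>I - {i}. \<exists>d>0. \<forall>x. \<bar>x - z\<bar> < d \<longrightarrow> \<sigma> x j = \<sigma> z j"
    proof
      fix j assume j: "j \<in> I - {i}"
      then have nz: "f j z \<noteq> 0" using distinct[of i j z] i by auto
      have "(f j \<longlongrightarrow> f j z) (nhds z)"
        using cont[of j z] j by (simp add: isCont_def tendsto_at_iff_tendsto_nhds)
      then have "eventually (\<lambda>x. \<sigma> x j = \<sigma> z j) (nhds z)"
        using nz order_tendstoD[of "f j" "f j z" "nhds z" 0]
        by (cases "f j z > 0") (auto simp: \<sigma>_def elim!: eventually_mono)
      then show "\<exists>d>0. \<forall>x. \<bar>x - z\<bar> < d \<longrightarrow> \<sigma> x j = \<sigma> z j"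
        unfolding eventually_nhds_metric dist_real_def by auto
    qed
    then obtain d where d: "\<And>j. j \<in> I - {i} \<Longrightarrow> d j > 0"
      "\<And>j x. j \<in> I - {i} \<Longrightarrow> \<bar>x - z\<bar> < d j \<Longrightarrow> \<sigma> x j = \<sigma> z j" by metis
    define e where "e = Min (insert 1 (d ` (I - {i})))"
    have e: "e > 0" "\<And>j. j \<in> I - {i} \<Longrightarrow> e \<le> d j" using I d by (auto simp: e_def)
    have eq: "B (\<sigma> x) = B ((\<sigma> z)(i := \<sigma> x i))" if "\<bar>x - z\<bar> < e" for x
    proof (rule B)
      fix j assume j: "j \<in> I"
      show "\<sigma> x j = ((\<sigma> z)(i := \<sigma> x i)) j"
      proof (cases "j = i")
        case False
        then have "\<bar>x - z\<bar> < d j" using e(2)[of j] j that by auto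
        then show ?thesis using d(2)[of j x] j False by simp
      qed simp
    qed
    have "\<exists>r>0. (\<forall>x\<in>{z-r<..<z}. \<sigma> x i = (m < 0)) \<and> (\<forall>x\<in>{z<..<z+r}. \<sigma> x i = (m > 0))"
    proof (cases "m > 0")
      case True
      obtain r1 where r1: "r1 > 0" "\<And>h. 0 < h \<Longrightarrow> h < r1 \<Longrightarrow> f i z < f i (z + h)"
        using DERIV_pos_inc_right[OF m(2) True] by auto
      obtain r2 where r2: "r2 > 0" "\<And>h. 0 < h \<Longrightarrow> h < r2 \<Longrightarrow> f i (z - h) < f i z"
        using DERIV_pos_inc_left[OF m(2) True] by auto
      show ?thesis
      proof (intro exI[of _ "min r1 r2"] conjI ballI)
        fix x assume "x \<in> {z - min r1 r2<..<z}"
        then have "0 < z - x" "z - x < r2" by auto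
        then show "\<sigma> x i = (m < 0)" using r2(2)[of "z - x"] True i(4) by (auto simp: \<sigma>_def)
      next
        fix x assume "x \<in> {z<..<z + min r1 r2}"
        then have "0 < x - z" "x - z < r1" by auto
        then show "\<sigma> x i = (m > 0)" using r1(2)[of "x - z"] True i(4) by (auto simp: \<sigma>_def)
      qed (use r1 r2 in auto)
    next
      case False
      then have m0: "m < 0" using m(1) by auto
      obtain r1 where r1: "r1 > 0" "\<And>h. 0 < h \<Longrightarrow> h < r1 \<Longrightarrow> f i (z + h) < f i z"
        using DERIV_neg_dec_right[OF m(2) m0] by auto
      obtain r2 where r2: "r2 > 0" "\<And>h. 0 < h \<Longrightarrow> h < r2 \<Longrightarrow> f i z < f i (z - h)"
        using DERIV_neg_dec_left[OF m(2) m0] by auto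
      show ?thesis
      proof (intro exI[of _ "min r1 r2"] conjI ballI)
        fix x assume "x \<in> {z - min r1 r2<..<z}"
        then have "0 < z - x" "z - x < r2" by auto
        then show "\<sigma> x i = (m < 0)" using r2(2)[of "z - x"] m0 i(4) by (auto simp: \<sigma>_def)
      next
        fix x assume "x \<in> {z<..<z + min r1 r2}"
        then have "0 < x - z" "x - z < r1" by auto
        then show "\<sigma> x i = (m > 0)" using r1(2)[of "x - z"] m0 i(4) by (auto simp: \<sigma>_def)
      qed (use r1 r2 in auto)
    qed
    then obtain r where r: "r > 0" "\<And>x. x \<in> {z-r<..<z} \<Longrightarrow> \<sigma> x i = (m < 0)"
      "\<And>x. x \<in> {z<..<z+r} \<Longrightarrow> \<sigma> x i = (m > 0)" by blast
    show "\<exists>d>0. \<forall>x\<in>{z-d<..<z}. \<forall>y\<in>{z<..<z+d}. (B (\<sigma> x) \<noteq> B (\<sigma> y)) = D z"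
    proof (intro exI[of _ "min e r"] conjI ballI)
      fix x y assume "x \<in> {z - min e r<..<z}" "y \<in> {z<..<z + min e r}"
      then have "B (\<sigma> x) = B ((\<sigma> z)(i := (m < 0)))" "B (\<sigma> y) = B ((\<sigma> z)(i := (m > 0)))"
        using eq[of x] eq[of y] r(2)[of x] r(3)[of y] by auto
      then show "(B (\<sigma> x) \<noteq> B (\<sigma> y)) = D z"
        using m(1) Dz by (cases "m > 0") auto
    qed (use e r in auto)
  qed (use ab in auto)
  moreover have "card {z \<in> Z. D z} =
    (\<Sum>i\<in>I. card {z \<in> {a<..<b}. f i z = 0 \<and> B ((\<sigma> z)(i := True)) \<noteq> B ((\<sigma> z)(i := False))})"
  proof -
    have "{z \<in> Z. D z} =
      (\<Union>i\<in>I. {z \<in> {a<..<b}. f i z = 0 \<and> B ((\<sigma> z)(i := True)) \<noteq> B ((\<sigma> z)(i := False))})"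
      by (auto simp: Z_def D_def)
    also have "card \<dots> = (\<Sum>i\<in>I. card {z \<in> {a<..<b}. f i z = 0 \<and> B ((\<sigma> z)(i := True)) \<noteq> B ((\<sigma> z)(i := False))})"
    proof (rule card_UN_disjoint[OF I])
      show "\<forall>i\<in>I. finite {z \<in> {a<..<b}. f i z = 0 \<and> B ((\<sigma> z)(i := True)) \<noteq> B ((\<sigma> z)(i := False))}"
        using fin by (auto intro: finite_subset[rotated])
    qed (use distinct in auto)
    finally show ?thesis .
  qed
  ultimately show ?thesis by (auto simp: of_bool_def)
qed

section \<open>Lines meeting three edges\<close>

text \<open>Any point of a line may serve as one of its spanning vectors; rescaling the other one
  keeps the coordinates equal and not merely proportional.\<close>

lemma plucker_replace:
  fixes x y :: "'a::field^4"
  assumes "a *s x + b *s y = P" "a \<noteq> 0 \<or> b \<noteq> 0"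
  obtains w where "plucker x y = plucker P w"
proof (cases "a = 0")
  case False
  then have "plucker x y = plucker P (inverse a *s y)" using assms(1)[symmetric] by simp
  then show ?thesis by (rule that)
next
  case True
  then have "plucker x y = plucker P (- (inverse b *s x))"
    using assms plucker_swap[of x y] by (auto simp flip: assms(1))
  then show ?thesis by (rule that)
qed

lemma span_singleton_eq_iff:
  fixes U V :: "'a::field^'n"
  assumes "V \<noteq> 0"
  shows "vec.span {V} = vec.span {U} \<longleftrightarrow> (\<exists>c. c \<noteq> 0 \<and> V = c *s U)"
proof
  assume "vec.span {V} = vec.span {U}"
  then have "V \<in> vec.span {U}" using vec.span_base[of V "{V}"] by simp
  then show "\<exists>c. c \<noteq> 0 \<and> V = c *s U" using assms by (auto simp: vec.span_singleton)
next
  assume "\<exists>c. c \<noteq> 0 \<and> V = c *s U"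
  then obtain c where c: "c \<noteq> 0" "V = c *s U" by blast
  have "\<exists>e. d *s U = (e * c) *s U" for d
    by (intro exI[of _ "d / c"]) (use c in auto)
  then show "vec.span {V} = vec.span {U}"
    by (auto simp: vec.span_singleton c image_iff)
qed

lemma poly_finite_roots_real:
  fixes f :: "real \<Rightarrow> real"
  assumes "\<And>s. f s = poly p s" "f a \<noteq> 0"
  shows "finite {z. f z = 0}"
proof -
  have "p \<noteq> 0" using assms(1)[of a] assms(2) by auto
  then show ?thesis unfolding assms(1) by (rule poly_roots_finite)
qed

lemma affine_simple:
  fixes f :: "real \<Rightarrow> real"
  assumes f: "\<And>s. f s = (1 - s) * A + s * B" and "A \<noteq> 0"
  shows "(f has_real_derivative B - A) (at s)" "f s = 0 \<Longrightarrow> B - A \<noteq> 0" "finite {z. f z = 0}"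
proof -
  have f': "f = (\<lambda>s. (1 - s) * A + s * B)" using f by (rule ext)
  show "(f has_real_derivative B - A) (at s)"
    unfolding f' by (auto intro!: derivative_eq_intros)
  show "B - A \<noteq> 0" if "f s = 0" using f[of s] assms(2) that by (auto simp: algebra_simps)
  show "finite {z. f z = 0}"
    by (rule poly_finite_roots_real[where p = "[:A, B - A:]" and a = 0])
       (use assms(2) in \<open>simp_all add: f algebra_simps\<close>)
qed

lemma sign_simps:
  fixes a b :: real
  shows "a \<noteq> 0 \<Longrightarrow> b \<noteq> 0 \<Longrightarrow> ((0 < a) = (\<not> 0 < b)) = (a * b < 0)"
    "a \<noteq> 0 \<Longrightarrow> b \<noteq> 0 \<Longrightarrow> ((0 < a) = (0 < b)) = (0 < a * b)"
    "a \<noteq> 0 \<Longrightarrow> b \<noteq> 0 \<Longrightarrow> (\<not> 0 < a * b) = (a * b < 0)"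
  by (auto simp: mult_less_0_iff zero_less_mult_iff)

section \<open>Sign conditions for meeting an edge or the inside of a triangle\<close>

definition crosses :: "real^6 \<Rightarrow> real^6 \<Rightarrow> real^6 \<Rightarrow> real^6 \<Rightarrow> bool" where
  "crosses e f g U \<longleftrightarrow> pair U e = 0 \<and> 0 < pair U f * pair U g"

text \<open>For a line with coordinates \<open>U\<close>, the products with the three edges of a triangle are the
  barycentric coordinates, up to a common factor, of its intersection with the plane of the triangle.\<close>

definition inside :: "(3 \<Rightarrow> real^6) \<Rightarrow> real^6 \<Rightarrow> bool" where
  "inside E U \<longleftrightarrow> 0 < pair U (E 1) * pair U (E 2) \<and> 0 < pair U (E 2) * pair U (E 3)"

lemma crosses_scale: "c \<noteq> 0 \<Longrightarrow> crosses e f g (c *s U) = crosses e f g U"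
  by (simp add: crosses_def zero_less_mult_iff mult_less_0_iff) auto

lemma inside_scale: "c \<noteq> 0 \<Longrightarrow> inside E (c *s U) = inside E U"
  by (simp add: inside_def zero_less_mult_iff mult_less_0_iff) auto

text \<open>The two inequalities put \<open>c\<close> and \<open>d\<close> on different sides of the
  plane \<open>x a b\<close>, and \<open>a\<close> and \<open>b\<close> on different sides of the
  plane \<open>x c d\<close>. The second argument of \<open>plucker\<close> is the point of the line
  \<open>c d\<close> in the plane \<open>x a b\<close>. So the line from \<open>x\<close> that meets
  both edges is meant.\<close>

definition joins :: "(3 \<Rightarrow> real^6) \<Rightarrow> real^4 \<Rightarrow> real^4 \<Rightarrow> real^4 \<Rightarrow> real^4 \<Rightarrow> real^4 \<Rightarrow> bool" where
  "joins E x a b c d \<longleftrightarrow> bracket x a b c * bracket x a b d < 0 \<and> bracket x b c d * bracket x a c d < 0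
     \<and> inside E (plucker x (bracket x a b d *s c - bracket x a b c *s d))"

text \<open>The parameters of the points \<open>p\<close> of the edge \<open>a b\<close> for which the line from \<open>p\<close> through the vertex \<open>m\<close>
  meets the edge \<open>c d\<close> and the inside of the triangle. The vertex \<open>n\<close> is auxiliary: the set does not
  depend on it, and this makes the contributions of the two edges at \<open>m\<close> cancel.\<close>

definition vertex_events ::
  "(3 \<Rightarrow> real^6) \<Rightarrow> real^4 \<Rightarrow> real^4 \<Rightarrow> real^4 \<Rightarrow> real^4 \<Rightarrow> real^4 \<Rightarrow> real^4 \<Rightarrow> real set" where
  "vertex_events E a b c d m n = {z \<in> {0<..<1}. let p = (1 - z) *s a + z *s b in
     bracket p c d m = 0 \<and> bracket p c m n * bracket p d m n < 0 \<and> inside E (plucker p m)}"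

lemma pair_plucker_edges:
  "pair (plucker (x *s a + y *s b) w) (plucker a b) = 0"
  "pair (plucker (x *s a + y *s b) w) (plucker b c) = x * bracket a w b c"
  "pair (plucker (x *s a + y *s b) w) (plucker c a) = y * bracket a w b c"
  by (simp_all add: plucker_coords algebra_simps)

text \<open>The products with the two other edges are \<open>x\<close> and \<open>y\<close> times
  the same nonzero factor, provided that the three edges are oriented cyclically. Equal signs of
  \<open>x\<close> and \<open>y\<close> mean a point strictly between \<open>a\<close> and
  \<open>b\<close>.\<close>

lemma crosses_plucker_iff:
  assumes "bracket a w b c \<noteq> 0"
  shows "crosses (plucker a b) (plucker b c) (plucker c a) (plucker (x *s a + y *s b) w) \<longleftrightarrow> 0 < x * y"
proof -
  have "x * bracket a w b c * (y * bracket a w b c) = x * y * (bracket a w b c)\<^sup>2"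
    by (simp add: power2_eq_square)
  then show ?thesis
    using assms by (simp only: crosses_def pair_plucker_edges) (auto simp: zero_less_mult_iff)
qed

text \<open>The edges are \<open>a b\<close> with opposite vertex \<open>c\<close>; the first
  triangle enters only through the coordinates \<open>E\<close> of its edges.
  \<open>generic_y\<close> and \<open>generic_h\<close> keep the linear coordinates nonzero at the
  ends of the second edge, and \<open>generic_e\<close> prevents a coordinate on the third edge and
  one on the fourth from vanishing together. \<open>simple\<close> states that the intersection with
  the Klein quadric at a transversal is transverse.\<close>

locale edge_triple =
  fixes E :: "3 \<Rightarrow> real^6" and a2 b2 c2 a3 b3 c3 a4 b4 c4 :: "real^4"
  assumes skew: "bracket a2 b2 a3 b3 \<noteq> 0" "bracket a2 b2 a4 b4 \<noteq> 0" "bracket a3 b3 a4 b4 \<noteq> 0"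
    and generic_y: "\<And>x m. x \<in> {a2, b2} \<Longrightarrow> m \<in> {a4, b4} \<Longrightarrow> bracket x a3 b3 m \<noteq> 0"
    and generic_h: "\<And>x m. x \<in> {a2, b2} \<Longrightarrow> m \<in> {a3, b3} \<Longrightarrow> bracket x m a4 b4 \<noteq> 0"
    and generic_e: "\<And>m n. m \<in> {a3, b3} \<Longrightarrow> n \<in> {a4, b4} \<Longrightarrow> bracket a2 b2 m n \<noteq> 0"
  fixes transversal :: "3 \<Rightarrow> real^6 \<Rightarrow> bool"
  defines "transversal k U \<equiv> U \<noteq> 0 \<and> pair U U = 0 \<and> pair U (E k) = 0 \<and> pair U (plucker a2 b2) = 0 \<and>
      pair U (plucker a3 b3) = 0 \<and> pair U (plucker a4 b4) = 0"
  assumes reg: "\<And>k U. transversal k U \<Longrightarrow> (\<forall>l. l \<noteq> k \<longrightarrow> pair U (E l) \<noteq> 0) \<and>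
      pair U (plucker b2 c2) \<noteq> 0 \<and> pair U (plucker c2 a2) \<noteq> 0 \<and>
      pair U (plucker b3 c3) \<noteq> 0 \<and> pair U (plucker c3 a3) \<noteq> 0 \<and>
      pair U (plucker b4 c4) \<noteq> 0 \<and> pair U (plucker c4 a4) \<noteq> 0"
    and simple: "\<And>k U W. \<lbrakk>transversal k U; pair W (E k) = 0; pair W (plucker a2 b2) = 0;
      pair W (plucker a3 b3) = 0; pair W (plucker a4 b4) = 0; pair U W = 0\<rbrakk> \<Longrightarrow> W \<in> vec.span {U}"
begin

text \<open>\<open>U s\<close> is the line through the point \<open>p s\<close> of the second edge that meets the lines of the third and
  fourth edges; \<open>y1\<close>, \<open>y2\<close> and \<open>h1\<close>, \<open>h2\<close> are, up to sign, the coordinates of its intersections with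
  the fourth and the third edge.\<close>

definition p :: "real \<Rightarrow> real^4" where "p s = (1 - s) *s a2 + s *s b2"
text \<open>The point where the line \<open>a4 b4\<close> meets the plane through \<open>x\<close>,
  \<open>a3\<close> and \<open>b3\<close>.\<close>

definition r :: "real^4 \<Rightarrow> real^4" where
  "r x = bracket x a3 b3 b4 *s a4 - bracket x a3 b3 a4 *s b4"
definition U :: "real \<Rightarrow> real^6" where "U s = plucker (p s) (r (p s))"
definition y1 where "y1 s = bracket (p s) a3 b3 a4"
definition y2 where "y2 s = bracket (p s) a3 b3 b4"
definition h1 where "h1 s = bracket (p s) b3 a4 b4"
definition h2 where "h2 s = bracket (p s) a3 a4 b4"
definition Q where "Q k s = pair (U s) (E k)"

lemma U_y: "U s = y2 s *s plucker (p s) a4 - y1 s *s plucker (p s) b4"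
  by (simp add: U_def r_def y1_def y2_def)

text \<open>The same point, seen from the third edge. Wedging with \<open>x\<close> removes the
  first term, so the line is also a combination of the lines from \<open>x\<close> to
  \<open>a3\<close> and \<open>b3\<close>.\<close>

lemma r_cramer: "r x = bracket a3 b3 a4 b4 *s x - bracket x b3 a4 b4 *s a3 + bracket x a3 a4 b4 *s b3"
  using bracket_cramer[of a3 b3 a4 b4 x] by (simp add: r_def algebra_simps)

lemma U_h: "U s = h2 s *s plucker (p s) b3 - h1 s *s plucker (p s) a3"
  by (simp add: U_def r_cramer h1_def h2_def)

lemma r_linear: "r (x + y) = r x + r y" "r (x - y) = r x - r y" "r (c *s x) = c *s r x"
  by (simp_all add: r_def vec_eq_iff algebra_simps)

lemma bracket_p:
  "bracket (p s) m a2 n = s * bracket a2 b2 m n" "bracket (p s) m b2 n = - ((1 - s) * bracket a2 b2 m n)"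
  by (simp_all add: p_def plucker_coords algebra_simps)

text \<open>Otherwise the plane through \<open>p s\<close>, \<open>a3\<close>, \<open>b3\<close>
  would contain the fourth edge as well, which by skewness forces \<open>p s\<close> onto the line
  \<open>a3 b3\<close>. Testing against both \<open>a2\<close> and \<open>b2\<close> covers every
  \<open>s\<close>, since \<open>s\<close> and \<open>1 - s\<close> are not both zero.\<close>

lemma y_nonzero: "y1 s \<noteq> 0 \<or> y2 s \<noteq> 0"
proof (rule ccontr)
  assume "\<not> ?thesis"
  then have "r (p s) = 0" by (simp add: r_def y1_def y2_def)
  then have e: "bracket a3 b3 a4 b4 *s p s = h1 s *s a3 - h2 s *s b3"
    by (simp add: r_cramer h1_def h2_def algebra_simps eq_neg_iff_add_eq_0)
  have "bracket a3 b3 a4 b4 * bracket (p s) a3 x b3 = 0" for x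
    using arg_cong[OF e, of "\<lambda>z. bracket z a3 x b3"] by simp
  then have "bracket (p s) a3 x b3 = 0" for x using skew(3) by simp
  from this[of a2] this[of b2] show False
    using skew(1) by (auto simp: bracket_p)
qed

lemma U_nonzero: "U s \<noteq> 0"
proof
  assume "U s = 0"
  then have z: "pair (U s) V = 0" for V by simp
  have "y1 s * (t * bracket a2 b2 b4 a4) = 0" "y2 s * (t * bracket a2 b2 a4 b4) = 0" if "t = s \<or> t = 1 - s" for t
    using that z[of "plucker a2 a4"] z[of "plucker b2 a4"] z[of "plucker a2 b4"] z[of "plucker b2 b4"]
    by (auto simp: U_y bracket_p simp flip: bracket_def)
  from this[of s] this[of "1 - s"] show False
    using skew(2) y_nonzero[of s] bracket_swap(2)[of a2 b2 a4 b4] by auto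
qed

lemma h_nonzero: "h1 s \<noteq> 0 \<or> h2 s \<noteq> 0"
  using U_nonzero[of s] by (auto simp: U_h)

text \<open>Otherwise one line through \<open>p s\<close> would contain \<open>m\<close> and
  \<open>n\<close>, so the line \<open>m n\<close> would meet the line \<open>a2 b2\<close>, against
  \<open>generic_e\<close>.\<close>

lemma vertices_apart:
  assumes "m \<in> {a3, b3}" "n \<in> {a4, b4}" "c *s plucker (p s) m = d *s plucker (p s) n" "d \<noteq> 0"
  shows False
proof -
  have "d * bracket (p s) n x m = 0" for x
    using arg_cong[OF assms(3), of "\<lambda>z. pair z (plucker x m)"] by (simp flip: bracket_def)
  then have "bracket (p s) n x m = 0" for x using assms(4) by simp
  from this[of a2] this[of b2] show False
    using generic_e[OF assms(1,2)] bracket_swap(2)[of a2 b2 m n] by (auto simp: bracket_p)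
qed

lemma pair_U:
  "pair (U s) (U s) = 0" "pair (U s) (plucker a2 b2) = 0"
  "pair (U s) (plucker a3 b3) = 0" "pair (U s) (plucker a4 b4) = 0"
proof -
  show "pair (U s) (U s) = 0" by (simp add: U_def)
  show "pair (U s) (plucker a2 b2) = 0" unfolding U_def p_def by (rule pair_plucker_edges)
  show "pair (U s) (plucker a3 b3) = 0" by (simp add: U_h flip: bracket_def)
  show "pair (U s) (plucker a4 b4) = 0" by (simp add: U_y flip: bracket_def)
qed

lemma transversal_U: "Q k s = 0 \<Longrightarrow> transversal k (U s)"
  using pair_U U_nonzero by (simp add: transversal_def Q_def)

text \<open>At these parameters \<open>U s\<close> passes through a vertex: of the fourth edge for
  \<open>y1\<close> and \<open>y2\<close>, of the third for \<open>h1\<close> and \<open>h2\<close>,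
  of the second at 0 and 1. It then meets two edges of that triangle, so by \<open>reg\<close> it
  cannot meet edge \<open>k\<close> of the first.\<close>

lemma Q_nonzero:
  "y1 s = 0 \<Longrightarrow> Q k s \<noteq> 0" "y2 s = 0 \<Longrightarrow> Q k s \<noteq> 0" "h1 s = 0 \<Longrightarrow> Q k s \<noteq> 0" "h2 s = 0 \<Longrightarrow> Q k s \<noteq> 0"
  "Q k 0 \<noteq> 0" "Q k 1 \<noteq> 0" "Q k s = 0 \<Longrightarrow> l \<noteq> k \<Longrightarrow> Q l s \<noteq> 0"
  using reg[OF transversal_U[of k s]]
  by (auto simp: U_y simp flip: bracket_def)[2]
     (use reg[OF transversal_U[of k s]] in \<open>auto simp: U_h simp flip: bracket_def\<close>,
      use reg[OF transversal_U[of k s]] in \<open>auto simp: U_h simp flip: bracket_def\<close>,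
      use reg[OF transversal_U[of k 0]] in \<open>auto simp: U_def p_def simp flip: bracket_def\<close>,
      use reg[OF transversal_U[of k 1]] in \<open>auto simp: U_def p_def simp flip: bracket_def\<close>,
      use reg[OF transversal_U[of k s]] in \<open>auto simp: Q_def\<close>)

lemma yh_nonzero: "y1 s = 0 \<or> y2 s = 0 \<Longrightarrow> h1 s \<noteq> 0 \<and> h2 s \<noteq> 0"
proof (rule ccontr)
  assume A: "y1 s = 0 \<or> y2 s = 0" "\<not> (h1 s \<noteq> 0 \<and> h2 s \<noteq> 0)"
  then show False
    using U_y[of s] U_h[of s] y_nonzero[of s]
      vertices_apart[of b3 a4 "h2 s" s "y2 s"] vertices_apart[of a3 a4 "- h1 s" s "y2 s"]
      vertices_apart[of b3 b4 "h2 s" s "- y1 s"] vertices_apart[of a3 b4 "- h1 s" s "- y1 s"]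
    by auto
qed

end

section \<open>Sign changes along the second edge\<close>

context edge_triple
begin

lemma Q_quadratic:
  "Q k s = (1 - s)\<^sup>2 * pair (plucker a2 (r a2)) (E k)
    + s * (1 - s) * (pair (plucker a2 (r b2)) (E k) + pair (plucker b2 (r a2)) (E k))
    + s\<^sup>2 * pair (plucker b2 (r b2)) (E k)"
proof -
  \<comment> \<open>\<open>u\<close> stands for \<open>1 - s\<close>, so that the expansion treats
    the two coefficients as independent.\<close>
  have "pair (plucker (u *s a2 + s *s b2) (r (u *s a2 + s *s b2))) (E k) =
    u\<^sup>2 * pair (plucker a2 (r a2)) (E k)
    + s * u * (pair (plucker a2 (r b2)) (E k) + pair (plucker b2 (r a2)) (E k))
    + s\<^sup>2 * pair (plucker b2 (r b2)) (E k)" for u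
    by (simp add: r_linear power2_eq_square distrib_left mult_ac)
  then show ?thesis by (simp only: Q_def U_def p_def)
qed

text \<open>The product rule for \<open>plucker (p s) (r (p s))\<close>, with \<open>p\<close>
  affine and \<open>r\<close> linear. Written as the product of one vector with \<open>E k\<close>,
  the derivative can be compared with \<open>simple\<close>.\<close>

lemma Q_derivative:
  "(Q k has_real_derivative pair (plucker (b2 - a2) (r (p s)) + plucker (p s) (r (b2 - a2))) (E k)) (at s)"
proof -
  let ?A = "pair (plucker a2 (r a2)) (E k)" and ?C = "pair (plucker b2 (r b2)) (E k)"
  let ?B = "pair (plucker a2 (r b2)) (E k) + pair (plucker b2 (r a2)) (E k)"
  have "Q k = (\<lambda>s. (1 - s)\<^sup>2 * ?A + s * (1 - s) * ?B + s\<^sup>2 * ?C)"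
    by (rule ext) (rule Q_quadratic)
  moreover have "((\<lambda>s. (1 - s)\<^sup>2 * ?A + s * (1 - s) * ?B + s\<^sup>2 * ?C) has_real_derivative
      (- 2 * (1 - s) * ?A + (1 - 2 * s) * ?B + 2 * s * ?C)) (at s)"
    by (auto intro!: derivative_eq_intros simp: algebra_simps)
  moreover have "- 2 * (1 - s) * ?A + (1 - 2 * s) * ?B + 2 * s * ?C =
      pair (plucker (b2 - a2) (r (p s)) + plucker (p s) (r (b2 - a2))) (E k)"
  proof -
    have "pair (plucker (b2 - a2) (r (u *s a2 + s *s b2)) + plucker (u *s a2 + s *s b2) (r (b2 - a2))) (E k)
      = - 2 * u * ?A + (u - s) * ?B + 2 * s * ?C" for u
      by (simp only: r_linear plucker_linear pair_linear) (simp add: algebra_simps)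
    from this[of "1 - s"] show ?thesis by (simp only: p_def) (simp add: algebra_simps)
  qed
  ultimately show ?thesis by simp
qed

text \<open>\<open>W\<close> is the velocity of \<open>U s\<close>: tangent to the Klein quadric and
  subject to the conditions of the last three edges. If it also satisfied the condition of edge
  \<open>k\<close>, then \<open>simple\<close> would make it a multiple of \<open>U s\<close>; this
  would put \<open>r (p s)\<close>, a nonzero point of the fourth line, on the line
  \<open>a2 b2\<close>.\<close>

lemma Q_simple:
  assumes "Q k s = 0"
  shows "pair (plucker (b2 - a2) (r (p s)) + plucker (p s) (r (b2 - a2))) (E k) \<noteq> 0"
proof
  let ?d = "b2 - a2"
  define W where "W = plucker ?d (r (p s)) + plucker (p s) (r ?d)"
  assume "pair (plucker ?d (r (p s)) + plucker (p s) (r ?d)) (E k) = 0"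
  then have "pair W (E k) = 0" by (simp add: W_def)
  moreover have "pair W (plucker a2 b2) = 0"
    by (simp add: W_def p_def flip: bracket_def)
  moreover have "pair W (plucker a3 b3) = 0"
  proof -
    have "bracket x (r x) a3 b3 = 0" for x by (simp add: r_cramer)
    from this[of "?d + p s"] this[of ?d] this[of "p s"] show ?thesis
      by (simp add: W_def r_linear flip: bracket_def)
  qed
  moreover have "pair W (plucker a4 b4) = 0"
    by (simp add: W_def r_def flip: bracket_def)
  moreover have "pair (U s) W = 0"
    by (simp add: W_def U_def flip: bracket_def)
  ultimately have "W \<in> vec.span {U s}" using simple transversal_U[OF assms] by blast
  then obtain c where c: "W = c *s U s" by (auto simp: vec.span_singleton)
  have "pair W (plucker (p s) x) = 0" for x
    unfolding c by (simp add: U_def flip: bracket_def)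
  then have *: "bracket ?d (r (p s)) (p s) x = 0" for x
    by (simp add: W_def flip: bracket_def)
  have wedge: "bracket ?d m (p s) x = bracket a2 b2 m x" for m x
    by (simp add: p_def plucker_coords algebra_simps)
  have "y1 s * bracket a2 b2 b4 a4 = 0" "y2 s * bracket a2 b2 a4 b4 = 0"
    using *[of a4] *[of b4] unfolding wedge by (simp_all add: r_def y1_def y2_def)
  then show False using y_nonzero[of s] skew(2) bracket_swap(2)[of a2 b2 a4 b4] by auto
qed

lemma affine_forms:
  "y1 s = (1 - s) * y1 0 + s * y1 1" "y2 s = (1 - s) * y2 0 + s * y2 1"
  "h1 s = (1 - s) * h1 0 + s * h1 1" "h2 s = (1 - s) * h2 0 + s * h2 1"
  by (simp_all add: y1_def y2_def h1_def h2_def p_def, simp_all add: algebra_simps)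

lemma ends_nonzero:
  "y1 0 \<noteq> 0" "y1 1 \<noteq> 0" "y2 0 \<noteq> 0" "y2 1 \<noteq> 0" "h1 0 \<noteq> 0" "h1 1 \<noteq> 0" "h2 0 \<noteq> 0" "h2 1 \<noteq> 0"
  using generic_y generic_h by (auto simp: y1_def y2_def h1_def h2_def p_def)

lemma Q_finite: "finite {z. Q k z = 0}"
proof (rule poly_finite_roots_real[where a = 0])
  let ?A = "pair (plucker a2 (r a2)) (E k)" and ?C = "pair (plucker b2 (r b2)) (E k)"
  let ?B = "pair (plucker a2 (r b2)) (E k) + pair (plucker b2 (r a2)) (E k)"
  show "Q k s = poly [:?A, ?B - 2 * ?A, ?A - ?B + ?C:] s" for s
    by (simp add: Q_quadratic algebra_simps power2_eq_square)
  show "Q k 0 \<noteq> 0" by (rule Q_nonzero)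
qed

definition F :: "nat \<Rightarrow> real \<Rightarrow> real" where
  "F i = (if i = 0 then y1 else if i = 1 then y2 else if i = 2 then h1 else if i = 3 then h2
     else if i = 4 then Q 1 else if i = 5 then Q 2 else Q 3)"

definition hits :: "3 \<Rightarrow> real set" where
  "hits k = {z \<in> {0<..<1}. Q k z = 0 \<and> y1 z * y2 z < 0 \<and> h1 z * h2 z < 0 \<and> 0 < Q (k + 1) z * Q (k + 2) z}"

lemma inside_U: "inside E (U s) \<longleftrightarrow> 0 < Q 1 s * Q 2 s \<and> 0 < Q 2 s * Q 3 s"
  by (simp add: inside_def Q_def)

text \<open>Seven functions govern the line \<open>U s\<close>. A zero of a linear one is a passage
  through a vertex of the third or fourth triangle, a zero of \<open>Q k\<close> a contact with edge
  \<open>k\<close> of the first. Each counts only if the remaining signs fit, and the values at 0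
  and 1 give the two \<open>joins\<close> terms.\<close>

lemma hit_parity:
  "even (of_bool (joins E a2 a3 b3 a4 b4) + of_bool (joins E b2 a3 b3 a4 b4)
    + (card (vertex_events E a2 b2 a3 b3 a4 b4) + card (vertex_events E a2 b2 a3 b3 b4 a4)
      + card (vertex_events E a2 b2 a4 b4 b3 a3) + card (vertex_events E a2 b2 a4 b4 a3 b3)
      + (\<Sum>k\<in>UNIV. card (hits k))))"
proof -
  \<comment> \<open>Opposite signs of \<open>y1\<close>, \<open>y2\<close> mean that the fourth edge
    is crossed, opposite signs of \<open>h1\<close>, \<open>h2\<close> the third; three equal signs
    of \<open>Q\<close> mean that the line passes through the inside of the first triangle.\<close>
  let ?B = "\<lambda>t::nat \<Rightarrow> bool. (t 0 \<noteq> t 1) \<and> (t 2 \<noteq> t 3) \<and> (t 4 = t 5) \<and> (t 5 = t 6)"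
  let ?\<sigma> = "\<lambda>x i. 0 < F i x"
  let ?ev = "\<lambda>i. {z \<in> {0<..<1}. F i z = 0 \<and> ?B ((?\<sigma> z)(i := True)) \<noteq> ?B ((?\<sigma> z)(i := False))}"
  have F: "F 0 = y1" "F 1 = y2" "F 2 = h1" "F 3 = h2" "F 4 = Q 1" "F 5 = Q 2" "F 6 = Q 3"
    "F (Suc 0) = y2"
    by (simp_all add: F_def)
  have I: "{..<7::nat} = {0, 1, 2, 3, 4, 5, 6}" by auto
  note affine = affine_simple[of y1, OF affine_forms(1) ends_nonzero(1)]
    affine_simple[of y2, OF affine_forms(2) ends_nonzero(3)]
    affine_simple[of h1, OF affine_forms(3) ends_nonzero(5)]
    affine_simple[of h2, OF affine_forms(4) ends_nonzero(7)]
  have der: "\<exists>D. (F i has_real_derivative D) (at z) \<and> (F i z = 0 \<longrightarrow> D \<noteq> 0)" for i z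
  proof -
    have *: "P (F i)" if "P y1" "P y2" "P h1" "P h2" "\<And>k. P (Q k)" for P
      using that by (simp add: F_def)
    show ?thesis
      by (rule *) (use affine Q_derivative Q_simple in blast)+
  qed
  have "even (of_bool (?B (?\<sigma> 0)) + of_bool (?B (?\<sigma> 1)) + (\<Sum>i\<in>{..<7}. card (?ev i)))"
  proof (rule sign_pattern_parity)
    show "isCont (F i) x" for i x using der[of i x] DERIV_isCont by blast
    show "finite {z \<in> {0<..<1}. F i z = 0}" for i
      by (rule finite_subset[of _ "{z. F i z = 0}"]) (auto simp: F_def affine Q_finite)
    show "F i 0 \<noteq> 0 \<and> F i 1 \<noteq> 0" for i
      by (auto simp: F_def ends_nonzero Q_nonzero)
    show "\<exists>D. D \<noteq> 0 \<and> (F i has_real_derivative D) (at z)" if "F i z = 0" for i z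
      using der[of i z] that by blast
    show "i = j" if "i \<in> {..<7}" "j \<in> {..<7}" "F i z = 0" "F j z = 0" for i j z
    proof (rule ccontr)
      assume "i \<noteq> j"
      moreover have "\<not> (y1 z = 0 \<and> y2 z = 0)" "\<not> (h1 z = 0 \<and> h2 z = 0)" "\<not> (y1 z = 0 \<and> h1 z = 0)"
        "\<not> (y1 z = 0 \<and> h2 z = 0)" "\<not> (y2 z = 0 \<and> h1 z = 0)" "\<not> (y2 z = 0 \<and> h2 z = 0)"
        "\<And>k. \<not> (y1 z = 0 \<and> Q k z = 0)" "\<And>k. \<not> (y2 z = 0 \<and> Q k z = 0)"
        "\<And>k. \<not> (h1 z = 0 \<and> Q k z = 0)" "\<And>k. \<not> (h2 z = 0 \<and> Q k z = 0)"
        "\<not> (Q 1 z = 0 \<and> Q 2 z = 0)" "\<not> (Q 1 z = 0 \<and> Q 3 z = 0)" "\<not> (Q 2 z = 0 \<and> Q 3 z = 0)"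
        using y_nonzero[of z] h_nonzero[of z] yh_nonzero[of z] Q_nonzero(1-4)[of z]
          Q_nonzero(7)[of 1 z 2] Q_nonzero(7)[of 1 z 3] Q_nonzero(7)[of 2 z 3] by auto
      moreover have "i \<in> {0, 1, 2, 3, 4, 5, 6}" "j \<in> {0, 1, 2, 3, 4, 5, 6}" using that I by auto
      ultimately show False using that(3,4)
        by (elim insertE emptyE) (simp_all add: F)
    qed
  qed (auto simp: I)
  moreover have "(\<Sum>i\<in>{..<7}. g i) = g 0 + g 1 + g 3 + g 2 + (g 4 + g 5 + g 6)" for g :: "nat \<Rightarrow> nat"
    by (simp add: I)
  moreover have B: "?B (?\<sigma> s) = joins E (p s) a3 b3 a4 b4"
    if "y1 s \<noteq> 0" "y2 s \<noteq> 0" "h1 s \<noteq> 0" "h2 s \<noteq> 0" "\<And>k. Q k s \<noteq> 0" for s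
  proof -
    have "joins E (p s) a3 b3 a4 b4 \<longleftrightarrow> y1 s * y2 s < 0 \<and> h1 s * h2 s < 0 \<and> inside E (U s)"
      by (simp add: joins_def y1_def y2_def h1_def h2_def U_def r_def)
    then show ?thesis unfolding F inside_U using that by (simp add: sign_simps)
  qed
  have "?B (?\<sigma> 0) = joins E a2 a3 b3 a4 b4" "?B (?\<sigma> 1) = joins E b2 a3 b3 a4 b4"
    using B[of 0] B[of 1] ends_nonzero Q_nonzero(5,6) by (simp_all add: p_def)
  \<comment> \<open>At a zero of \<open>y1\<close> the line is the one from \<open>p z\<close>
    through \<open>a4\<close>. Whatever the sign of \<open>y2\<close>, exactly one sign of
    \<open>y1\<close> differs from it, so only the signs of the \<open>h\<close> and of the
    \<open>Q\<close> decide.\<close>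
  moreover have "?ev 0 = vertex_events E a2 b2 a3 b3 a4 b4"
    unfolding vertex_events_def Let_def p_def[symmetric]
  proof (rule Collect_cong, rule conj_cong[OF refl])
    fix z
    show "(F 0 z = 0 \<and> ?B ((?\<sigma> z)(0 := True)) \<noteq> ?B ((?\<sigma> z)(0 := False))) =
      (bracket (p z) a3 b3 a4 = 0 \<and> bracket (p z) a3 a4 b4 * bracket (p z) b3 a4 b4 < 0 \<and>
        inside E (plucker (p z) a4))"
    proof (cases "y1 z = 0")
      case True
      then have "inside E (plucker (p z) a4) = inside E (U z)"
        using y_nonzero[of z] by (simp add: U_y inside_scale)
      moreover have "(?B (t(0 := True)) \<noteq> ?B (t(0 := False))) = ((t 2 \<noteq> t 3) \<and> (t 4 = t 5) \<and> (t 5 = t 6))" for t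
        by auto
      ultimately show ?thesis
        using True yh_nonzero[of z] Q_nonzero(1)[of z]
        by (simp only: F) (simp add: sign_simps inside_U mult.commute flip: y1_def h1_def h2_def)
    qed (simp add: F y1_def)
  qed
  moreover have "?ev 1 = vertex_events E a2 b2 a3 b3 b4 a4"
    unfolding vertex_events_def Let_def p_def[symmetric]
  proof (rule Collect_cong, rule conj_cong[OF refl])
    fix z
    have sw: "bracket (p z) a3 b4 a4 = - h2 z" "bracket (p z) b3 b4 a4 = - h1 z"
      by (simp_all add: h1_def h2_def bracket_swap(2)[of _ _ b4 a4])
    show "(F 1 z = 0 \<and> ?B ((?\<sigma> z)(1 := True)) \<noteq> ?B ((?\<sigma> z)(1 := False))) =
      (bracket (p z) a3 b3 b4 = 0 \<and> bracket (p z) a3 b4 a4 * bracket (p z) b3 b4 a4 < 0 \<and>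
        inside E (plucker (p z) b4))"
    proof (cases "y2 z = 0")
      case True
      then have "inside E (plucker (p z) b4) = inside E (U z)"
        using y_nonzero[of z] inside_scale[of "- y1 z" E "plucker (p z) b4"] by (simp add: U_y)
      moreover have "(?B (t(1 := True)) \<noteq> ?B (t(1 := False))) = ((t 2 \<noteq> t 3) \<and> (t 4 = t 5) \<and> (t 5 = t 6))" for t
        by auto
      ultimately show ?thesis
        using True yh_nonzero[of z] Q_nonzero(2)[of z]
        by (simp only: F sw) (simp add: sign_simps inside_U mult.commute flip: y2_def)
    qed (simp add: F y2_def)
  qed
  moreover have "?ev 2 = vertex_events E a2 b2 a4 b4 b3 a3"
    unfolding vertex_events_def Let_def p_def[symmetric]
  proof (rule Collect_cong, rule conj_cong[OF refl])
    fix z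
    have sw: "bracket (p z) a4 b4 b3 = h1 z" "bracket (p z) a4 b3 a3 = - y1 z" "bracket (p z) b4 b3 a3 = - y2 z"
      by (simp_all add: h1_def y1_def y2_def plucker_coords algebra_simps)
    show "(F 2 z = 0 \<and> ?B ((?\<sigma> z)(2 := True)) \<noteq> ?B ((?\<sigma> z)(2 := False))) =
      (bracket (p z) a4 b4 b3 = 0 \<and> bracket (p z) a4 b3 a3 * bracket (p z) b4 b3 a3 < 0 \<and>
        inside E (plucker (p z) b3))"
    proof (cases "h1 z = 0")
      case True
      then have "inside E (plucker (p z) b3) = inside E (U z)"
        using h_nonzero[of z] by (simp add: U_h inside_scale)
      moreover have "(?B (t(2 := True)) \<noteq> ?B (t(2 := False))) = ((t 0 \<noteq> t 1) \<and> (t 4 = t 5) \<and> (t 5 = t 6))" for t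
        by auto
      moreover have "y1 z \<noteq> 0" "y2 z \<noteq> 0" "Q 1 z \<noteq> 0" "Q 2 z \<noteq> 0" "Q 3 z \<noteq> 0"
        using True yh_nonzero[of z] Q_nonzero(3)[of z] by blast+
      ultimately show ?thesis
        using True by (simp only: F sw) (simp add: sign_simps inside_U)
    qed (simp add: F sw)
  qed
  moreover have "?ev 3 = vertex_events E a2 b2 a4 b4 a3 b3"
    unfolding vertex_events_def Let_def p_def[symmetric]
  proof (rule Collect_cong, rule conj_cong[OF refl])
    fix z
    have sw: "bracket (p z) a4 b4 a3 = h2 z" "bracket (p z) a4 a3 b3 = y1 z" "bracket (p z) b4 a3 b3 = y2 z"
      by (simp_all add: h2_def y1_def y2_def plucker_coords algebra_simps)
    show "(F 3 z = 0 \<and> ?B ((?\<sigma> z)(3 := True)) \<noteq> ?B ((?\<sigma> z)(3 := False))) =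
      (bracket (p z) a4 b4 a3 = 0 \<and> bracket (p z) a4 a3 b3 * bracket (p z) b4 a3 b3 < 0 \<and>
        inside E (plucker (p z) a3))"
    proof (cases "h2 z = 0")
      case True
      then have "inside E (plucker (p z) a3) = inside E (U z)"
        using h_nonzero[of z] inside_scale[of "- h1 z" E "plucker (p z) a3"] by (simp add: U_h)
      moreover have "(?B (t(3 := True)) \<noteq> ?B (t(3 := False))) = ((t 0 \<noteq> t 1) \<and> (t 4 = t 5) \<and> (t 5 = t 6))" for t
        by auto
      moreover have "y1 z \<noteq> 0" "y2 z \<noteq> 0" "Q 1 z \<noteq> 0" "Q 2 z \<noteq> 0" "Q 3 z \<noteq> 0"
        using True yh_nonzero[of z] Q_nonzero(4)[of z] by blast+
      ultimately show ?thesis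
        using True by (simp only: F sw) (simp add: sign_simps inside_U)
    qed (simp add: F sw)
  qed
  moreover have "?ev 4 = hits 1" "?ev 5 = hits 2" "?ev 6 = hits 3"
  proof -
    have nz: "y1 z \<noteq> 0 \<and> y2 z \<noteq> 0 \<and> h1 z \<noteq> 0 \<and> h2 z \<noteq> 0" "l \<noteq> k \<Longrightarrow> Q l z \<noteq> 0" if "Q k z = 0" for k l z
      using Q_nonzero(1-4)[of z k] Q_nonzero(7)[of k z l] that by auto
    have fl: "(?B (t(4 := True)) \<noteq> ?B (t(4 := False))) = ((t 0 \<noteq> t 1) \<and> (t 2 \<noteq> t 3) \<and> (t 5 = t 6))"
      "(?B (t(5 := True)) \<noteq> ?B (t(5 := False))) = ((t 0 \<noteq> t 1) \<and> (t 2 \<noteq> t 3) \<and> (t 4 = t 6))"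
      "(?B (t(6 := True)) \<noteq> ?B (t(6 := False))) = ((t 0 \<noteq> t 1) \<and> (t 2 \<noteq> t 3) \<and> (t 4 = t 5))" for t
      by auto
    have idx: "1 + 1 = (2::3)" "1 + 2 = (3::3)" "2 + 1 = (3::3)" "2 + 2 = (1::3)" "3 + 1 = (1::3)" "3 + 2 = (2::3)"
      by simp_all
    show "?ev 4 = hits 1" unfolding hits_def fl F idx
      by (rule Collect_cong, rule conj_cong[OF refl], rule conj_cong[OF refl]) (use nz in \<open>auto simp: sign_simps\<close>)
    show "?ev 5 = hits 2" unfolding hits_def fl F idx
      by (rule Collect_cong, rule conj_cong[OF refl], rule conj_cong[OF refl]) (use nz in \<open>auto simp: sign_simps mult.commute\<close>)
    show "?ev 6 = hits 3" unfolding hits_def fl F idx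
      by (rule Collect_cong, rule conj_cong[OF refl], rule conj_cong[OF refl]) (use nz in \<open>auto simp: sign_simps\<close>)
  qed
  ultimately show ?thesis by (simp only: sum_3 add_ac)
qed

end

section \<open>Parameter values and the lines they describe\<close>

context edge_triple
begin

definition triple_tangents :: "3 \<Rightarrow> (real^6) set set" where
  "triple_tangents k = {vec.span {V} |V. pair V V = 0 \<and> crosses (E k) (E (k + 1)) (E (k + 2)) V \<and>
     crosses (plucker a2 b2) (plucker b2 c2) (plucker c2 a2) V \<and>
     crosses (plucker a3 b3) (plucker b3 c3) (plucker c3 a3) V \<and>
     crosses (plucker a4 b4) (plucker b4 c4) (plucker c4 a4) V}"

lemma crosses_U:
  assumes "Q k s = 0"
  shows "crosses (plucker a2 b2) (plucker b2 c2) (plucker c2 a2) (U s) \<longleftrightarrow> 0 < s * (1 - s)"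
    "crosses (plucker a3 b3) (plucker b3 c3) (plucker c3 a3) (U s) \<longleftrightarrow> h1 s * h2 s < 0"
    "crosses (plucker a4 b4) (plucker b4 c4) (plucker c4 a4) (U s) \<longleftrightarrow> y1 s * y2 s < 0"
    "crosses (E k) (E (k + 1)) (E (k + 2)) (U s) \<longleftrightarrow> 0 < Q (k + 1) s * Q (k + 2) s"
proof -
  \<comment> \<open>The same line is spanned from its point on each of the three edges; the weights
    of that point on the two ends are what \<open>crosses\<close> tests.\<close>
  have u2: "U s = plucker ((1 - s) *s a2 + s *s b2) (r (p s))"
    by (simp only: U_def p_def)
  have u3: "U s = plucker (h1 s *s a3 + (- h2 s) *s b3) (p s)"
    unfolding U_h by (simp add: plucker_swap[of "p s" a3] plucker_swap[of "p s" b3])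
  have u4: "U s = plucker ((- y2 s) *s a4 + y1 s *s b4) (p s)"
    unfolding U_y by (simp add: plucker_swap[of "p s" a4] plucker_swap[of "p s" b4])
  note nz = reg[OF transversal_U[OF assms]]
  have *: "crosses (plucker a b) (plucker b c) (plucker c a) (U s) \<longleftrightarrow> 0 < x * y"
    if "U s = plucker (x *s a + y *s b) w" "pair (U s) (plucker b c) \<noteq> 0" for a b c w x y
  proof -
    have "bracket a w b c \<noteq> 0" using that pair_plucker_edges(2)[of x a y b w c] by auto
    from crosses_plucker_iff[OF this] show ?thesis unfolding that(1) .
  qed
  show "crosses (plucker a2 b2) (plucker b2 c2) (plucker c2 a2) (U s) \<longleftrightarrow> 0 < s * (1 - s)"
    using *[OF u2, of c2] nz by (simp add: mult.commute)
  show "crosses (plucker a3 b3) (plucker b3 c3) (plucker c3 a3) (U s) \<longleftrightarrow> h1 s * h2 s < 0"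
    using *[OF u3, of c3] nz by simp
  show "crosses (plucker a4 b4) (plucker b4 c4) (plucker c4 a4) (U s) \<longleftrightarrow> y1 s * y2 s < 0"
    using *[OF u4, of c4] nz by (simp add: mult.commute)
  show "crosses (E k) (E (k + 1)) (E (k + 2)) (U s) \<longleftrightarrow> 0 < Q (k + 1) s * Q (k + 2) s"
    using assms by (simp add: crosses_def Q_def)
qed

text \<open>A line belonging to two parameters would contain two points of the line
  \<open>a2 b2\<close> and coincide with it, although it meets the fourth line.\<close>

lemma inj_span_U: "inj (\<lambda>s. vec.span {U s})"
proof (rule injI)
  fix s t assume "vec.span {U s} = vec.span {U t}"
  then obtain c where c: "U s = c *s U t" using span_singleton_eq_iff[OF U_nonzero] by blast
  have "pair (U s) (plucker (p t) m) = 0" for m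
    unfolding c by (simp add: U_def flip: bracket_def)
  then have *: "bracket (p s) (r (p s)) (p t) m = 0" for m by (simp add: U_def flip: bracket_def)
  have wedge: "bracket (p s) n (p t) m = (s - t) * bracket a2 b2 n m" for n m
    by (simp add: p_def plucker_coords algebra_simps)
  have "(s - t) * (y1 s * bracket a2 b2 b4 a4) = 0" "(s - t) * (y2 s * bracket a2 b2 a4 b4) = 0"
    using *[of a4] *[of b4] unfolding wedge by (simp_all add: r_def y1_def y2_def)
  then show "s = t" using y_nonzero[of s] skew(2) bracket_swap(2)[of a2 b2 a4 b4] by auto
qed

text \<open>The line is spanned from its point on the second edge and its point on the fourth line.
  The condition of the third line then fixes the weights on \<open>a4\<close> and \<open>b4\<close>
  up to a common factor, and they agree with those in \<open>U_y\<close>.\<close>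

lemma transversal_imp_U:
  assumes iso: "pair V V = 0" and V: "V \<noteq> 0"
    and e2: "crosses (plucker a2 b2) (plucker b2 c2) (plucker c2 a2) V"
    and e3: "pair V (plucker a3 b3) = 0" and e4: "pair V (plucker a4 b4) = 0"
  obtains s c where "0 < s" "s < 1" "c \<noteq> 0" "V = c *s U s"
proof -
  have pl: "plucker a2 b2 \<noteq> 0" "plucker a4 b4 \<noteq> 0" using skew by (auto simp: bracket_def)
  obtain x y where xy: "V = plucker x y" using isotropic_imp_plucker[OF iso] .
  obtain \<alpha> \<beta> \<gamma> \<delta> where P: "\<alpha> *s x + \<beta> *s y = \<gamma> *s a2 + \<delta> *s b2" "\<alpha> \<noteq> 0 \<or> \<beta> \<noteq> 0"
  proof (rule bracket_eq_0_imp_meet)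
    show "bracket x y a2 b2 = 0" using e2 xy by (simp add: crosses_def bracket_def)
  qed (use V xy pl in auto)
  obtain w where w: "V = plucker (\<gamma> *s a2 + \<delta> *s b2) w"
    using plucker_replace[OF P] xy by metis
  have "bracket a2 w b2 c2 \<noteq> 0"
    using e2 unfolding w crosses_def pair_plucker_edges by auto
  then have pos: "0 < \<gamma> * \<delta>" using e2 unfolding w by (rule crosses_plucker_iff[THEN iffD1])
  \<comment> \<open>The weights have equal signs, so their sum is nonzero and normalizing them gives
    a parameter strictly between 0 and 1.\<close>
  define s where "s = \<delta> / (\<gamma> + \<delta>)"
  have n0: "\<gamma> + \<delta> \<noteq> 0" using pos by (auto simp: zero_less_mult_iff)
  have s: "0 < s" "s < 1" using pos by (auto simp: s_def zero_less_mult_iff field_simps)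
  have "\<gamma> *s a2 + \<delta> *s b2 = (\<gamma> + \<delta>) *s p s"
  proof -
    have "(\<gamma> + \<delta>) * (1 - s) = \<gamma>" "(\<gamma> + \<delta>) * s = \<delta>" using n0 by (simp_all add: s_def field_simps)
    then show ?thesis by (simp only: p_def vector_add_ldistrib vector_smult_assoc)
  qed
  then have V2: "V = plucker (p s) ((\<gamma> + \<delta>) *s w)" using w by simp
  define w' where "w' = (\<gamma> + \<delta>) *s w"
  obtain \<alpha>' \<beta>' \<gamma>' \<delta>' where P': "\<alpha>' *s p s + \<beta>' *s w' = \<gamma>' *s a4 + \<delta>' *s b4" "\<alpha>' \<noteq> 0 \<or> \<beta>' \<noteq> 0"
  proof (rule bracket_eq_0_imp_meet)
    show "bracket (p s) w' a4 b4 = 0" using e4 V2 by (simp add: w'_def bracket_def)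
    show "plucker (p s) w' \<noteq> 0" using V V2 unfolding w'_def by metis
  qed (use pl in auto)
  \<comment> \<open>By skewness \<open>p s\<close> is not on the fourth line, so \<open>w'\<close>
    must contribute to the meeting point.\<close>
  have b0: "\<beta>' \<noteq> 0"
  proof
    assume b: "\<beta>' = 0"
    then have e: "\<alpha>' *s p s = \<gamma>' *s a4 + \<delta>' *s b4" and "\<alpha>' \<noteq> 0" using P' by auto
    have "\<alpha>' * bracket (p s) a4 x b4 = 0" for x
    proof -
      have "\<alpha>' * bracket (p s) a4 x b4 = bracket (\<alpha>' *s p s) a4 x b4" by simp
      also have "\<dots> = 0" unfolding e by simp
      finally show ?thesis .
    qed
    from this[of a2] show False using \<open>\<alpha>' \<noteq> 0\<close> s skew(2) by (simp add: bracket_p)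
  qed
  have "\<beta>' *s V = plucker (p s) (\<alpha>' *s p s + \<beta>' *s w')" by (simp add: V2[folded w'_def])
  then have V3: "\<beta>' *s V = \<gamma>' *s plucker (p s) a4 + \<delta>' *s plucker (p s) b4"
    by (simp add: P')
  have "\<beta>' * pair V (plucker a3 b3) = \<gamma>' * y1 s + \<delta>' * y2 s"
    using arg_cong[OF V3, of "\<lambda>z. pair z (plucker a3 b3)"]
    by (simp add: y1_def y2_def flip: bracket_def) (simp add: plucker_coords algebra_simps)
  then have rel: "\<gamma>' * y1 s + \<delta>' * y2 s = 0" using e3 by simp
  obtain t where t: "\<gamma>' = t * y2 s" "\<delta>' = - (t * y1 s)"
  proof (cases "y1 s = 0")
    case True
    then show ?thesis using that[of "\<gamma>' / y2 s"] y_nonzero[of s] rel by auto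
  next
    case False
    then show ?thesis using that[of "- \<delta>' / y1 s"] rel by (auto simp: field_simps eq_neg_iff_add_eq_0)
  qed
  have "\<beta>' *s V = t *s U s" unfolding V3 t U_y by (simp add: vec_eq_iff algebra_simps)
  then have VU: "V = (t / \<beta>') *s U s" using b0 by (simp add: vec_eq_iff field_simps)
  then have "t / \<beta>' \<noteq> 0" using V by auto
  then show ?thesis using that s VU by blast
qed

lemma card_hits: "card (hits k) = card (triple_tangents k)"
proof (rule bij_betw_same_card[of "\<lambda>s. vec.span {U s}"], rule bij_betw_imageI)
  show "inj_on (\<lambda>s. vec.span {U s}) (hits k)" using inj_span_U by (rule inj_on_subset) auto
  show "(\<lambda>s. vec.span {U s}) ` hits k = triple_tangents k"
  proof (intro subset_antisym subsetI)
    fix X assume "X \<in> (\<lambda>s. vec.span {U s}) ` hits k"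
    then obtain s where s: "s \<in> hits k" "X = vec.span {U s}" by blast
    then have "Q k s = 0" by (simp add: hits_def)
    then show "X \<in> triple_tangents k"
      using s crosses_U[of k s] pair_U(1)[of s] unfolding triple_tangents_def hits_def by auto
  next
    fix X assume "X \<in> triple_tangents k"
    then obtain V where V: "X = vec.span {V}" "pair V V = 0" "crosses (E k) (E (k + 1)) (E (k + 2)) V"
      "crosses (plucker a2 b2) (plucker b2 c2) (plucker c2 a2) V"
      "crosses (plucker a3 b3) (plucker b3 c3) (plucker c3 a3) V"
      "crosses (plucker a4 b4) (plucker b4 c4) (plucker c4 a4) V"
      unfolding triple_tangents_def by blast
    have "V \<noteq> 0" using V(3) by (auto simp: crosses_def)
    then obtain s c where s: "0 < s" "s < 1" "c \<noteq> 0" "V = c *s U s"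
      using transversal_imp_U V by (metis crosses_def)
    have cU: "crosses e f g V = crosses e f g (U s)" for e f g
      using s by (simp add: crosses_scale)
    have "Q k s = 0" using V(3) unfolding cU by (simp add: crosses_def Q_def)
    then have "s \<in> hits k" using V(3-6) s crosses_U[of k s] unfolding cU hits_def by simp
    moreover have "X = vec.span {U s}"
      unfolding V(1) using span_singleton_eq_iff[OF \<open>V \<noteq> 0\<close>] s by blast
    ultimately show "X \<in> (\<lambda>s. vec.span {U s}) ` hits k" by blast
  qed
qed

end

text \<open>Where \<open>p\<close>, \<open>c\<close>, \<open>d\<close>, \<open>m\<close> are
  coplanar, the Cramer relation shows that the ratio of \<open>bracket p c m n\<close> to
  \<open>bracket p d m n\<close> is the same for all admissible \<open>n\<close>. The two products
  to be compared thus multiply to a nonzero square and have the same sign.\<close>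

lemma vertex_events_cong:
  assumes "\<And>z. bracket ((1 - z) *s a + z *s b) c d m = 0 \<Longrightarrow>
      bracket ((1 - z) *s a + z *s b) c m n \<noteq> 0 \<and> bracket ((1 - z) *s a + z *s b) d m n \<noteq> 0"
    and "\<And>z. bracket ((1 - z) *s a + z *s b) c d m = 0 \<Longrightarrow>
      bracket ((1 - z) *s a + z *s b) c m n' \<noteq> 0 \<and> bracket ((1 - z) *s a + z *s b) d m n' \<noteq> 0"
  shows "vertex_events E a b c d m n = vertex_events E a b c d m n'"
proof -
  have "bracket p c m n * bracket p d m n < 0 \<longleftrightarrow> bracket p c m n' * bracket p d m n' < 0"
    if "bracket p c d m = 0" "bracket p c m n \<noteq> 0 \<and> bracket p d m n \<noteq> 0"
      "bracket p c m n' \<noteq> 0 \<and> bracket p d m n' \<noteq> 0" for p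
  proof -
    have "bracket p c m n * bracket p d m n' = bracket p d m n * bracket p c m n'"
      using arg_cong[OF bracket_cramer[of c d m n p], of "\<lambda>w. bracket p w m n'"] that(1)
      by simp
    then have "(bracket p c m n * bracket p d m n) * (bracket p c m n' * bracket p d m n') =
        (bracket p c m n * bracket p d m n')\<^sup>2"
      by (simp add: power2_eq_square mult_ac)
    then have "0 < (bracket p c m n * bracket p d m n) * (bracket p c m n' * bracket p d m n')"
      using that by simp
    then show ?thesis by (metis less_asym zero_less_mult_iff)
  qed
  then show ?thesis
    using assms unfolding vertex_events_def Let_def by blast
qed

lemma (in edge_triple) vertex_brackets_nonzero:
  "bracket (p z) a3 b3 a4 = 0 \<Longrightarrow> bracket (p z) a3 a4 b4 \<noteq> 0 \<and> bracket (p z) b3 a4 b4 \<noteq> 0"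
  "bracket (p z) a3 b3 b4 = 0 \<Longrightarrow> bracket (p z) a3 b4 a4 \<noteq> 0 \<and> bracket (p z) b3 b4 a4 \<noteq> 0"
  "bracket (p z) a4 b4 a3 = 0 \<Longrightarrow> bracket (p z) a4 a3 b3 \<noteq> 0 \<and> bracket (p z) b4 a3 b3 \<noteq> 0"
  "bracket (p z) a4 b4 b3 = 0 \<Longrightarrow> bracket (p z) a4 b3 a3 \<noteq> 0 \<and> bracket (p z) b4 b3 a3 \<noteq> 0"
proof -
  have sw: "bracket (p z) a4 b4 m = bracket (p z) m a4 b4" "bracket (p z) m n a3 = bracket (p z) a3 m n"
    "bracket (p z) m b3 a3 = - bracket (p z) a3 b3 m" "bracket (p z) m b4 a4 = - bracket (p z) m a4 b4"
    "bracket (p z) m a3 b3 = bracket (p z) a3 b3 m" for m n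
    by (simp_all add: plucker_coords algebra_simps)
  show "bracket (p z) a3 b3 a4 = 0 \<Longrightarrow> bracket (p z) a3 a4 b4 \<noteq> 0 \<and> bracket (p z) b3 a4 b4 \<noteq> 0"
    "bracket (p z) a3 b3 b4 = 0 \<Longrightarrow> bracket (p z) a3 b4 a4 \<noteq> 0 \<and> bracket (p z) b3 b4 a4 \<noteq> 0"
    using yh_nonzero[of z] unfolding y1_def y2_def h1_def h2_def sw(4) by auto
  show "bracket (p z) a4 b4 a3 = 0 \<Longrightarrow> bracket (p z) a4 a3 b3 \<noteq> 0 \<and> bracket (p z) b4 a3 b3 \<noteq> 0"
    using yh_nonzero[of z] unfolding y1_def y2_def h1_def h2_def sw(1) sw(5) by auto
  show "bracket (p z) a4 b4 b3 = 0 \<Longrightarrow> bracket (p z) a4 b3 a3 \<noteq> 0 \<and> bracket (p z) b4 b3 a3 \<noteq> 0"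
    using yh_nonzero[of z] unfolding y1_def y2_def h1_def h2_def sw(1) sw(3) by auto
qed

section \<open>Summation over the edges\<close>

text \<open>The edge opposite to vertex \<open>j\<close>. Addition in the type \<open>3\<close> is
  cyclic, which yields the orientation that \<open>crosses\<close> expects.\<close>

definition edge :: "(3 \<Rightarrow> real^4) \<Rightarrow> 3 \<Rightarrow> real^6" where
  "edge v j = plucker (v (j + 1)) (v (j + 2))"

definition tangents :: "(4 \<Rightarrow> 3 \<Rightarrow> real^6) \<Rightarrow> (4 \<Rightarrow> 3) \<Rightarrow> (real^6) set set" where
  "tangents E j = {vec.span {V} |V. pair V V = 0 \<and>
     (\<forall>i. crosses (E i (j i)) (E i (j i + 1)) (E i (j i + 2)) V)}"

text \<open>No real transversal of the chosen edges meets a further edge, and none is a double solution of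
  the quadratic equation that determines the transversals.\<close>

definition regular :: "(4 \<Rightarrow> 3 \<Rightarrow> real^6) \<Rightarrow> (4 \<Rightarrow> 3) \<Rightarrow> bool" where
  "regular E j \<longleftrightarrow> (\<forall>U. U \<noteq> 0 \<and> pair U U = 0 \<and> (\<forall>i. pair U (E i (j i)) = 0) \<longrightarrow>
     (\<forall>i k. k \<noteq> j i \<longrightarrow> pair U (E i k) \<noteq> 0) \<and>
     (\<forall>W. (\<forall>i. pair W (E i (j i)) = 0) \<and> pair U W = 0 \<longrightarrow> W \<in> vec.span {U}))"

definition quad :: "'a \<Rightarrow> 'a \<Rightarrow> 'a \<Rightarrow> 'a \<Rightarrow> 4 \<Rightarrow> 'a" where
  "quad a b c d i = (if i = 1 then a else if i = 2 then b else if i = 3 then c else d)"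

lemma quad_nth [simp]: "quad a b c d 1 = a" "quad a b c d 2 = b" "quad a b c d 3 = c" "quad a b c d 4 = d"
  by (simp_all add: quad_def)

lemma add_mod3:
  "(j::3) + 1 + 1 = j + 2" "(j::3) + 1 + 2 = j" "(j::3) + 2 + 1 = j" "(j::3) + 2 + 2 = j + 1"
  "j + 1 \<noteq> j" "j + 2 \<noteq> j"
  using exhaust_3[of j] by auto

lemma sum_shift3: "(\<Sum>j\<in>UNIV. f ((j::3) + 1)) = (\<Sum>j\<in>UNIV. f j)" "(\<Sum>j\<in>UNIV. f ((j::3) + 2)) = (\<Sum>j\<in>UNIV. f j)"
  for f :: "3 \<Rightarrow> nat"
proof -
  have idx: "1 + 1 = (2::3)" "1 + 2 = (3::3)" "2 + 1 = (3::3)" "2 + 2 = (1::3)" "3 + 1 = (1::3)" "3 + 2 = (2::3)"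
    by simp_all
  show "(\<Sum>j\<in>UNIV. f (j + 1)) = (\<Sum>j\<in>UNIV. f j)" "(\<Sum>j\<in>UNIV. f (j + 2)) = (\<Sum>j\<in>UNIV. f j)"
    unfolding sum_3 idx by simp_all
qed

text \<open>The parities of the 27 triples of edges are added. Every vertex of the second triangle
  is an end of two edges, and every vertex of the third or fourth carries the same events for both
  of its edges, so all terms other than the tangents occur twice.\<close>

lemma even_sum_card_tangents:
  fixes v :: "4 \<Rightarrow> 3 \<Rightarrow> real^4"
  defines "E \<equiv> \<lambda>i. edge (v i)"
  assumes reg: "\<And>j. regular E j"
    and skew: "\<And>i i' k k'. \<lbrakk>i \<noteq> i'; i \<noteq> 1; i' \<noteq> 1\<rbrakk> \<Longrightarrow> pair (E i k) (E i' k') \<noteq> 0"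
    and generic: "\<And>i i' i'' k k' k''. \<lbrakk>i \<noteq> i'; i \<noteq> i''; i' \<noteq> i''; i \<noteq> 1; i' \<noteq> 1; i'' \<noteq> 1\<rbrakk> \<Longrightarrow>
      pair (E i k) (plucker (v i' k') (v i'' k'')) \<noteq> 0"
  shows "even (\<Sum>j2\<in>UNIV. \<Sum>j3\<in>UNIV. \<Sum>j4\<in>UNIV. \<Sum>k\<in>UNIV. card (tangents E (quad k j2 j3 j4)))"
proof -
  have trip: "edge_triple (E 1) (v 2 (j2 + 1)) (v 2 (j2 + 2)) (v 2 j2) (v 3 (j3 + 1)) (v 3 (j3 + 2)) (v 3 j3)
      (v 4 (j4 + 1)) (v 4 (j4 + 2)) (v 4 j4)" for j2 j3 j4
  proof -
    have e: "E i j = plucker (v i (j + 1)) (v i (j + 2))" "E i (j + 1) = plucker (v i (j + 2)) (v i j)"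
      "E i (j + 2) = plucker (v i j) (v i (j + 1))" for i j
      by (simp_all add: E_def edge_def add_mod3)
    have sw: "bracket x a b m = bracket a b x m" for x a b m :: "real^4"
      by (simp add: plucker_coords algebra_simps)
    have R: "regular E (quad k j2 j3 j4)" for k by (rule reg)
    show ?thesis
    proof
      show "bracket (v 2 (j2 + 1)) (v 2 (j2 + 2)) (v 3 (j3 + 1)) (v 3 (j3 + 2)) \<noteq> 0"
        "bracket (v 2 (j2 + 1)) (v 2 (j2 + 2)) (v 4 (j4 + 1)) (v 4 (j4 + 2)) \<noteq> 0"
        "bracket (v 3 (j3 + 1)) (v 3 (j3 + 2)) (v 4 (j4 + 1)) (v 4 (j4 + 2)) \<noteq> 0"
        using skew[of 2 3 j2 j3] skew[of 2 4 j2 j4] skew[of 3 4 j3 j4] by (simp_all add: bracket_def e)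
    next
      fix x m assume "x \<in> {v 2 (j2 + 1), v 2 (j2 + 2)}" "m \<in> {v 4 (j4 + 1), v 4 (j4 + 2)}"
      then show "bracket x (v 3 (j3 + 1)) (v 3 (j3 + 2)) m \<noteq> 0"
        using generic[of 3 2 4 j3] unfolding sw[of x] by (auto simp: bracket_def e)
    next
      fix x m assume "x \<in> {v 2 (j2 + 1), v 2 (j2 + 2)}" "m \<in> {v 3 (j3 + 1), v 3 (j3 + 2)}"
      then show "bracket x m (v 4 (j4 + 1)) (v 4 (j4 + 2)) \<noteq> 0"
        using generic[of 4 2 3 j4] unfolding bracket_swap(4)[of x] by (auto simp: bracket_def e)
    next
      fix m n assume "m \<in> {v 3 (j3 + 1), v 3 (j3 + 2)}" "n \<in> {v 4 (j4 + 1), v 4 (j4 + 2)}"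
      then show "bracket (v 2 (j2 + 1)) (v 2 (j2 + 2)) m n \<noteq> 0"
        using generic[of 2 3 4 j2] by (auto simp: bracket_def e)
    next
      fix k U
      let ?t = "U \<noteq> 0 \<and> pair U U = 0 \<and> pair U (E 1 k) = 0 \<and> pair U (plucker (v 2 (j2 + 1)) (v 2 (j2 + 2))) = 0 \<and>
        pair U (plucker (v 3 (j3 + 1)) (v 3 (j3 + 2))) = 0 \<and> pair U (plucker (v 4 (j4 + 1)) (v 4 (j4 + 2))) = 0"
      assume t: ?t
      then have *: "U \<noteq> 0 \<and> pair U U = 0 \<and> (\<forall>i. pair U (E i (quad k j2 j3 j4 i)) = 0)"
        by (simp add: forall_4 e(1)[of 2] e(1)[of 3] e(1)[of 4])
      then have **: "\<forall>i l. l \<noteq> quad k j2 j3 j4 i \<longrightarrow> pair U (E i l) \<noteq> 0"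
        using R[of k] unfolding regular_def by blast
      show "(\<forall>l. l \<noteq> k \<longrightarrow> pair U (E 1 l) \<noteq> 0) \<and>
          pair U (plucker (v 2 (j2 + 2)) (v 2 j2)) \<noteq> 0 \<and> pair U (plucker (v 2 j2) (v 2 (j2 + 1))) \<noteq> 0 \<and>
          pair U (plucker (v 3 (j3 + 2)) (v 3 j3)) \<noteq> 0 \<and> pair U (plucker (v 3 j3) (v 3 (j3 + 1))) \<noteq> 0 \<and>
          pair U (plucker (v 4 (j4 + 2)) (v 4 j4)) \<noteq> 0 \<and> pair U (plucker (v 4 j4) (v 4 (j4 + 1))) \<noteq> 0"
        unfolding e(2,3)[symmetric] using **[unfolded forall_4 quad_nth] add_mod3(5,6) by simp
      fix W
      assume "pair W (E 1 k) = 0" "pair W (plucker (v 2 (j2 + 1)) (v 2 (j2 + 2))) = 0"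
        "pair W (plucker (v 3 (j3 + 1)) (v 3 (j3 + 2))) = 0" "pair W (plucker (v 4 (j4 + 1)) (v 4 (j4 + 2))) = 0"
        "pair U W = 0"
      then have "(\<forall>i. pair W (E i (quad k j2 j3 j4 i)) = 0) \<and> pair U W = 0"
        by (simp add: forall_4 e(1)[of 2] e(1)[of 3] e(1)[of 4])
      then show "W \<in> vec.span {U}" using R[of k] * unfolding regular_def by blast
    qed
  qed
  define T where "T k j2 j3 j4 = card (tangents E (quad k j2 j3 j4))" for k j2 j3 j4
  define g where "g x j3 j4 = (of_bool (joins (E 1) (v 2 x) (v 3 (j3 + 1)) (v 3 (j3 + 2)) (v 4 (j4 + 1)) (v 4 (j4 + 2))) :: nat)"
    for x j3 j4
  \<comment> \<open>The auxiliary vertex is fixed as \<open>m + 1\<close>, so that this number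
    refers to the vertex \<open>m\<close> alone and not to one of its edges.\<close>
  define X4 where "X4 j2 j3 m = card (vertex_events (E 1) (v 2 (j2 + 1)) (v 2 (j2 + 2))
     (v 3 (j3 + 1)) (v 3 (j3 + 2)) (v 4 m) (v 4 (m + 1)))" for j2 j3 m
  define X3 where "X3 j2 j4 m = card (vertex_events (E 1) (v 2 (j2 + 1)) (v 2 (j2 + 2))
     (v 4 (j4 + 1)) (v 4 (j4 + 2)) (v 3 m) (v 3 (m + 1)))" for j2 j4 m
  have par: "even (g (j2 + 1) j3 j4 + g (j2 + 2) j3 j4 + (X4 j2 j3 (j4 + 1) + X4 j2 j3 (j4 + 2)
      + X3 j2 j4 (j3 + 2) + X3 j2 j4 (j3 + 1) + (\<Sum>k\<in>UNIV. T k j2 j3 j4)))" for j2 j3 j4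
  proof -
    interpret edge_triple "E 1" "v 2 (j2 + 1)" "v 2 (j2 + 2)" "v 2 j2" "v 3 (j3 + 1)" "v 3 (j3 + 2)" "v 3 j3"
      "v 4 (j4 + 1)" "v 4 (j4 + 2)" "v 4 j4"
      "\<lambda>k U. U \<noteq> 0 \<and> pair U U = 0 \<and> pair U (E 1 k) = 0 \<and> pair U (plucker (v 2 (j2 + 1)) (v 2 (j2 + 2))) = 0 \<and>
        pair U (plucker (v 3 (j3 + 1)) (v 3 (j3 + 2))) = 0 \<and> pair U (plucker (v 4 (j4 + 1)) (v 4 (j4 + 2))) = 0"
      by (rule trip)
    have e: "E i j = plucker (v i (j + 1)) (v i (j + 2))" "E i (j + 1) = plucker (v i (j + 2)) (v i j)"
      "E i (j + 2) = plucker (v i j) (v i (j + 1))" for i j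
      by (simp_all add: E_def edge_def add_mod3)
    have "triple_tangents k = tangents E (quad k j2 j3 j4)" for k
      unfolding triple_tangents_def tangents_def forall_4 quad_nth e[of 2] e[of 3] e[of 4] add_mod3(1-4) ..
    then have hT: "card (hits k) = T k j2 j3 j4" for k
      by (simp add: card_hits T_def)
    have x4: "X4 j2 j3 (j4 + 1) = card (vertex_events (E 1) (v 2 (j2 + 1)) (v 2 (j2 + 2))
        (v 3 (j3 + 1)) (v 3 (j3 + 2)) (v 4 (j4 + 1)) (v 4 (j4 + 2)))"
      by (simp only: X4_def add_mod3)
    have x3: "X3 j2 j4 (j3 + 1) = card (vertex_events (E 1) (v 2 (j2 + 1)) (v 2 (j2 + 2))
        (v 4 (j4 + 1)) (v 4 (j4 + 2)) (v 3 (j3 + 1)) (v 3 (j3 + 2)))"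
      by (simp only: X3_def add_mod3)
    \<comment> \<open>For the end \<open>j4 + 2\<close> the parity statement uses the auxiliary
      vertex \<open>j4 + 1\<close>, whereas the fixed choice is \<open>j4\<close>. The inequalities
      for the latter come from the neighbouring edge \<open>j4 + 1\<close>, which joins
      \<open>j4 + 2\<close> and \<open>j4\<close>.\<close>
    have x4': "X4 j2 j3 (j4 + 2) = card (vertex_events (E 1) (v 2 (j2 + 1)) (v 2 (j2 + 2))
        (v 3 (j3 + 1)) (v 3 (j3 + 2)) (v 4 (j4 + 2)) (v 4 (j4 + 1)))"
      unfolding X4_def add_mod3
      by (rule arg_cong[where f = card], rule vertex_events_cong)
        (use edge_triple.vertex_brackets_nonzero(1)[OF trip[of j2 j3 "j4 + 1"], unfolded edge_triple.p_def[OF trip] add_mod3]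
          vertex_brackets_nonzero(2)[unfolded p_def] in blast)+
    have x3': "X3 j2 j4 (j3 + 2) = card (vertex_events (E 1) (v 2 (j2 + 1)) (v 2 (j2 + 2))
        (v 4 (j4 + 1)) (v 4 (j4 + 2)) (v 3 (j3 + 2)) (v 3 (j3 + 1)))"
      unfolding X3_def add_mod3
      by (rule arg_cong[where f = card], rule vertex_events_cong)
        (use edge_triple.vertex_brackets_nonzero(3)[OF trip[of j2 "j3 + 1" j4], unfolded edge_triple.p_def[OF trip] add_mod3]
          vertex_brackets_nonzero(4)[unfolded p_def] in blast)+
    show ?thesis
      using hit_parity unfolding g_def x3 x3' x4 x4' hT .
  qed
  have "even (\<Sum>j2\<in>UNIV. \<Sum>j3\<in>UNIV. \<Sum>j4\<in>UNIV. g (j2 + 1) j3 j4 + g (j2 + 2) j3 j4 + (X4 j2 j3 (j4 + 1) + X4 j2 j3 (j4 + 2)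
      + X3 j2 j4 (j3 + 2) + X3 j2 j4 (j3 + 1) + (\<Sum>k\<in>UNIV. T k j2 j3 j4)))"
    by (intro dvd_sum par)
  also have "(\<Sum>j2\<in>UNIV. \<Sum>j3\<in>UNIV. \<Sum>j4\<in>UNIV. g (j2 + 1) j3 j4 + g (j2 + 2) j3 j4 + (X4 j2 j3 (j4 + 1) + X4 j2 j3 (j4 + 2)
      + X3 j2 j4 (j3 + 2) + X3 j2 j4 (j3 + 1) + (\<Sum>k\<in>UNIV. T k j2 j3 j4))) =
      2 * (\<Sum>j2\<in>UNIV. \<Sum>j3\<in>UNIV. \<Sum>j4\<in>UNIV. g j2 j3 j4) + 2 * (\<Sum>j2\<in>UNIV. \<Sum>j3\<in>UNIV. \<Sum>j4\<in>UNIV. X4 j2 j3 j4)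
      + 2 * (\<Sum>j2\<in>UNIV. \<Sum>j3\<in>UNIV. \<Sum>j4\<in>UNIV. X3 j2 j4 j3) + (\<Sum>j2\<in>UNIV. \<Sum>j3\<in>UNIV. \<Sum>j4\<in>UNIV. \<Sum>k\<in>UNIV. T k j2 j3 j4)"
    unfolding sum.distrib
    using sum_shift3[of "\<lambda>x. \<Sum>j3\<in>UNIV. \<Sum>j4\<in>UNIV. g x j3 j4"] sum_shift3[of "X4 j2 j3" for j2 j3]
      sum_shift3[of "\<lambda>x. \<Sum>j4\<in>UNIV. X3 j2 j4 x" for j2]
    by simp
  finally show ?thesis unfolding T_def by simp
qed

section \<open>Perturbation\<close>

text \<open>The quadratic formula for isotropic vectors of the form
  \<open>K1 + \<rho> *s K2\<close>; the Boolean selects the root. The closed form makes continuity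
  in \<open>K1\<close> and \<open>K2\<close> evident.\<close>

definition root_sol :: "bool \<Rightarrow> real^6 \<Rightarrow> real^6 \<Rightarrow> real^6" where
  "root_sol s K1 K2 = K1 + ((- pair K1 K2 + (if s then 1 else - 1) *
     sqrt ((pair K1 K2)\<^sup>2 - pair K1 K1 * pair K2 K2)) / pair K2 K2) *s K2"

text \<open>Projectively, the kernel is a line in the space of line coordinates, meeting the Klein
  quadric in two different points, real or complex conjugate. As \<open>K2\<close> is not isotropic,
  every isotropic vector has a nonzero \<open>K1\<close> coefficient.\<close>

locale pencil =
  fixes E :: "4 \<Rightarrow> 3 \<Rightarrow> real^6" and j :: "4 \<Rightarrow> 3" and K1 K2 :: "real^6"
  assumes kernel: "\<And>U. (\<forall>i. pair U (E i (j i)) = 0) \<longleftrightarrow> (\<exists>a b. U = a *s K1 + b *s K2)"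
    and independent: "\<And>a b. a *s K1 + b *s K2 = 0 \<Longrightarrow> a = 0 \<and> b = 0"
    and nonisotropic: "pair K2 K2 \<noteq> 0"
    and discriminant: "(pair K1 K2)\<^sup>2 - pair K1 K1 * pair K2 K2 \<noteq> 0"
begin

abbreviation "A \<equiv> pair K1 K1"
abbreviation "B \<equiv> pair K1 K2"
abbreviation "C \<equiv> pair K2 K2"
definition "D = B\<^sup>2 - A * C"
definition "V s = root_sol s K1 K2"
definition "\<rho> s = (- B + (if s then 1 else - 1) * sqrt D) / C"

lemma V_rho: "V s = K1 + \<rho> s *s K2"
  by (simp add: V_def \<rho>_def root_sol_def D_def)

lemma pair_combination: "pair (a *s K1 + b *s K2) (x *s K1 + y *s K2) = a * x * A + (a * y + b * x) * B + b * y * C"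
  by (simp add: pair_commute[of K2 K1] algebra_simps)

lemma V_nonzero: "V s \<noteq> 0"
  using independent[of 1 "\<rho> s"] by (auto simp: V_rho)

lemma V_kernel: "pair (V s) (E i (j i)) = 0"
  using kernel[of "V s"] by (metis V_rho vec.scale_one)

lemma rho_quadratic:
  assumes "D > 0"
  shows "A + 2 * \<rho> s * B + (\<rho> s)\<^sup>2 * C = 0" "B + \<rho> s * C \<noteq> 0"
proof -
  have r: "B + \<rho> s * C = (if s then 1 else - 1) * sqrt D" using nonisotropic by (simp add: \<rho>_def)
  then show "B + \<rho> s * C \<noteq> 0" using assms by simp
  have "(B + \<rho> s * C)\<^sup>2 = D" unfolding r using assms by (simp add: power_mult_distrib)
  then have "C * (A + 2 * \<rho> s * B + (\<rho> s)\<^sup>2 * C) = 0"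
    by (simp add: D_def power2_eq_square algebra_simps)
  then show "A + 2 * \<rho> s * B + (\<rho> s)\<^sup>2 * C = 0" using nonisotropic by simp
qed

lemma V_isotropic: "D > 0 \<Longrightarrow> pair (V s) (V s) = 0"
  using pair_combination[of 1 "\<rho> s" 1 "\<rho> s"] rho_quadratic(1)[of s]
  by (simp add: V_rho power2_eq_square pair_commute[of K2 K1] algebra_simps)

text \<open>Completing the square: \<open>C\<close> times the form is
  \<open>(a * B + b * C)\<^sup>2 - a\<^sup>2 * D\<close>. A real zero forces
  \<open>a \<noteq> 0\<close> and \<open>D > 0\<close>, and the sign of the root gives
  \<open>s\<close>.\<close>

lemma isotropic_cases:
  assumes "U \<noteq> 0" "pair U U = 0" "\<forall>i. pair U (E i (j i)) = 0"
  obtains s a where "D > 0" "a \<noteq> 0" "U = a *s V s"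
proof -
  obtain a b where U: "U = a *s K1 + b *s K2" using kernel[of U] assms(3) by blast
  have q: "a * a * A + 2 * a * b * B + b * b * C = 0"
    using assms(2) pair_combination[of a b a b] by (simp add: U algebra_simps)
  have sq: "(a * B + b * C)\<^sup>2 = a\<^sup>2 * D"
  proof -
    have "(a * B + b * C)\<^sup>2 - a\<^sup>2 * D = C * (a * a * A + 2 * a * b * B + b * b * C)"
      by (simp add: D_def power2_eq_square algebra_simps)
    then show ?thesis using q by simp
  qed
  have a0: "a \<noteq> 0"
  proof
    assume "a = 0"
    then have "b = 0" using sq nonisotropic by simp
    then show False using \<open>a = 0\<close> U assms(1) by simp
  qed
  have "D \<ge> 0" using sq a0 by (metis zero_le_mult_iff zero_le_power2 zero_less_power2 not_less)
  then have D: "D > 0" using discriminant by (simp add: D_def)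
  have "\<bar>a * B + b * C\<bar> = \<bar>a\<bar> * sqrt D"
    using arg_cong[OF sq, of sqrt] by (simp add: real_sqrt_mult)
  then have "a * B + b * C = a * sqrt D \<or> a * B + b * C = - (a * sqrt D)"
    using D by (auto simp: abs_if split: if_splits)
  then obtain s where "a * B + b * C = a * ((if s then 1 else - 1) * sqrt D)"
    by (metis (full_types) minus_mult_left minus_mult_right mult_1)
  then have "b = a * \<rho> s" using nonisotropic by (simp add: \<rho>_def field_simps)
  then have "U = a *s V s" by (simp add: U V_rho vector_add_ldistrib vector_smult_assoc)
  then show ?thesis using that D a0 by blast
qed

text \<open>The nonzero discriminant already makes both roots simple, because the polar form with
  \<open>V s\<close> is a nonzero multiple of \<open>y - x * \<rho> s\<close>. What remains of
  regularity is a finite list of inequalities at two explicit vectors.\<close>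

lemma regular_iff:
  "regular E j \<longleftrightarrow> (D > 0 \<longrightarrow> (\<forall>s i k. k \<noteq> j i \<longrightarrow> pair (V s) (E i k) \<noteq> 0))"
proof
  assume "regular E j"
  then show "D > 0 \<longrightarrow> (\<forall>s i k. k \<noteq> j i \<longrightarrow> pair (V s) (E i k) \<noteq> 0)"
    using V_isotropic V_kernel V_nonzero unfolding regular_def by blast
next
  assume N: "D > 0 \<longrightarrow> (\<forall>s i k. k \<noteq> j i \<longrightarrow> pair (V s) (E i k) \<noteq> 0)"
  show "regular E j"
    unfolding regular_def
  proof (intro allI impI)
    fix U assume U: "U \<noteq> 0 \<and> pair U U = 0 \<and> (\<forall>i. pair U (E i (j i)) = 0)"
    then obtain s a where sa: "D > 0" "a \<noteq> 0" "U = a *s V s"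
      using isotropic_cases by metis
    have "\<forall>i k. k \<noteq> j i \<longrightarrow> pair U (E i k) \<noteq> 0" using N sa by simp
    moreover have "W \<in> vec.span {U}" if W: "(\<forall>i. pair W (E i (j i)) = 0) \<and> pair U W = 0" for W
    proof -
      obtain x y where xy: "W = x *s K1 + y *s K2" using kernel[of W] W by blast
      have "a * pair (V s) W = 0" using W sa by simp
      then have "pair (V s) W = 0" using sa(2) by simp
      then have "x * A + (y + \<rho> s * x) * B + \<rho> s * y * C = 0"
        using pair_combination[of 1 "\<rho> s" x y] by (simp add: V_rho xy)
      then have "(y - x * \<rho> s) * (B + \<rho> s * C) = 0"
        using rho_quadratic(1)[OF sa(1), of s] by algebra
      then have "y = x * \<rho> s" using rho_quadratic(2)[OF sa(1)] by simp
      then have "W = (x / a) *s U" using sa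
        by (simp add: xy V_rho vector_add_ldistrib vector_smult_assoc)
      then show ?thesis by (auto simp: vec.span_singleton)
    qed
    ultimately show "(\<forall>i k. k \<noteq> j i \<longrightarrow> pair U (E i k) \<noteq> 0) \<and>
        (\<forall>W. (\<forall>i. pair W (E i (j i)) = 0) \<and> pair U W = 0 \<longrightarrow> W \<in> vec.span {U})" by blast
  qed
qed

lemma span_V_eq:
  assumes "D > 0" "vec.span {V s} = vec.span {V s'}"
  shows "s = s'"
proof -
  obtain c where "V s = c *s V s'" using span_singleton_eq_iff[OF V_nonzero] assms(2) by blast
  then have "(1 - c) *s K1 + (\<rho> s - c * \<rho> s') *s K2 = 0"
    by (simp add: V_rho vec_eq_iff algebra_simps)
  then have "1 - c = 0 \<and> \<rho> s - c * \<rho> s' = 0" by (rule independent)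
  then have "\<rho> s = \<rho> s'" by simp
  then have "(if s then 1 else - 1) * sqrt D = (if s' then 1 else - 1) * sqrt D"
    using nonisotropic by (simp add: \<rho>_def)
  then show ?thesis using assms(1) by (auto split: if_splits)
qed

definition "good s \<longleftrightarrow> D > 0 \<and> (\<forall>i. 0 < pair (V s) (E i (j i + 1)) * pair (V s) (E i (j i + 2)))"

lemma tangents_eq: "tangents E j = (\<lambda>s. vec.span {V s}) ` {s. good s}"
proof (intro subset_antisym subsetI)
  fix X assume "X \<in> tangents E j"
  then obtain U where U: "X = vec.span {U}" "pair U U = 0"
    "\<forall>i. crosses (E i (j i)) (E i (j i + 1)) (E i (j i + 2)) U" unfolding tangents_def by blast
  have "U \<noteq> 0" using U(3) by (auto simp: crosses_def)
  moreover have "\<forall>i. pair U (E i (j i)) = 0" using U(3) by (auto simp: crosses_def)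
  ultimately obtain s a where sa: "D > 0" "a \<noteq> 0" "U = a *s V s"
    using isotropic_cases U(2) by metis
  have "good s" using U(3) sa(1) unfolding sa(3) crosses_scale[OF sa(2)] by (simp add: good_def crosses_def)
  moreover have "X = vec.span {V s}" unfolding U(1)
    using span_singleton_eq_iff[OF \<open>U \<noteq> 0\<close>] sa by blast
  ultimately show "X \<in> (\<lambda>s. vec.span {V s}) ` {s. good s}" by blast
next
  fix X assume "X \<in> (\<lambda>s. vec.span {V s}) ` {s. good s}"
  then obtain s where "good s" "X = vec.span {V s}" by blast
  then show "X \<in> tangents E j"
    unfolding tangents_def good_def crosses_def using V_isotropic V_kernel by blast
qed

lemma finite_tangents: "finite (tangents E j)"
  by (simp add: tangents_eq)

lemma card_tangents: "card (tangents E j) = card {s. good s}"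
  unfolding tangents_eq
  by (rule card_image, rule inj_onI) (use span_V_eq good_def in blast)

end

section \<open>Continuous dependence on the edges\<close>

lemma isCont_det:
  fixes M :: "real \<Rightarrow> real^'n^'n"
  assumes "\<And>i j. isCont (\<lambda>t. M t $ i $ j) x"
  shows "isCont (\<lambda>t. det (M t)) x"
  unfolding det_def by (intro continuous_intros assms)

lemma isCont_vecI:
  fixes f :: "real \<Rightarrow> real^'n"
  assumes "\<And>i. isCont (\<lambda>t. f t $ i) x"
  shows "isCont f x"
  using assms unfolding isCont_def by (intro vec_tendstoI)

lemma isCont_pair:
  fixes f g :: "real \<Rightarrow> real^6"
  assumes "isCont f x" "isCont g x"
  shows "isCont (\<lambda>t. pair (f t) (g t)) x"
  unfolding pair_def by (intro continuous_intros assms)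

lemma isCont_smult:
  fixes f :: "real \<Rightarrow> real" and g :: "real \<Rightarrow> real^'n"
  assumes "isCont f x" "isCont g x"
  shows "isCont (\<lambda>t. f t *s g t) x"
  unfolding scalar_mult_eq_scaleR by (intro continuous_intros assms)

lemma eventually_isCont_nonzero:
  fixes f :: "real \<Rightarrow> real"
  assumes "isCont f 0" "f 0 \<noteq> 0"
  shows "eventually (\<lambda>t. f t \<noteq> 0 \<and> (0 < f t \<longleftrightarrow> 0 < f 0)) (nhds 0)"
proof -
  have "(f \<longlongrightarrow> f 0) (nhds 0)" using assms(1) by (simp add: isCont_def tendsto_at_iff_tendsto_nhds)
  then show ?thesis
    using assms(2) order_tendstoD[of f "f 0" "nhds 0" 0]
    by (cases "f 0 > 0") (auto elim!: eventually_mono)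
qed

text \<open>The kernel basis is moved continuously by solving, with Cramer's rule, the linear system
  obtained by adding the two Euclidean products with the initial basis to the four conditions.\<close>

lemma kernel_basis_continuous:
  fixes c :: "real \<Rightarrow> 4 \<Rightarrow> real^6" and k1 k2 :: "real^6"
  assumes cont: "\<And>i. isCont (\<lambda>t. c t i) 0"
    and ker: "\<And>U. (\<forall>i. pair U (c 0 i) = 0) \<longleftrightarrow> (\<exists>a b. U = a *s k1 + b *s k2)"
    and orth: "inner k1 k2 = 0" "k1 \<noteq> 0" "k2 \<noteq> 0"
  obtains K1 K2 where "isCont K1 0" "isCont K2 0" "K1 0 = k1" "K2 0 = k2"
    "eventually (\<lambda>t. (\<forall>U. (\<forall>i. pair U (c t i) = 0) \<longleftrightarrow> (\<exists>a b. U = a *s K1 t + b *s K2 t)) \<and>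
       (\<forall>a b. a *s K1 t + b *s K2 t = 0 \<longrightarrow> a = 0 \<and> b = 0)) (nhds 0)"
proof -
  \<comment> \<open>Exchanging the two halves turns \<open>pair\<close> into the inner product, so
    the four conditions become rows of a matrix.\<close>
  define J :: "real^6 \<Rightarrow> real^6" where "J V = vec6 (V$4) (V$5) (V$6) (V$1) (V$2) (V$3)" for V
  define M :: "real \<Rightarrow> real^6^6" where
    "M t = vec6 (J (c t 1)) (J (c t 2)) (J (c t 3)) (J (c t 4)) k1 k2" for t
  have UNIV_6: "(UNIV :: 6 set) = {1, 2, 3, 4, 5, 6}" using exhaust_6 by auto
  have inner6: "inner x y = x$1 * y$1 + x$2 * y$2 + x$3 * y$3 + x$4 * y$4 + x$5 * y$5 + x$6 * y$6" for x y :: "real^6"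
    unfolding inner_vec_def UNIV_6 by (simp add: algebra_simps)
  have JU: "inner (J V) U = pair U V" for U V by (simp add: inner6 J_def pair_def algebra_simps)
  have MU: "M t *v U = vec6 (pair U (c t 1)) (pair U (c t 2)) (pair U (c t 3)) (pair U (c t 4))
      (inner k1 U) (inner k2 U)" for t U
    unfolding matrix_mult_dot vec6_eq_iff by (simp add: M_def JU)
  define sol where "sol b t = (\<chi> k. det (\<chi> i j. if j = k then b$i else M t $ i $ j) / det (M t))" for b t
  \<comment> \<open>A vector killed by \<open>M 0\<close> lies in the span of \<open>k1\<close> and
    \<open>k2\<close> and is orthogonal to both.\<close>
  have d0: "det (M 0) \<noteq> 0"
  proof -
    have "U = 0" if "M 0 *v U = 0" for U
    proof -
      have "\<forall>i. pair U (c 0 i) = 0" and i: "inner k1 U = 0" "inner k2 U = 0"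
        using that unfolding MU by (simp_all add: vec6_eq_iff forall_4)
      then obtain a b where U: "U = a *s k1 + b *s k2" using ker by blast
      have "inner U U = a * inner k1 U + b * inner k2 U"
        by (simp add: U scalar_mult_eq_scaleR inner_add_left)
      then show ?thesis using i by simp
    qed
    then have "invertible (M 0)" by (metis invertible_left_inverse matrix_left_invertible_ker)
    then show ?thesis by (simp add: invertible_det_nz)
  qed
  have Mcont: "isCont (\<lambda>t. M t $ i $ l) 0" for i l
  proof -
    have "isCont (\<lambda>t. c t i $ l) 0" for i l using cont[of i] by (intro continuous_intros)
    then show ?thesis
      using exhaust_6[of i] exhaust_6[of l] by (elim disjE) (simp_all add: M_def J_def)
  qed
  have solcont: "isCont (sol b) 0" for b
  proof (rule isCont_vecI)
    fix k
    have "isCont (\<lambda>t. (\<chi> i l. if l = k then b$i else M t $ i $ l) $ i $ l) 0" for i l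
      using Mcont[of i l] by (cases "l = k") simp_all
    then have "isCont (\<lambda>t. det (\<chi> i l. if l = k then b$i else M t $ i $ l)) 0" by (rule isCont_det)
    then have "isCont (\<lambda>t. det (\<chi> i l. if l = k then b$i else M t $ i $ l) / det (M t)) 0"
      using isCont_det[OF Mcont] d0 by (intro continuous_intros) auto
    then show "isCont (\<lambda>t. sol b t $ k) 0" by (simp add: sol_def)
  qed
  have sol_iff: "M t *v U = b \<longleftrightarrow> U = sol b t" if "det (M t) \<noteq> 0" for t U b
    unfolding sol_def using that by (rule cramer)
  define K1 where "K1 = sol (vec6 0 0 0 0 (inner k1 k1) 0)"
  define K2 where "K2 = sol (vec6 0 0 0 0 0 (inner k2 k2))"
  have k: "\<forall>i. pair k1 (c 0 i) = 0" "\<forall>i. pair k2 (c 0 i) = 0"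
    using ker[of k1] ker[of k2] by (metis add.right_neutral vec.scale_one vec.scale_zero_left,
      metis add.left_neutral vec.scale_one vec.scale_zero_left)
  show ?thesis
  proof (rule that)
    show "isCont K1 0" "isCont K2 0" unfolding K1_def K2_def by (rule solcont)+
    show "K1 0 = k1" unfolding K1_def
      using sol_iff[OF d0, of k1 "vec6 0 0 0 0 (inner k1 k1) 0"] k orth(1) MU[of 0 k1]
      by (simp add: inner_commute)
    show "K2 0 = k2" unfolding K2_def
      using sol_iff[OF d0, of k2 "vec6 0 0 0 0 0 (inner k2 k2)"] k orth(1) MU[of 0 k2]
      by simp
    have "eventually (\<lambda>t. det (M t) \<noteq> 0) (nhds 0)"
      using eventually_isCont_nonzero[OF isCont_det[OF Mcont] d0] by (rule eventually_mono) simp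
    then show "eventually (\<lambda>t. (\<forall>U. (\<forall>i. pair U (c t i) = 0) \<longleftrightarrow> (\<exists>a b. U = a *s K1 t + b *s K2 t)) \<and>
       (\<forall>a b. a *s K1 t + b *s K2 t = 0 \<longrightarrow> a = 0 \<and> b = 0)) (nhds 0)"
    proof (rule eventually_mono)
      fix t assume dt: "det (M t) \<noteq> 0"
      have MK: "M t *v K1 t = vec6 0 0 0 0 (inner k1 k1) 0" "M t *v K2 t = vec6 0 0 0 0 0 (inner k2 k2)"
        using sol_iff[OF dt] by (simp_all add: K1_def K2_def)
      have comb: "M t *v (a *s K1 t + b *s K2 t) = vec6 0 0 0 0 (a * inner k1 k1) (b * inner k2 k2)" for a b
        by (simp add: matrix_vector_right_distrib vec.scale MK vec6_eq_iff)
      have "(\<forall>i. pair U (c t i) = 0) \<longleftrightarrow> (\<exists>a b. U = a *s K1 t + b *s K2 t)" for U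
      proof
        assume "\<forall>i. pair U (c t i) = 0"
        then have "M t *v U = M t *v ((inner k1 U / inner k1 k1) *s K1 t + (inner k2 U / inner k2 k2) *s K2 t)"
          unfolding comb using orth by (simp add: MU)
        then show "\<exists>a b. U = a *s K1 t + b *s K2 t" using sol_iff[OF dt] by metis
      next
        assume "\<exists>a b. U = a *s K1 t + b *s K2 t"
        then obtain a b where U: "U = a *s K1 t + b *s K2 t" by blast
        have "M t *v U = vec6 0 0 0 0 (a * inner k1 k1) (b * inner k2 k2)"
          unfolding U by (rule comb)
        then show "\<forall>i. pair U (c t i) = 0" unfolding MU by (simp add: forall_4 vec6_eq_iff)
      qed
      moreover have "a = 0 \<and> b = 0" if "a *s K1 t + b *s K2 t = 0" for a b
      proof -
        have z: "vec6 0 0 0 0 (a * inner k1 k1) (b * inner k2 k2) = 0" using comb[of a b] unfolding that by simp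
        show ?thesis
          using arg_cong[OF z, of "\<lambda>x. x$5"] arg_cong[OF z, of "\<lambda>x. x$6"] orth by simp
      qed
      ultimately show "(\<forall>U. (\<forall>i. pair U (c t i) = 0) \<longleftrightarrow> (\<exists>a b. U = a *s K1 t + b *s K2 t)) \<and>
       (\<forall>a b. a *s K1 t + b *s K2 t = 0 \<longrightarrow> a = 0 \<and> b = 0)" by blast
    qed
  qed
qed

lemma isCont_root_sol:
  assumes "isCont K1 (x::real)" "isCont K2 x" "pair (K2 x) (K2 x) \<noteq> 0"
  shows "isCont (\<lambda>t. root_sol s (K1 t) (K2 t)) x"
  unfolding root_sol_def using assms by (intro continuous_intros isCont_smult isCont_pair) auto

text \<open>The count depends only on the signs of finitely many nonzero continuous quantities: the
  discriminant and the products of the two roots with the remaining edges.\<close>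

lemma tangents_stable:
  fixes E :: "real \<Rightarrow> 4 \<Rightarrow> 3 \<Rightarrow> real^6"
  assumes cont: "\<And>i k. isCont (\<lambda>t. E t i k) 0"
    and pen: "pencil (E 0) j k1 k2" and reg: "regular (E 0) j"
  shows "eventually (\<lambda>t. regular (E t) j \<and> card (tangents (E t) j) = card (tangents (E 0) j)) (nhds 0)"
proof -
  interpret p0: pencil "E 0" j k1 k2 by (rule pen)
  \<comment> \<open>Orthogonalization that alters only the first basis vector: \<open>k2\<close>
    must stay non-isotropic, and such a shear preserves the discriminant.\<close>
  define l where "l = inner k1 k2 / inner k2 k2"
  define k where "k = k1 - l *s k2"
  have k20: "k2 \<noteq> 0" using p0.nonisotropic by auto
  have k0: "k \<noteq> 0" using p0.independent[of 1 "- l"] by (auto simp: k_def)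
  have orth: "inner k k2 = 0" using k20
    by (simp add: k_def l_def scalar_mult_eq_scaleR inner_diff_left)
  have shift: "a *s k + b *s k2 = a *s k1 + (b - a * l) *s k2" for a b
    by (simp add: k_def vec_eq_iff algebra_simps)
  have shift': "a *s k1 + b *s k2 = a *s k + (b + a * l) *s k2" for a b
    by (simp add: k_def vec_eq_iff algebra_simps)
  have pen': "pencil (E 0) j k k2"
  proof
    show "(\<forall>i. pair U (E 0 i (j i)) = 0) \<longleftrightarrow> (\<exists>a b. U = a *s k + b *s k2)" for U
      unfolding p0.kernel using shift shift' by metis
    show "a = 0 \<and> b = 0" if "a *s k + b *s k2 = 0" for a b
      using p0.independent[of a "b - a * l"] that shift by auto
    show "pair k2 k2 \<noteq> 0" by (rule p0.nonisotropic)
    have "(pair k k2)\<^sup>2 - pair k k * pair k2 k2 = (pair k1 k2)\<^sup>2 - pair k1 k1 * pair k2 k2"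
      by (simp add: k_def pair_commute[of k2 k1] power2_eq_square algebra_simps)
    then show "(pair k k2)\<^sup>2 - pair k k * pair k2 k2 \<noteq> 0" using p0.discriminant by simp
  qed
  interpret q: pencil "E 0" j k k2 by (rule pen')
  obtain K1 K2 where K: "isCont K1 0" "isCont K2 0" "K1 0 = k" "K2 0 = k2"
    and ev: "eventually (\<lambda>t. (\<forall>U. (\<forall>i. pair U (E t i (j i)) = 0) \<longleftrightarrow> (\<exists>a b. U = a *s K1 t + b *s K2 t)) \<and>
       (\<forall>a b. a *s K1 t + b *s K2 t = 0 \<longrightarrow> a = 0 \<and> b = 0)) (nhds 0)"
    using kernel_basis_continuous[of "\<lambda>t i. E t i (j i)" k k2, OF cont q.kernel orth k0 k20] by blast
  define d where "d t = (pair (K1 t) (K2 t))\<^sup>2 - pair (K1 t) (K1 t) * pair (K2 t) (K2 t)" for t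
  have "isCont d 0" unfolding d_def by (intro continuous_intros isCont_pair K)
  moreover have d0: "d 0 \<noteq> 0" using q.discriminant by (simp add: d_def K)
  ultimately have evd: "eventually (\<lambda>t. d t \<noteq> 0 \<and> (0 < d t \<longleftrightarrow> 0 < d 0)) (nhds 0)"
    by (rule eventually_isCont_nonzero)
  have evC: "eventually (\<lambda>t. pair (K2 t) (K2 t) \<noteq> 0 \<and> (0 < pair (K2 t) (K2 t) \<longleftrightarrow> 0 < pair (K2 0) (K2 0))) (nhds 0)"
    by (rule eventually_isCont_nonzero) (use isCont_pair[OF K(2) K(2)] q.nonisotropic K in auto)
  define f where "f s i m t = pair (root_sol s (K1 t) (K2 t)) (E t i m)" for s i m t
  have f0: "f s i m 0 \<noteq> 0" if "0 < d 0" "m \<noteq> j i" for s i m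
    using q.regular_iff[THEN iffD1, OF reg] that
    unfolding f_def K q.V_def[symmetric] q.D_def d_def by blast
  \<comment> \<open>With a negative discriminant there are no real roots to control; for
    \<open>m = j i\<close> the product is zero by construction.\<close>
  have evf: "eventually (\<lambda>t. \<forall>s i m. 0 < d 0 \<and> m \<noteq> j i \<longrightarrow> f s i m t \<noteq> 0 \<and> (0 < f s i m t \<longleftrightarrow> 0 < f s i m 0)) (nhds 0)"
  proof (intro eventually_all_finite)
    fix s i m
    show "eventually (\<lambda>t. 0 < d 0 \<and> m \<noteq> j i \<longrightarrow> f s i m t \<noteq> 0 \<and> (0 < f s i m t \<longleftrightarrow> 0 < f s i m 0)) (nhds 0)"
    proof (cases "0 < d 0 \<and> m \<noteq> j i")
      case True
      have "isCont (f s i m) 0" unfolding f_def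
        by (intro isCont_pair isCont_root_sol cont) (use K q.nonisotropic in auto)
      from eventually_isCont_nonzero[OF this] f0 True show ?thesis by (auto elim: eventually_mono)
    qed (rule always_eventually, blast)
  qed
  show ?thesis
    using ev evd evC evf
  proof eventually_elim
    case (elim t)
    interpret r: pencil "E t" j "K1 t" "K2 t"
      by unfold_locales (use elim in \<open>auto simp: d_def\<close>)
    have D: "r.D = d t" "q.D = d 0" by (simp_all add: r.D_def q.D_def d_def K)
    have fV: "pair (r.V s) (E t i m) = f s i m t" "pair (q.V s) (E 0 i m) = f s i m 0" for s i m
      by (simp_all add: f_def r.V_def q.V_def K)
    have "regular (E t) j" unfolding r.regular_iff D fV using elim by blast
    moreover have "r.good s \<longleftrightarrow> q.good s" for s
    proof (cases "0 < d 0")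
      case True
      have "0 < f s i (j i + 1) t * f s i (j i + 2) t \<longleftrightarrow> 0 < f s i (j i + 1) 0 * f s i (j i + 2) 0" for i
      proof -
        have "f s i m t \<noteq> 0" "f s i m 0 \<noteq> 0" "0 < f s i m t \<longleftrightarrow> 0 < f s i m 0" if "m = j i + 1 \<or> m = j i + 2" for m
          using elim True that f0[of m i s] add_mod3(5,6)[of "j i"] by blast+
        from this[of "j i + 1"] this[of "j i + 2"] show ?thesis
          unfolding zero_less_mult_iff by (auto simp: not_less)
      qed
      then show ?thesis unfolding r.good_def q.good_def D fV using elim True by blast
    next
      case False
      then show ?thesis unfolding r.good_def q.good_def D using elim by blast
    qed
    ultimately show ?case using r.card_tangents q.card_tangents by simp
  qed
qed

section \<open>A generic direction for moving the vertices\<close>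

definition moment :: "real \<Rightarrow> real^4" where
  "moment s = vector [1, s, s^2, s^3]"

text \<open>The Vandermonde determinant: four points of the moment curve with distinct parameters
  are independent.\<close>

lemma bracket_moment:
  "bracket (moment a) (moment b) (moment c) (moment d) =
    (b - a) * (c - a) * (d - a) * (c - b) * (d - b) * (d - c)"
  by (simp add: moment_def plucker_coords) algebra

lemma isCont_bracket:
  fixes a b c d :: "real \<Rightarrow> real^4"
  assumes "isCont a x" "isCont b x" "isCont c x" "isCont d x"
  shows "isCont (\<lambda>t. bracket (a t) (b t) (c t) (d t)) x"
  unfolding plucker_coords vec6_nth by (intro continuous_intros assms)

lemma isCont_plucker:
  fixes a b :: "real \<Rightarrow> real^4"
  assumes "isCont a x" "isCont b x"
  shows "isCont (\<lambda>t. plucker (a t) (b t)) x"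
proof (rule isCont_vecI)
  fix i
  show "isCont (\<lambda>t. plucker (a t) (b t) $ i) x"
    using exhaust_6[of i] unfolding plucker_def
    by (elim disjE) (simp_all, (intro continuous_intros assms)+)
qed

text \<open>The bracket is a polynomial in \<open>t\<close> whose coefficient of \<open>t^4\<close>
  is \<open>bracket a' b' c' d'\<close>. However degenerate the starting position, it therefore has
  only finitely many roots.\<close>

lemma eventually_bracket_nonzero:
  fixes a b c d a' b' c' d' :: "real^4"
  assumes "bracket a' b' c' d' \<noteq> 0"
  shows "eventually (\<lambda>t. bracket (a + t *s a') (b + t *s b') (c + t *s c') (d + t *s d') \<noteq> 0) (at 0)"
proof -
  let ?f = "\<lambda>t. bracket (a + t *s a') (b + t *s b') (c + t *s c') (d + t *s d')"
  let ?l = "\<lambda>(x::real^4) (x'::real^4). (\<chi> i. [:x$i, x'$i:]) :: real poly^4"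
  define P where "P = bracket (?l a a') (?l b b') (?l c c') (?l d d')"
  have P: "poly P t = ?f t" for t
    unfolding P_def plucker_coords vec6_nth poly_add poly_mult poly_diff vec_lambda_beta by simp
  have "P \<noteq> 0"
  proof
    assume "P = 0"
    then have z: "?f t = 0" for t using P[of t] by simp
    \<comment> \<open>The reversed polynomial: for \<open>u \<noteq> 0\<close> it is
      \<open>u^4\<close> times the value of \<open>?f\<close> at \<open>1/u\<close>, and its value
      at 0 is the leading coefficient of \<open>?f\<close>.\<close>
    let ?g = "\<lambda>u. bracket (u *s a + a') (u *s b + b') (u *s c + c') (u *s d + d')"
    have "?g u = 0" if "u \<noteq> 0" for u
    proof -
      have e: "u *s x + y = u *s (x + inverse u *s y)" for x y :: "real^4"
        using that by (simp add: vec_eq_iff algebra_simps)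
      have sc: "bracket (u *s p) (u *s q) (u *s r) (u *s s) = u * (u * (u * (u * bracket p q r s)))" for p q r s
        by simp
      show ?thesis unfolding e sc z by (simp only: mult_zero_right)
    qed
    moreover have "(?g \<longlongrightarrow> ?g 0) (at 0)"
    proof -
      have "isCont ?g 0"
        by (intro isCont_bracket) (intro continuous_intros isCont_smult)+
      then show ?thesis by (simp add: isCont_def)
    qed
    ultimately have "((\<lambda>u::real. 0::real) \<longlongrightarrow> ?g 0) (at 0)"
      by (rule_tac Lim_transform_eventually) (auto simp: eventually_at_filter)
    then have "?g 0 = 0" by (simp add: tendsto_const_iff)
    then show False using assms by simp
  qed
  then have "finite {t. ?f t = 0}" using poly_roots_finite[of P] by (simp add: P)
  then have "eventually (\<lambda>t. t \<notin> {t. ?f t = 0}) (at 0)" 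
    using islimpt_finite islimpt_iff_eventually by blast
  then show ?thesis by simp
qed

text \<open>Genericity holds for small \<open>t\<close> away from 0, while regularity and the 81
  counts persist in a whole neighbourhood of 0. A common \<open>t\<close> transfers the parity from
  the moved vertices to the given ones.\<close>

lemma even_sum_pencils:
  fixes v :: "4 \<Rightarrow> 3 \<Rightarrow> real^4"
  assumes pen: "\<And>j. \<exists>k1 k2. pencil (\<lambda>i. edge (v i)) j k1 k2" and reg: "\<And>j. regular (\<lambda>i. edge (v i)) j"
  shows "even (\<Sum>j\<in>UNIV. card (tangents (\<lambda>i. edge (v i)) j))"
proof -
  \<comment> \<open>An injective numbering gives the twelve vertices different parameters on the
    moment curve.\<close>
  obtain f :: "4 \<times> 3 \<Rightarrow> nat" where f: "inj f"
    using finite_imp_inj_to_nat_seg[of "UNIV :: (4 \<times> 3) set"] by auto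
  define w where "w i k = moment (real (f (i, k)))" for i k
  define x where "x t i k = v i k + t *s w i k" for t i k
  define E where "E t i = edge (x t i)" for t i
  have x0: "x 0 = v" by (simp add: x_def fun_eq_iff)
  have wbr: "bracket (w i k) (w i' k') (w i'' k'') (w m l) \<noteq> 0"
    if "distinct [(i, k), (i', k'), (i'', k''), (m, l)]" for i i' i'' m k k' k'' l
    using that by (auto simp: w_def bracket_moment inj_eq[OF f])
  have xbr: "eventually (\<lambda>t. bracket (x t i k) (x t i' k') (x t i'' k'') (x t m l) \<noteq> 0) (at 0)"
    if "distinct [(i, k), (i', k'), (i'', k''), (m, l)]" for i i' i'' m k k' k'' l
    unfolding x_def by (rule eventually_bracket_nonzero[OF wbr[OF that]])
  have 12: "k + 1 \<noteq> k + (2::3)" for k by simp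
  have ev1: "eventually (\<lambda>t. \<forall>i i' k k'. i \<noteq> i' \<longrightarrow> pair (E t i k) (E t i' k') \<noteq> 0) (at 0)"
  proof (intro eventually_all_finite)
    fix i i' k k'
    show "eventually (\<lambda>t. i \<noteq> i' \<longrightarrow> pair (E t i k) (E t i' k') \<noteq> 0) (at 0)"
      using xbr[of i "k + 1" i "k + 2" i' "k' + 1" i' "k' + 2"] 12
      by (cases "i = i'") (simp_all add: E_def edge_def flip: bracket_def)
  qed
  have ev2: "eventually (\<lambda>t. \<forall>i i' i'' k k' k''. i \<noteq> i' \<and> i \<noteq> i'' \<and> i' \<noteq> i'' \<longrightarrow>
      pair (E t i k) (plucker (x t i' k') (x t i'' k'')) \<noteq> 0) (at 0)"
  proof (intro eventually_all_finite)
    fix i i' i'' k k' k''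
    show "eventually (\<lambda>t. i \<noteq> i' \<and> i \<noteq> i'' \<and> i' \<noteq> i'' \<longrightarrow>
        pair (E t i k) (plucker (x t i' k') (x t i'' k'')) \<noteq> 0) (at 0)"
      using xbr[of i "k + 1" i "k + 2" i' k' i'' k''] 12
      by (cases "i \<noteq> i' \<and> i \<noteq> i'' \<and> i' \<noteq> i''") (simp_all add: E_def edge_def flip: bracket_def)
  qed
  have "isCont (\<lambda>t. E t i k) 0" for i k
    unfolding E_def edge_def x_def by (intro isCont_plucker) (intro continuous_intros isCont_smult)+
  moreover have E0: "E 0 = (\<lambda>i. edge (v i))" by (simp add: E_def x0 fun_eq_iff)
  ultimately have "eventually (\<lambda>t. regular (E t) j \<and> card (tangents (E t) j) = card (tangents (E 0) j)) (nhds 0)" for j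
    using pen[of j] reg[of j] tangents_stable[of E j] by (metis (no_types))
  then have "eventually (\<lambda>t. \<forall>j. regular (E t) j \<and> card (tangents (E t) j) = card (tangents (E 0) j)) (nhds 0)"
    by (rule eventually_all_finite)
  then have ev3: "eventually (\<lambda>t. \<forall>j. regular (E t) j \<and> card (tangents (E t) j) = card (tangents (E 0) j)) (at 0)"
    unfolding eventually_at_filter by (rule eventually_mono) simp
  obtain t where t: "\<forall>i i' k k'. i \<noteq> i' \<longrightarrow> pair (E t i k) (E t i' k') \<noteq> 0"
    "\<forall>i i' i'' k k' k''. i \<noteq> i' \<and> i \<noteq> i'' \<and> i' \<noteq> i'' \<longrightarrow> pair (E t i k) (plucker (x t i' k') (x t i'' k'')) \<noteq> 0"
    "\<forall>j. regular (E t) j \<and> card (tangents (E t) j) = card (tangents (E 0) j)"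
    using eventually_happens[OF eventually_conj[OF ev1 eventually_conj[OF ev2 ev3]]] by auto
  have "even (\<Sum>j2\<in>UNIV. \<Sum>j3\<in>UNIV. \<Sum>j4\<in>UNIV. \<Sum>k\<in>UNIV. card (tangents (E t) (quad k j2 j3 j4)))"
    unfolding E_def by (rule even_sum_card_tangents) (use t[unfolded E_def] in simp_all)
  then have ev: "even (\<Sum>j2\<in>UNIV. \<Sum>j3\<in>UNIV. \<Sum>j4\<in>UNIV. \<Sum>k\<in>UNIV. card (tangents (E 0) (quad k j2 j3 j4)))"
    using t(3) by simp
  have re: "(\<Sum>j2\<in>UNIV. \<Sum>j3\<in>UNIV. \<Sum>j4\<in>UNIV. \<Sum>k\<in>UNIV. g (quad k j2 j3 j4)) = (\<Sum>j\<in>UNIV. g j)" for g :: "(4 \<Rightarrow> 3) \<Rightarrow> nat"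
  proof -
    have b: "bij_betw (\<lambda>(j2, j3, j4, k). quad k j2 j3 j4) (UNIV \<times> UNIV \<times> UNIV \<times> UNIV) (UNIV :: (4 \<Rightarrow> 3) set)"
    proof (rule bij_betw_byWitness[where f' = "\<lambda>j. (j 2, j 3, j 4, j 1)"])
      show "\<forall>j\<in>UNIV. (case (j 2, j 3, j 4, j 1) of (j2, j3, j4, k) \<Rightarrow> quad k j2 j3 j4) = (j :: 4 \<Rightarrow> 3)"
        by (simp add: fun_eq_iff forall_4)
    qed auto
    show ?thesis
      using sum.reindex_bij_betw[OF b, of g] by (simp add: sum.cartesian_product case_prod_beta flip: UNIV_Times_UNIV)
  qed
  show ?thesis using ev re[of "\<lambda>j. card (tangents (E 0) j)"] by (simp only: E0)
qed

section \<open>Complex transversals\<close>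

lemma span_pair: "z \<in> vec.span {x, y} \<longleftrightarrow> (\<exists>a b. z = a *s x + b *s y)" for x y z :: "'a::field^'n"
  unfolding vec.span_insert vec.span_singleton by (auto simp: algebra_simps)

text \<open>The points incident with \<open>U\<close>: the wedge of \<open>U\<close> with
  \<open>z\<close> vanishes, tested against every further vector \<open>w\<close>.\<close>

definition line_of :: "'a::field^6 \<Rightarrow> ('a^4) set" where
  "line_of U = {z. \<forall>w. pair U (plucker z w) = 0}"

text \<open>\<open>u\<close> and \<open>w\<close> complete \<open>x\<close>, \<open>y\<close> to a
  basis; they exist because the brackets with pairs of axis vectors are, up to sign, the coordinates
  of \<open>plucker x y\<close>. By Cramer's relation an incident point has no component along
  \<open>u\<close> or \<open>w\<close>.\<close>

lemma line_of_plucker: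
  fixes x y :: "'a::field^4"
  assumes "plucker x y \<noteq> 0"
  shows "line_of (plucker x y) = vec.span {x, y}"
proof (intro subset_antisym subsetI)
  fix z assume "z \<in> vec.span {x, y}"
  then show "z \<in> line_of (plucker x y)"
    by (auto simp: span_pair line_of_def simp flip: bracket_def)
next
  fix z assume "z \<in> line_of (plucker x y)"
  then have z: "bracket x y z w = 0" for w by (simp add: line_of_def bracket_def)
  obtain u w where uw: "bracket x y u w \<noteq> 0"
  proof (rule ccontr)
    assume "\<not> thesis"
    then have "bracket x y (axis i 1) (axis j 1) = 0" for i j using that by blast
    from this[of 1 2] this[of 1 3] this[of 1 4] this[of 2 3] this[of 2 4] this[of 3 4]
    have "plucker x y = 0" by (simp add: plucker_coords axis_def vec6_eq_iff)
    then show False using assms by simp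
  qed
  have "bracket z x y m = 0" for m
    using z[of m] by (simp add: plucker_coords algebra_simps)
  then have "bracket x y u w *s z = bracket z y u w *s x - bracket z x u w *s y"
    using bracket_cramer[of x y u w z] by (simp add: algebra_simps eq_neg_iff_add_eq_0)
  then have "z = (bracket z y u w / bracket x y u w) *s x + (- bracket z x u w / bracket x y u w) *s y"
    using uw by (simp add: vec_eq_iff field_simps)
  then show "z \<in> vec.span {x, y}" unfolding span_pair by blast
qed

lemma line_of_scale: "c \<noteq> 0 \<Longrightarrow> line_of (c *s U) = line_of U"
  by (simp add: line_of_def)

lemma plucker_in_line:
  fixes U :: "'a::field_char_0^6"
  assumes "U \<noteq> 0" "pair U U = 0" "x \<in> line_of U" "y \<in> line_of U"
  obtains c where "plucker x y = c *s U"
proof -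
  obtain a b where U: "U = plucker a b" using isotropic_imp_plucker[OF assms(2)] .
  then have "x \<in> vec.span {a, b}" "y \<in> vec.span {a, b}" using assms line_of_plucker by blast+
  then obtain p q r s where "x = p *s a + q *s b" "y = r *s a + s *s b" by (auto simp: span_pair)
  then have "plucker x y = (p * s - q * r) *s plucker a b"
    by (simp add: plucker_def vec6_eq_iff algebra_simps)
  then show ?thesis using that U by blast
qed

lemma line_of_eq_iff:
  fixes U V :: "'a::field_char_0^6"
  assumes "U \<noteq> 0" "pair U U = 0" "V \<noteq> 0" "pair V V = 0"
  shows "line_of U = line_of V \<longleftrightarrow> (\<exists>c. c \<noteq> 0 \<and> U = c *s V)"
proof
  assume eq: "line_of U = line_of V"
  obtain a b where U: "U = plucker a b" using isotropic_imp_plucker[OF assms(2)] .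
  have "a \<in> line_of U" "b \<in> line_of U" by (simp_all add: U line_of_def flip: bracket_def)
  then obtain c where "plucker a b = c *s V" using plucker_in_line[OF assms(3,4)] eq by metis
  then show "\<exists>c. c \<noteq> 0 \<and> U = c *s V" using U assms(1) by auto
qed (auto simp: line_of_scale)

lemma plucker_nonzero_iff_independent:
  fixes x y :: "'a::field^4"
  shows "plucker x y \<noteq> 0 \<longleftrightarrow> x \<noteq> y \<and> vec.independent {x, y}"
proof
  assume pl: "plucker x y \<noteq> 0"
  then have "x \<noteq> y" "y \<noteq> 0" by auto
  moreover have "x \<notin> vec.span {y}"
  proof
    assume "x \<in> vec.span {y}"
    then obtain c where "x = c *s y" by (auto simp: vec.span_singleton)
    then show False using pl by simp
  qed
  ultimately show "x \<noteq> y \<and> vec.independent {x, y}"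
    by (simp add: vec.independent_insert)
next
  assume ind: "x \<noteq> y \<and> vec.independent {x, y}"
  show "plucker x y \<noteq> 0"
  proof
    assume "plucker x y = 0"
    then obtain a b where ab: "a *s x + b *s y = 0" "a \<noteq> 0 \<or> b \<noteq> 0"
      using plucker_eq_0_imp_dependent by blast
    have "x \<notin> vec.span {y}" "y \<noteq> 0" using ind by (auto simp: vec.independent_insert)
    moreover have "x \<in> vec.span {y}" if "a \<noteq> 0"
    proof -
      have "x = (- b / a) *s y"
        using ab(1) that by (simp add: vec_eq_iff field_simps eq_neg_iff_add_eq_0)
      then show ?thesis by (metis rangeI vec.span_singleton)
    qed
    ultimately have "a = 0" by blast
    then show False using ab \<open>y \<noteq> 0\<close> by simp
  qed
qed

text \<open>The Klein correspondence: isotropic vectors are exactly the wedges, and a wedge is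
  nonzero exactly for independent vectors.\<close>

lemma CP3_line_iff: "CP3_line M \<longleftrightarrow> (\<exists>U. U \<noteq> 0 \<and> pair U U = 0 \<and> M = line_of U)"
proof
  assume M: "CP3_line M"
  obtain B where B: "B \<subseteq> M" "vec.independent B" "M \<subseteq> vec.span B" "card B = vec.dim M"
    using vec.basis_exists by blast
  have "card B = 2" using M B by (simp add: CP3_line_def)
  then obtain x y where xy: "B = {x, y}" "x \<noteq> y" by (auto simp: card_2_iff)
  have "plucker x y \<noteq> 0" using B xy by (simp add: plucker_nonzero_iff_independent)
  moreover have "M = vec.span {x, y}" using B M xy unfolding CP3_line_def
    by (metis subset_antisym vec.span_minimal)
  ultimately show "\<exists>U. U \<noteq> 0 \<and> pair U U = 0 \<and> M = line_of U"
    using line_of_plucker pair_plucker_self by metis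
next
  assume "\<exists>U. U \<noteq> 0 \<and> pair U U = 0 \<and> M = line_of U"
  then obtain U where U: "U \<noteq> 0" "pair U U = 0" "M = line_of U" by blast
  obtain x y where xy: "U = plucker x y" using isotropic_imp_plucker[OF U(2)] .
  have M: "M = vec.span {x, y}" using U xy line_of_plucker by blast
  have "x \<noteq> y \<and> vec.independent {x, y}" using U xy plucker_nonzero_iff_independent by blast
  then have "vec.dim M = 2" unfolding M by (simp add: vec.dim_eq_card_independent)
  then show "CP3_line M" by (simp add: CP3_line_def M)
qed

lemma CP3_meet_iff:
  assumes "U \<noteq> 0" "pair U U = 0" "plucker a b \<noteq> 0"
  shows "CP3_meet (line_of U) (vec.span {a, b}) \<longleftrightarrow> pair U (plucker a b) = 0"
proof -
  obtain x y where xy: "U = plucker x y" using isotropic_imp_plucker[OF assms(2)] .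
  have L: "line_of U = vec.span {x, y}" using assms(1) xy line_of_plucker by blast
  show ?thesis
  proof
    assume "CP3_meet (line_of U) (vec.span {a, b})"
    then obtain P where P: "CP3_point P" "P \<subseteq> vec.span {x, y}" "P \<subseteq> vec.span {a, b}"
      unfolding CP3_meet_def L by blast
    have "\<not> P \<subseteq> {0}"
      using P(1) vec.dim_eq_0[of P] unfolding CP3_point_def by auto
    then obtain z where z: "z \<noteq> 0" "z \<in> vec.span {x, y}" "z \<in> vec.span {a, b}"
      using P by blast
    then obtain \<alpha> \<beta> \<gamma> \<delta> where ab: "\<alpha> *s x + \<beta> *s y = z" "\<gamma> *s a + \<delta> *s b = z"
      by (auto simp: span_pair)
    then have "\<alpha> \<noteq> 0 \<or> \<beta> \<noteq> 0" "\<gamma> \<noteq> 0 \<or> \<delta> \<noteq> 0" using z(1) by auto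
    then obtain w w' where "plucker x y = plucker z w" "plucker a b = plucker z w'"
      using plucker_replace[OF ab(1)] plucker_replace[OF ab(2)] by metis
    then show "pair U (plucker a b) = 0" by (simp add: xy flip: bracket_def)
  next
    assume "pair U (plucker a b) = 0"
    then have "bracket x y a b = 0" by (simp add: xy bracket_def)
    then obtain \<alpha> \<beta> \<gamma> \<delta> where e: "\<alpha> *s x + \<beta> *s y = \<gamma> *s a + \<delta> *s b" "\<alpha> \<noteq> 0 \<or> \<beta> \<noteq> 0"
      using bracket_eq_0_imp_meet[of x y a b] assms xy by metis
    define z where "z = \<alpha> *s x + \<beta> *s y"
    have "z \<noteq> 0" using plucker_nonzero_imp_independent[of \<alpha> x \<beta> y] e(2) assms(1) xy by (auto simp: z_def)
    then have "CP3_point (vec.span {z})"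
      unfolding CP3_point_def by (simp add: vec.dim_eq_card_independent)
    moreover have "z \<in> vec.span {x, y}" "z \<in> vec.span {a, b}" unfolding span_pair using e(1) z_def by blast+
    then have "vec.span {z} \<subseteq> vec.span {x, y}" "vec.span {z} \<subseteq> vec.span {a, b}"
      by (simp_all add: vec.span_minimal)
    ultimately show "CP3_meet (line_of U) (vec.span {a, b})" unfolding CP3_meet_def L by blast
  qed
qed

lemma CP3_transversals_eq:
  assumes "\<And>i. plucker (a i) (b i) \<noteq> 0"
  shows "CP3_transversals (vec.span {a 1, b 1}) (vec.span {a 2, b 2}) (vec.span {a 3, b 3}) (vec.span {a (4::4), b 4}) =
    line_of ` {U. U \<noteq> 0 \<and> pair U U = 0 \<and> (\<forall>i. pair U (plucker (a i) (b i)) = 0)}"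
  unfolding CP3_transversals_def CP3_line_iff using CP3_meet_iff[OF _ _ assms]
  by (auto simp: forall_4)

definition cvec :: "real^'n \<Rightarrow> complex^'n" where
  "cvec x = (\<chi> i. complex_of_real (x$i))"

lemma cvec_nth [simp]: "cvec x $ i = complex_of_real (x$i)"
  by (simp add: cvec_def)

lemma cvec_eq_0_iff [simp]: "cvec x = 0 \<longleftrightarrow> x = 0"
  by (simp add: vec_eq_iff)

lemma plucker_cvec: "plucker (cvec x) (cvec y) = cvec (plucker x y)"
  by (simp add: plucker_def vec6_eq_iff)

lemma pair_cvec: "pair (cvec U) (cvec V) = complex_of_real (pair U V)"
  by (simp add: pair_def)

lemma cvec_decompose:
  fixes U :: "complex^'n"
  obtains a b where "U = cvec a + \<i> *s cvec b"
proof
  show "U = cvec (\<chi> i. Re (U$i)) + \<i> *s cvec (\<chi> i. Im (U$i))"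
    by (simp add: vec_eq_iff complex_eq)
qed

lemma cvec_combination_eq_0:
  fixes u w k :: "real^'n" and a b c :: complex
  assumes "a *s cvec u + b *s cvec w + c *s cvec k = 0"
  shows "Re a *s u + Re b *s w + Re c *s k = 0" "Im a *s u + Im b *s w + Im c *s k = 0"
  using assms by (auto simp: vec_eq_iff complex_eq_iff)

text \<open>Five linear conditions on six unknowns; the zero row makes the matrix square and
  singular. With \<open>k = 0\<close> it just provides a nonzero vector of the kernel.\<close>

lemma exists_orthogonal_in_kernel:
  fixes c :: "4 \<Rightarrow> real^6" and k :: "real^6"
  obtains u where "u \<noteq> 0" "\<forall>i. pair u (c i) = 0" "inner k u = 0"
proof -
  define J :: "real^6 \<Rightarrow> real^6" where "J V = vec6 (V$4) (V$5) (V$6) (V$1) (V$2) (V$3)" for V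
  define M :: "real^6^6" where "M = vec6 (J (c 1)) (J (c 2)) (J (c 3)) (J (c 4)) k 0"
  have UNIV_6: "(UNIV :: 6 set) = {1, 2, 3, 4, 5, 6}" using exhaust_6 by auto
  have JU: "inner (J V) U = pair U V" for U V
    unfolding inner_vec_def UNIV_6 by (simp add: J_def pair_def algebra_simps)
  have MU: "M *v U = vec6 (pair U (c 1)) (pair U (c 2)) (pair U (c 3)) (pair U (c 4)) (inner k U) 0" for U
    unfolding matrix_mult_dot vec6_eq_iff by (simp add: M_def JU)
  have "row 6 M = 0" by (simp add: row_def M_def vec_eq_iff)
  then have "det M = 0" by (rule det_zero_row)
  then have "\<not> invertible M" by (simp add: invertible_det_nz)
  then obtain u where u: "M *v u = 0" "u \<noteq> 0" by (metis invertible_left_inverse matrix_left_invertible_ker)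
  then have "\<forall>i. pair u (c i) = 0" "inner k u = 0" unfolding MU by (simp_all add: vec6_eq_iff forall_4)
  then show ?thesis using that u by blast
qed

lemma orthogonal_independent:
  fixes u k :: "real^'n"
  assumes "u \<noteq> 0" "k \<noteq> 0" "inner k u = 0" "a *s u + b *s k = 0"
  shows "a = 0 \<and> b = 0"
proof -
  have "inner (a *s u + b *s k) u = a * inner u u" "inner (a *s u + b *s k) k = b * inner k k"
    using assms(3) by (simp_all add: scalar_mult_eq_scaleR inner_add_left inner_commute[of u k])
  then show ?thesis using assms unfolding assms(4) by simp
qed

text \<open>If the form vanished on the kernel, or the kernel had dimension at least 3, there would
  be infinitely many transversals; with zero discriminant there would be at most one. The edges are
  real, so the kernel is studied through its real vectors \<open>K\<close>.\<close>

lemma pencil_of_two_transversals: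
  fixes E :: "4 \<Rightarrow> 3 \<Rightarrow> real^6" and j :: "4 \<Rightarrow> 3"
  defines "S \<equiv> {U. U \<noteq> 0 \<and> pair U U = 0 \<and> (\<forall>i. pair U (cvec (E i (j i))) = 0)}"
  assumes card: "card (line_of ` S) = 2"
  shows "\<exists>k1 k2. pencil E j k1 k2"
proof -
  define K where "K = {U. \<forall>i. pair U (E i (j i)) = 0}"
  have Kadd: "a *s u + b *s w \<in> K" if "u \<in> K" "w \<in> K" for a b u w
    using that by (simp add: K_def)
  have fin: "finite (line_of ` S)" using card by (metis card.infinite zero_neq_numeral)
  have no_inj: False if "\<And>s. f s \<in> S" "inj (\<lambda>s::real. line_of (f s))" for f
  proof -
    have "range (\<lambda>s. line_of (f s)) \<subseteq> line_of ` S" using that(1) by blast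
    then have "finite (range (\<lambda>s. line_of (f s)))" using fin finite_subset by blast
    then show False using that(2) finite_imageD infinite_UNIV_char_0 by blast
  qed
  have S_I: "U \<in> S" if "U = a *s cvec u + b *s cvec w + c *s cvec k" "u \<in> K" "w \<in> K" "k \<in> K"
    "pair U U = 0" "U \<noteq> 0" for U a b c u w k
    using that by (simp add: S_def K_def pair_cvec)
  obtain k2 where k2: "k2 \<in> K" "pair k2 k2 \<noteq> 0"
  proof (rule ccontr)
    assume neg: "\<not> thesis"
    have iso: "pair u u = 0" if "u \<in> K" for u using neg that \<open>\<And>k2. k2 \<in> K \<Longrightarrow> pair k2 k2 \<noteq> 0 \<Longrightarrow> thesis\<close> by blast
    obtain u where u: "u \<noteq> 0" "u \<in> K"
      using exists_orthogonal_in_kernel[of "\<lambda>i. E i (j i)" 0] by (auto simp: K_def)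
    obtain w where w: "w \<noteq> 0" "w \<in> K" "inner u w = 0"
      using exists_orthogonal_in_kernel[of "\<lambda>i. E i (j i)" u] by (auto simp: K_def)
    \<comment> \<open>Polarization of a form that vanishes on all of \<open>K\<close>.\<close>
    have uw: "pair u w = 0"
      using iso[OF Kadd[OF u(2) w(2), of 1 1]] iso[OF u(2)] iso[OF w(2)] by (simp add: pair_commute[of w u])
    have ind: "a = 0 \<and> b = 0" if "a *s cvec u + b *s cvec w = 0" for a b
      using cvec_combination_eq_0[of a u b w 0 0] that orthogonal_independent[OF w(1) u(1) w(3)]
      by (metis (no_types, lifting) add.commute add.right_neutral complex_eq_iff vec.scale_zero_left zero_complex.sel)
    define f where "f s = cvec u + complex_of_real s *s cvec w" for s
    have f0: "f s \<noteq> 0" for s using ind[of 1 "complex_of_real s"] by (auto simp: f_def)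
    have fq: "pair (f s) (f s) = 0" for s
      using iso[OF u(2)] iso[OF w(2)] uw by (simp add: f_def pair_cvec pair_commute[of w u])
    show False
    proof (rule no_inj)
      show "f s \<in> S" for s
        using S_I[of "f s" 1 u "complex_of_real s" w 0 w] f0 fq u w by (simp add: f_def)
      show "inj (\<lambda>s. line_of (f s))"
      proof (rule injI)
        fix s t assume "line_of (f s) = line_of (f t)"
        then obtain c where "f s = c *s f t" using line_of_eq_iff f0 fq by blast
        then have "(1 - c) *s cvec u + (complex_of_real s - c * complex_of_real t) *s cvec w = 0"
          by (simp add: f_def vec_eq_iff algebra_simps)
        from ind[OF this] show "s = t" by auto
      qed
    qed
  qed
  obtain k1 where k1: "k1 \<noteq> 0" "k1 \<in> K" "inner k2 k1 = 0"
    using exists_orthogonal_in_kernel[of "\<lambda>i. E i (j i)" k2] by (auto simp: K_def)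
  have k20: "k2 \<noteq> 0" using k2 by auto
  have ind: "a = 0 \<and> b = 0" if "a *s k1 + b *s k2 = 0" for a b
    using orthogonal_independent[OF k1(1) k20 k1(3) that] .
  have K: "\<exists>a b. w = a *s k1 + b *s k2" if w: "w \<in> K" for w
  proof (rule ccontr)
    assume neg: "\<not> ?thesis"
    have ind3: "a = 0 \<and> b = 0 \<and> c = 0" if "a *s k1 + b *s w + c *s k2 = 0" for a b c
    proof -
      have "b = 0"
      proof (rule ccontr)
        assume "b \<noteq> 0"
        then have "w = (- a / b) *s k1 + (- c / b) *s k2"
          using that by (simp add: vec_eq_iff field_simps eq_neg_iff_add_eq_0)
        then show False using neg by blast
      qed
      then show ?thesis using ind[of a c] that by simp
    qed
    have cind3: "a = 0 \<and> b = 0 \<and> c = 0" if "a *s cvec k1 + b *s cvec w + c *s cvec k2 = 0" for a b c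
      using ind3[OF cvec_combination_eq_0(1)[OF that]] ind3[OF cvec_combination_eq_0(2)[OF that]]
      by (simp add: complex_eq_iff)
    define C where "C = complex_of_real (pair k2 k2)"
    have C0: "C \<noteq> 0" using k2 by (simp add: C_def)
    define g where "g s = cvec k1 + complex_of_real s *s cvec w" for s
    \<comment> \<open>For every real \<open>s\<close> the quadratic equation for the coefficient of
      \<open>k2\<close> is solvable over the complex numbers; \<open>csqrt\<close> selects a
      solution.\<close>
    define r where "r s = (- pair (g s) (cvec k2) +
       csqrt ((pair (g s) (cvec k2))\<^sup>2 - pair (g s) (g s) * C)) / C" for s
    define f where "f s = g s + r s *s cvec k2" for s
    have fe: "f s = 1 *s cvec k1 + complex_of_real s *s cvec w + r s *s cvec k2" for s
      by (simp add: f_def g_def)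
    have fq: "pair (f s) (f s) = 0" for s
    proof -
      have "C * r s + pair (g s) (cvec k2) = csqrt ((pair (g s) (cvec k2))\<^sup>2 - pair (g s) (g s) * C)"
        using C0 by (simp add: r_def)
      then have "(C * r s + pair (g s) (cvec k2))\<^sup>2 = (pair (g s) (cvec k2))\<^sup>2 - pair (g s) (g s) * C"
        by simp
      then have "C * (pair (g s) (g s) + 2 * r s * pair (g s) (cvec k2) + r s * r s * C) = 0"
        by (simp add: power2_eq_square algebra_simps)
      then have "pair (g s) (g s) + 2 * r s * pair (g s) (cvec k2) + r s * r s * C = 0" using C0 by simp
      then show ?thesis
        by (simp add: f_def pair_commute[of "cvec k2" "g s"] C_def pair_cvec[of k2 k2] algebra_simps)
    qed
    have f0: "f s \<noteq> 0" for s using cind3[of 1 "complex_of_real s" "r s"] fe[of s] by auto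
    show False
    proof (rule no_inj)
      show "f s \<in> S" for s by (rule S_I[OF fe k1(2) w k2(1) fq f0])
      show "inj (\<lambda>s. line_of (f s))"
      proof (rule injI)
        fix s t assume "line_of (f s) = line_of (f t)"
        then obtain c where "f s = c *s f t" using line_of_eq_iff f0 fq by blast
        then have "(1 - c) *s cvec k1 + (complex_of_real s - c * complex_of_real t) *s cvec w + (r s - c * r t) *s cvec k2 = 0"
          by (simp add: fe vec_eq_iff algebra_simps)
        from cind3[OF this] show "s = t" by auto
      qed
    qed
  qed
  have D: "(pair k1 k2)\<^sup>2 - pair k1 k1 * pair k2 k2 \<noteq> 0"
  proof
    assume D0: "(pair k1 k2)\<^sup>2 - pair k1 k1 * pair k2 k2 = 0"
    \<comment> \<open>The double root, of which every isotropic combination of \<open>k1\<close> and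
      \<open>k2\<close> is a multiple.\<close>
    define V where "V = cvec k1 - complex_of_real (pair k1 k2 / pair k2 k2) *s cvec k2"
    have "line_of U = line_of V" if U: "U \<in> S" for U
    proof -
      obtain a b where ab: "U = cvec a + \<i> *s cvec b" by (rule cvec_decompose)
      \<comment> \<open>Real and imaginary parts satisfy the real conditions separately.\<close>
      have "complex_of_real (pair a (E i (j i))) + \<i> * complex_of_real (pair b (E i (j i))) = 0" for i
        using U by (simp add: S_def ab pair_cvec)
      then have "a \<in> K" "b \<in> K" by (simp_all add: K_def complex_eq_iff)
      then obtain p q p' q' where "a = p *s k1 + q *s k2" "b = p' *s k1 + q' *s k2" using K by metis
      then have "U = Complex p p' *s cvec k1 + Complex q q' *s cvec k2"
        by (simp add: ab vec_eq_iff complex_eq_iff algebra_simps)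
      then obtain \<alpha> \<beta> where U2: "U = \<alpha> *s cvec k1 + \<beta> *s cvec k2" by blast
      let ?A = "complex_of_real (pair k1 k1)" and ?B = "complex_of_real (pair k1 k2)" and ?C = "complex_of_real (pair k2 k2)"
      have "pair U U = 0" using U by (simp add: S_def)
      then have "\<alpha> * \<alpha> * ?A + 2 * \<alpha> * \<beta> * ?B + \<beta> * \<beta> * ?C = 0"
        by (simp add: U2 pair_cvec pair_commute[of k2 k1] algebra_simps)
      moreover have "?B\<^sup>2 - ?A * ?C = 0"
        using arg_cong[OF D0, of complex_of_real] by simp
      ultimately have "(\<alpha> * ?B + \<beta> * ?C)\<^sup>2 = 0" by algebra
      then have "\<beta> = - \<alpha> * (?B / ?C)" using k2(2) by (simp add: field_simps eq_neg_iff_add_eq_0)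
      then have UV: "U = \<alpha> *s V" by (simp add: U2 V_def vec_eq_iff algebra_simps)
      then have "\<alpha> \<noteq> 0" using U by (auto simp: S_def)
      then show ?thesis by (simp add: UV line_of_scale)
    qed
    then have "line_of ` S \<subseteq> {line_of V}" by blast
    then have "card (line_of ` S) \<le> 1" using card_mono[of "{line_of V}"] by fastforce
    then show False using card by simp
  qed
  have "pencil E j k1 k2"
  proof
    show "(\<forall>i. pair U (E i (j i)) = 0) \<longleftrightarrow> (\<exists>a b. U = a *s k1 + b *s k2)" for U
      using K[of U] Kadd[OF k1(2) k2(1)] unfolding K_def by blast
  qed (use ind k2 D in auto)
  then show ?thesis by blast
qed

section \<open>Affine lines\<close>

definition hom :: "real^3 \<Rightarrow> real^4" where
  "hom x = vector [x$1, x$2, x$3, 1]"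

lemma hom_nth [simp]: "hom x $ 1 = x$1" "hom x $ 2 = x$2" "hom x $ 3 = x$3" "hom x $ 4 = 1"
  by (simp_all add: hom_def)

lemma homogenize_eq_cvec: "homogenize x = cvec (hom x)"
  by (simp add: homogenize_def vec4_eq_iff)

lemma vec3_eq_iff: "(x::'a^3) = y \<longleftrightarrow> x$1 = y$1 \<and> x$2 = y$2 \<and> x$3 = y$3"
  by (simp add: vec_eq_iff forall_3)

lemma hom_combination_iff:
  "hom x = u *s hom a + w *s hom b \<longleftrightarrow> u + w = 1 \<and> x = u *\<^sub>R a + w *\<^sub>R b"
  by (auto simp: vec4_eq_iff vec3_eq_iff)

lemma plucker_hom_nonzero: "a \<noteq> b \<Longrightarrow> plucker (hom a) (hom b) \<noteq> 0"
  by (auto simp: plucker_def vec6_eq_iff vec3_eq_iff)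

text \<open>For a line in the plane at infinity this set is empty.\<close>

definition affine_part :: "real^6 \<Rightarrow> (real^3) set" where
  "affine_part U = {x. hom x \<in> line_of U}"

lemma affine_part_plucker:
  assumes "a \<noteq> b"
  shows "affine_part (plucker (hom a) (hom b)) = affine hull {a, b}"
  unfolding affine_part_def line_of_plucker[OF plucker_hom_nonzero[OF assms]] span_pair
    hom_combination_iff affine_hull_2 by blast

lemma is_line_iff: "is_line L \<longleftrightarrow> (\<exists>a b. a \<noteq> b \<and> L = affine hull {a, b})"
proof
  assume L: "is_line L"
  obtain B where B: "affine hull B = affine hull L" "of_nat (card B) = aff_dim L + 1"
    using aff_dim_basis_exists by blast
  then have "card B = 2" using L by (simp add: is_line_def)
  then obtain a b where "B = {a, b}" "a \<noteq> b" by (auto simp: card_2_iff)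
  moreover have "affine hull L = L" using L by (simp add: is_line_def hull_same)
  ultimately show "\<exists>a b. a \<noteq> b \<and> L = affine hull {a, b}" using B by metis
qed (auto simp: is_line_def)

lemma affine_transversal:
  assumes "U \<noteq> 0" "pair U U = 0" "hom P \<in> line_of U"
  obtains Q where "Q \<noteq> P" "U = plucker (hom P) (hom Q)"
proof -
  obtain x y where xy: "U = plucker x y" using isotropic_imp_plucker[OF assms(2)] .
  then have "hom P \<in> vec.span {x, y}" using assms line_of_plucker by blast
  then obtain a b where ab: "a *s x + b *s y = hom P" by (metis span_pair)
  moreover have "a \<noteq> 0 \<or> b \<noteq> 0" using ab by (auto simp: vec4_eq_iff)
  ultimately obtain w where w: "U = plucker (hom P) w" using plucker_replace xy by metis
  \<comment> \<open>Adding \<open>1 - w$4\<close> times \<open>hom P\<close> to \<open>w\<close>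
    makes the last coordinate 1 and does not change the wedge with \<open>hom P\<close>; this also
    covers a direction vector, where \<open>w$4 = 0\<close>.\<close>
  define Q where "Q = P + (vector [w$1, w$2, w$3] - w$4 *\<^sub>R P)"
  have "hom Q = (1 - w$4) *s hom P + w" by (simp add: Q_def vec4_eq_iff algebra_simps)
  then have U: "U = plucker (hom P) (hom Q)" using w by simp
  moreover have "Q \<noteq> P" using U assms(1) by auto
  ultimately show ?thesis using that by blast
qed

lemma crosses_imp_point:
  assumes "U \<noteq> 0" "pair U U = 0" "a \<noteq> b"
    and cr: "crosses (plucker (hom a) (hom b)) (plucker (hom b) (hom c)) (plucker (hom c) (hom a)) U"
  obtains P where "P \<in> closed_segment a b" "hom P \<in> line_of U"
proof -
  obtain x y where xy: "U = plucker x y" using isotropic_imp_plucker[OF assms(2)] .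
  obtain \<alpha> \<beta> \<gamma> \<delta> where e: "\<alpha> *s x + \<beta> *s y = \<gamma> *s hom a + \<delta> *s hom b" "\<alpha> \<noteq> 0 \<or> \<beta> \<noteq> 0"
  proof (rule bracket_eq_0_imp_meet)
    show "bracket x y (hom a) (hom b) = 0" using cr xy by (simp add: crosses_def bracket_def)
  qed (use assms xy plucker_hom_nonzero in auto)
  obtain w where w: "U = plucker (\<gamma> *s hom a + \<delta> *s hom b) w"
    using plucker_replace[OF e] xy by metis
  have "bracket (hom a) w (hom b) (hom c) \<noteq> 0"
    using cr unfolding w crosses_def pair_plucker_edges by auto
  then have pos: "0 < \<gamma> * \<delta>" using cr unfolding w by (rule crosses_plucker_iff[THEN iffD1])
  define s where "s = \<delta> / (\<gamma> + \<delta>)"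
  have n0: "\<gamma> + \<delta> \<noteq> 0" using pos by (auto simp: zero_less_mult_iff)
  have s: "0 \<le> s" "s \<le> 1" using pos by (auto simp: s_def zero_less_mult_iff field_simps)
  define P where "P = (1 - s) *\<^sub>R a + s *\<^sub>R b"
  have "hom P = (1 - s) *s hom a + s *s hom b" unfolding hom_combination_iff by (simp add: P_def)
  moreover have "(\<gamma> + \<delta>) * (1 - s) = \<gamma>" "(\<gamma> + \<delta>) * s = \<delta>" using n0 by (simp_all add: s_def field_simps)
  ultimately have "\<gamma> *s hom a + \<delta> *s hom b = (\<gamma> + \<delta>) *s hom P"
    by (simp only: vector_add_ldistrib vector_smult_assoc)
  then have "U = (\<gamma> + \<delta>) *s plucker (hom P) w" using w by simp
  then have "hom P \<in> line_of U" by (simp add: line_of_def flip: bracket_def)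
  moreover have "P \<in> closed_segment a b" using s by (auto simp: closed_segment_def P_def)
  ultimately show ?thesis using that by blast
qed

text \<open>The two inequalities exclude that \<open>P\<close> is an end of the segment and that the
  line lies in the plane of the triangle.\<close>

lemma point_imp_crosses:
  assumes "U \<noteq> 0" "pair U U = 0" "P \<in> closed_segment a b" "hom P \<in> line_of U"
    and "pair U (plucker (hom b) (hom c)) \<noteq> 0" "pair U (plucker (hom c) (hom a)) \<noteq> 0"
  shows "crosses (plucker (hom a) (hom b)) (plucker (hom b) (hom c)) (plucker (hom c) (hom a)) U"
proof -
  obtain Q where Q: "U = plucker (hom P) (hom Q)" using affine_transversal assms by metis
  obtain s where s: "0 \<le> s" "s \<le> 1" "P = (1 - s) *\<^sub>R a + s *\<^sub>R b"
    using assms(3) by (auto simp: closed_segment_def)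
  then have hP: "hom P = (1 - s) *s hom a + s *s hom b" unfolding hom_combination_iff by simp
  have "(1 - s) * bracket (hom a) (hom Q) (hom b) (hom c) \<noteq> 0" "s * bracket (hom a) (hom Q) (hom b) (hom c) \<noteq> 0"
    using assms(5,6) unfolding Q hP pair_plucker_edges .
  then have "bracket (hom a) (hom Q) (hom b) (hom c) \<noteq> 0" "0 < (1 - s) * s" using s by auto
  then show ?thesis unfolding Q hP by (rule crosses_plucker_iff[THEN iffD2])
qed

text \<open>The vertices are the extreme points of the triangle, so every description of it uses the
  same three points.\<close>

lemma triangle_edges_eq:
  fixes p :: "3 \<Rightarrow> real^3"
  assumes nc: "\<not> collinear {p 1, p 2, p 3}"
  shows "triangle_edges (convex hull {p 1, p 2, p 3}) = range (\<lambda>k. closed_segment (p (k + 1)) (p (k + 2)))"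
proof -
  have idx: "1 + 1 = (2::3)" "1 + 2 = (3::3)" "2 + 1 = (3::3)" "2 + 2 = (1::3)" "3 + 1 = (1::3)" "3 + 2 = (2::3)"
    by simp_all
  have ext: "{x. x extreme_point_of (convex hull {a, b, c})} = {a, b, c}" if "\<not> collinear {a, b, c}" for a b c :: "real^3"
    using extreme_point_of_convex_hull_affine_independent[of "{a, b, c}"] that collinear_3_eq_affine_dependent[of a b c]
    by auto
  have "range (\<lambda>k. closed_segment (p (k + 1)) (p (k + 2))) =
    {closed_segment (p 2) (p 3), closed_segment (p 3) (p 1), closed_segment (p 1) (p 2)}"
    unfolding UNIV_3 by (simp only: image_insert image_empty idx)
  moreover have "triangle_edges (convex hull {p 1, p 2, p 3}) =
    {closed_segment (p 2) (p 3), closed_segment (p 3) (p 1), closed_segment (p 1) (p 2)}"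
  proof (intro subset_antisym subsetI)
    fix e assume "e \<in> triangle_edges (convex hull {p 1, p 2, p 3})"
    then obtain a b c where e: "e = closed_segment a b" "\<not> collinear {a, b, c}"
      "convex hull {p 1, p 2, p 3} = convex hull {a, b, c}" unfolding triangle_edges_def by blast
    have "{a, b, c} = {p 1, p 2, p 3}"
      using ext[OF nc] ext[OF e(2)] unfolding e(3) by (metis (no_types))
    then have "a \<in> {p 1, p 2, p 3}" "b \<in> {p 1, p 2, p 3}" by blast+
    moreover have "a \<noteq> b" using e(2) by auto
    ultimately show "e \<in> {closed_segment (p 2) (p 3), closed_segment (p 3) (p 1), closed_segment (p 1) (p 2)}"
      by (elim insertE emptyE) (simp_all add: e(1) closed_segment_commute)
  next
    have *: "closed_segment a b \<in> triangle_edges (convex hull {p 1, p 2, p 3})"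
      if "{a, b, c} = {p 1, p 2, p 3}" for a b c
      unfolding triangle_edges_def using that nc by (intro CollectI exI[of _ a] exI[of _ b] conjI refl exI[of _ c]) auto
    fix e assume "e \<in> {closed_segment (p 2) (p 3), closed_segment (p 3) (p 1), closed_segment (p 1) (p 2)}"
    moreover have "{p 2, p 3, p 1} = {p 1, p 2, p 3}" "{p 3, p 1, p 2} = {p 1, p 2, p 3}" by auto
    ultimately show "e \<in> triangle_edges (convex hull {p 1, p 2, p 3})"
      using *[of "p 2" "p 3" "p 1"] *[of "p 3" "p 1" "p 2"] *[of "p 1" "p 2" "p 3"] by blast
  qed
  ultimately show ?thesis by simp
qed

lemma complexify_segment:
  "complexify (supporting_line (closed_segment a b)) = vec.span {cvec (hom a), cvec (hom b)}"
proof -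
  have comb: "homogenize (u *\<^sub>R a + w *\<^sub>R b) = complex_of_real u *s cvec (hom a) + complex_of_real w *s cvec (hom b)"
    if "u + w = 1" for u w
  proof -
    have "complex_of_real u + complex_of_real w = 1" using that by (metis of_real_1 of_real_add)
    then show ?thesis by (simp add: homogenize_eq_cvec vec4_eq_iff)
  qed
  have "homogenize ` (affine hull {a, b}) \<subseteq> vec.span {cvec (hom a), cvec (hom b)}"
  proof (rule image_subsetI)
    fix x assume "x \<in> affine hull {a, b}"
    then obtain u w where "u + w = 1" "x = u *\<^sub>R a + w *\<^sub>R b" unfolding affine_hull_2 by blast
    then show "homogenize x \<in> vec.span {cvec (hom a), cvec (hom b)}" unfolding span_pair using comb by blast
  qed
  moreover have "{cvec (hom a), cvec (hom b)} \<subseteq> homogenize ` (affine hull {a, b})"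
    by (auto simp: homogenize_eq_cvec hull_inc)
  ultimately show ?thesis
    unfolding complexify_def supporting_line_def affine_hull_closed_segment
    by (meson subset_antisym vec.span_minimal vec.span_mono vec.subspace_span)
qed

theorem theorem1:
  fixes t1 t2 t3 t4 :: "(real^3) set"
  assumes "is_triangle t1" and "is_triangle t2" and "is_triangle t3" and "is_triangle t4"
    and "general_position t1 t2 t3 t4"
  shows "finite (tangent_lines t1 t2 t3 t4) \<and> even (card (tangent_lines t1 t2 t3 t4))"
proof -
  define t where "t = quad t1 t2 t3 t4"
  have t: "t 1 = t1" "t 2 = t2" "t 3 = t3" "t 4 = t4" by (simp_all add: t_def)
  have "\<exists>q::3 \<Rightarrow> real^3. \<not> collinear {q 1, q 2, q 3} \<and> T = convex hull {q 1, q 2, q 3}" if "is_triangle T" for T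
  proof -
    obtain a b c where abc: "\<not> collinear {a, b, c}" "T = convex hull {a, b, c}"
      using \<open>is_triangle T\<close> unfolding is_triangle_def by blast
    show ?thesis
      by (rule exI[of _ "\<lambda>k. if k = 1 then a else if k = 2 then b else c"]) (use abc in simp)
  qed
  moreover have "is_triangle (t i)" for i
    using assms(1-4) exhaust_4[of i] by (auto simp: t)
  ultimately have "\<exists>q::3 \<Rightarrow> real^3. \<not> collinear {q 1, q 2, q 3} \<and> t i = convex hull {q 1, q 2, q 3}" for i
    by blast
  then obtain p :: "4 \<Rightarrow> 3 \<Rightarrow> real^3" where p: "\<And>i. \<not> collinear {p i 1, p i 2, p i 3}"
    "\<And>i. t i = convex hull {p i 1, p i 2, p i 3}" by metis
  define seg where "seg i k = closed_segment (p i (k + 1)) (p i (k + 2))" for i k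
  have edges: "triangle_edges (t i) = range (seg i)" for i
    unfolding p(2) seg_def by (rule triangle_edges_eq[OF p(1)])
  have pinj: "p i k \<noteq> p i l" if "k \<noteq> l" for i k l
  proof
    assume eq: "p i k = p i l"
    have "collinear {p i 1, p i 2, p i 3}"
      using that eq exhaust_3[of k] exhaust_3[of l] by (elim disjE) (auto simp: insert_commute)
    then show False using p(1) by blast
  qed
  have p12: "p i (k + 1) \<noteq> p i (k + 2)" for i k by (rule pinj) simp
  have seg_inj: "inj (seg i)" for i
  proof (rule injI, rule ccontr)
    fix k l assume eq: "seg i k = seg i l" and "k \<noteq> l"
    have "{p i (k + 1), p i (k + 2)} = {p i (l + 1), p i (l + 2)}"
      using eq unfolding seg_def by simp
    then have "k + 1 = l + 1 \<or> k + 1 = l + 2" "k + 2 = l + 1 \<or> k + 2 = l + 2"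
      using pinj[of "k + 1" "l + 1" i] pinj[of "k + 1" "l + 2" i] pinj[of "k + 2" "l + 1" i] pinj[of "k + 2" "l + 2" i]
      by (auto simp: doubleton_eq_iff)
    then show False using \<open>k \<noteq> l\<close> exhaust_3[of k] exhaust_3[of l] by auto
  qed
  define E where "E i = edge (\<lambda>k. hom (p i k))" for i
  have E: "E i k = plucker (hom (p i (k + 1))) (hom (p i (k + 2)))"
    "E i (k + 1) = plucker (hom (p i (k + 2))) (hom (p i k))"
    "E i (k + 2) = plucker (hom (p i k)) (hom (p i (k + 1)))" for i k
    by (simp_all add: E_def edge_def add_mod3)
  have crE: "crosses (E i k) (E i (k + 1)) (E i (k + 2)) U =
      crosses (plucker (hom (p i (k + 1))) (hom (p i (k + 2)))) (plucker (hom (p i (k + 2))) (hom (p i k)))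
        (plucker (hom (p i k)) (hom (p i (k + 1)))) U" for i k U
    by (simp only: E(1) add_mod3(1-4))
  define S where "S j = {U. U \<noteq> 0 \<and> pair U U = 0 \<and> (\<forall>i. pair U (cvec (E i (j i))) = 0)}" for j
  define q where "q j = (seg 1 (j 1), seg 2 (j 2), seg 3 (j 3), seg 4 (j 4))" for j :: "4 \<Rightarrow> 3"
  have tr: "edge_transversals (q j) = line_of ` S j" for j
    unfolding q_def edge_transversals.simps seg_def complexify_segment S_def E(1) plucker_cvec[symmetric]
    by (rule CP3_transversals_eq[of "\<lambda>i. cvec (hom (p i (j i + 1)))" "\<lambda>i. cvec (hom (p i (j i + 2)))"])
       (simp add: plucker_cvec plucker_hom_nonzero p12)
  have quads: "q j \<in> edge_quadruples t1 t2 t3 t4" for j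
    unfolding edge_quadruples_def q_def t[symmetric] edges by blast
  have q_inj: "q j = q j' \<Longrightarrow> j = j'" for j j'
    unfolding q_def fun_eq_iff forall_4 using seg_inj by (auto dest: injD)
  have card2: "card (line_of ` S j) = 2" for j
    using assms(5) quads[of j] tr[of j] unfolding general_position_def by metis
  have disj: "line_of ` S j \<inter> line_of ` S j' = {}" if "j \<noteq> j'" for j j'
    using assms(5) quads[of j] quads[of j'] q_inj[of j j'] that tr
    unfolding general_position_def disjoint_family_on_def by metis
  have pen: "\<exists>k1 k2. pencil E j k1 k2" for j
    using pencil_of_two_transversals card2[of j] unfolding S_def by blast
  \<comment> \<open>Otherwise \<open>U\<close> would be a transversal of the quadruples
    \<open>j\<close> and \<open>j(i := k)\<close> at once, but different quadruples share
    none.\<close>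
  have N: "pair U (E i k) \<noteq> 0" if U: "U \<noteq> 0" "pair U U = 0" "\<forall>i. pair U (E i (j i)) = 0" and "k \<noteq> j i" for U i j k
  proof
    assume z: "pair U (E i k) = 0"
    have "cvec U \<in> S j" using U by (simp add: S_def pair_cvec)
    moreover have "cvec U \<in> S (j(i := k))" using U z by (simp add: S_def pair_cvec)
    moreover have "j \<noteq> j(i := k)" using \<open>k \<noteq> j i\<close> by (metis fun_upd_same)
    ultimately show False using disj by blast
  qed
  have reg: "regular E j" for j
  proof -
    obtain k1 k2 where "pencil E j k1 k2" using pen by blast
    then interpret pencil E j k1 k2 .
    show ?thesis
      unfolding regular_iff using N[OF V_nonzero V_isotropic] V_kernel by blast
  qed
  have "even (\<Sum>j\<in>UNIV. card (tangents (\<lambda>i. edge (\<lambda>k. hom (p i k))) j))"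
    by (rule even_sum_pencils) (use pen reg in \<open>simp_all add: E_def[abs_def]\<close>)
  then have even: "even (\<Sum>j\<in>UNIV. card (tangents E j))" by (simp add: E_def[abs_def])
  have fin: "finite (tangents E j)" for j
    using pen[of j] pencil.finite_tangents by blast
  have tanD: "\<exists>U. X = vec.span {U} \<and> U \<noteq> 0 \<and> pair U U = 0 \<and> (\<forall>i. pair U (E i (j i)) = 0) \<and>
      (\<forall>i. crosses (E i (j i)) (E i (j i + 1)) (E i (j i + 2)) U)" if "X \<in> tangents E j" for X j
    using that unfolding tangents_def crosses_def by fastforce
  have tan_disj: "tangents E j \<inter> tangents E j' = {}" if "j \<noteq> j'" for j j'
  proof (rule ccontr)
    assume "tangents E j \<inter> tangents E j' \<noteq> {}"
    then obtain X where X: "X \<in> tangents E j" "X \<in> tangents E j'" by blast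
    obtain U where U: "X = vec.span {U}" "U \<noteq> 0" "pair U U = 0" "\<forall>i. pair U (E i (j i)) = 0"
      using tanD[OF X(1)] by blast
    obtain V where V: "X = vec.span {V}" "V \<noteq> 0" "\<forall>i. pair V (E i (j' i)) = 0"
      using tanD[OF X(2)] by blast
    obtain c where "c \<noteq> 0" "U = c *s V" using span_singleton_eq_iff[OF U(2)] U(1) V(1) by metis
    then have "\<forall>i. pair U (E i (j' i)) = 0" using V(3) by simp
    moreover obtain i where "j' i \<noteq> j i" using \<open>j \<noteq> j'\<close> by (metis ext)
    ultimately show False using N[OF U(2-4)] by blast
  qed
  have card_UN: "card (\<Union>j. tangents E j) = (\<Sum>j\<in>UNIV. card (tangents E j))"
    by (rule card_UN_disjoint) (use fin tan_disj in auto)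
  \<comment> \<open>Quantifying over the whole span avoids the choice of a representative; the zero
    vector in it imposes no condition.\<close>
  define \<psi> where "\<psi> X = {x. \<forall>U\<in>X. hom x \<in> line_of U}" for X
  have psi: "\<psi> (vec.span {U}) = affine_part U" for U
    unfolding \<psi>_def affine_part_def vec.span_singleton by (auto simp: line_of_def)
  have "bij_betw \<psi> (\<Union>j. tangents E j) (tangent_lines t1 t2 t3 t4)"
  proof (rule bij_betw_imageI)
    \<comment> \<open>Crossing an edge yields a point of the line in affine space. Hence none of
      these lines is at infinity, and each is determined by its affine part.\<close>
    have point: "\<exists>P Q. P \<noteq> Q \<and> U = plucker (hom P) (hom Q)"
      if A: "U \<noteq> 0" "pair U U = 0" "crosses (E i k) (E i (k + 1)) (E i (k + 2)) U" for U i k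
    proof -
      obtain P where "hom P \<in> line_of U"
        using crosses_imp_point[OF A(1,2) p12 A(3)[unfolded crE]] by metis
      then show ?thesis using affine_transversal[OF A(1,2)] by metis
    qed
    show "inj_on \<psi> (\<Union>j. tangents E j)"
    proof (rule inj_onI)
      fix X Y assume "X \<in> (\<Union>j. tangents E j)" "Y \<in> (\<Union>j. tangents E j)" and eq: "\<psi> X = \<psi> Y"
      then obtain U V where U: "X = vec.span {U}" "U \<noteq> 0" "pair U U = 0" "\<exists>i k. crosses (E i k) (E i (k + 1)) (E i (k + 2)) U"
        and V: "Y = vec.span {V}" "V \<noteq> 0" "pair V V = 0"
        using tanD by (metis (no_types, lifting) UN_E)
      obtain P Q where PQ: "P \<noteq> Q" "U = plucker (hom P) (hom Q)" using U point by blast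
      have "P \<in> \<psi> X" "Q \<in> \<psi> X"
        unfolding U(1) psi PQ(2) affine_part_plucker[OF PQ(1)] by (simp_all add: hull_inc)
      then have "hom P \<in> line_of V" "hom Q \<in> line_of V"
        unfolding eq V(1) psi by (simp_all add: affine_part_def)
      then obtain c where "U = c *s V" using plucker_in_line[OF V(2,3)] PQ(2) by metis
      then show "X = Y" unfolding U(1) V(1) using span_singleton_eq_iff[OF U(2)] U(2) by (metis vec.scale_zero_left)
    qed
    show "\<psi> ` (\<Union>j. tangents E j) = tangent_lines t1 t2 t3 t4"
    proof (intro subset_antisym subsetI)
      fix L assume "L \<in> \<psi> ` (\<Union>j. tangents E j)"
      then obtain X j where X: "L = \<psi> X" "X \<in> tangents E j" by blast
      then obtain U where U: "X = vec.span {U}" "U \<noteq> 0" "pair U U = 0"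
        "\<And>i. crosses (E i (j i)) (E i (j i + 1)) (E i (j i + 2)) U"
        using tanD by blast
      have L: "L = affine_part U" by (simp add: X U psi)
      obtain P Q where PQ: "P \<noteq> Q" "U = plucker (hom P) (hom Q)" using point U by blast
      have line: "is_line L" unfolding L PQ(2) affine_part_plucker[OF PQ(1)] is_line_iff using PQ(1) by blast
      have "tangent_to L (t i)" for i
      proof -
        obtain R where "R \<in> seg i (j i)" "hom R \<in> line_of U"
          using crosses_imp_point[OF U(2,3) p12 U(4)[of i, unfolded crE]] unfolding seg_def by metis
        then have "L \<inter> seg i (j i) \<noteq> {}" by (auto simp: L affine_part_def)
        then show ?thesis unfolding tangent_to_def edges using line by blast
      qed
      then show "L \<in> tangent_lines t1 t2 t3 t4" unfolding tangent_lines_def t[symmetric] by blast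
    next
      fix L assume "L \<in> tangent_lines t1 t2 t3 t4"
      then have "\<forall>i. tangent_to L (t i)" unfolding tangent_lines_def t[symmetric] forall_4 by blast
      then have line: "is_line L" and "\<forall>i. \<exists>k P. P \<in> L \<and> P \<in> seg i k"
        unfolding tangent_to_def edges by blast+
      then obtain j P where jP: "\<And>i. P i \<in> L" "\<And>i. P i \<in> seg i (j i)" by metis
      obtain a b where ab: "a \<noteq> b" "L = affine hull {a, b}" using line is_line_iff by blast
      define U where "U = plucker (hom a) (hom b)"
      have U: "U \<noteq> 0" "pair U U = 0" using plucker_hom_nonzero[OF ab(1)] by (simp_all add: U_def)
      have L: "L = affine_part U" unfolding ab(2) U_def affine_part_plucker[OF ab(1)] ..
      have PU: "hom (P i) \<in> line_of U" for i using jP(1)[of i] unfolding L affine_part_def by simp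
      have k0: "\<forall>i. pair U (E i (j i)) = 0"
      proof
        fix i
        obtain Q where Q: "U = plucker (hom (P i)) (hom Q)" using affine_transversal[OF U PU] by metis
        obtain s where "P i = (1 - s) *\<^sub>R p i (j i + 1) + s *\<^sub>R p i (j i + 2)"
          using jP(2)[of i] unfolding seg_def closed_segment_def by blast
        then have "hom (P i) = (1 - s) *s hom (p i (j i + 1)) + s *s hom (p i (j i + 2))"
          unfolding hom_combination_iff by simp
        then show "pair U (E i (j i)) = 0" unfolding Q E(1) by (simp only: pair_plucker_edges)
      qed
      \<comment> \<open>By \<open>N\<close> the line meets no further edge of the triangle, so
        meeting the closed segment already means crossing it in its interior.\<close>
      have "crosses (E i (j i)) (E i (j i + 1)) (E i (j i + 2)) U" for i
        unfolding crE
        by (rule point_imp_crosses[OF U jP(2)[unfolded seg_def] PU])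
          (use N[OF U k0 add_mod3(5), of i, unfolded E(2)] N[OF U k0 add_mod3(6), of i, unfolded E(3)] in simp_all)
      then have "vec.span {U} \<in> tangents E j" unfolding tangents_def using U(2) by blast
      then show "L \<in> \<psi> ` (\<Union>j. tangents E j)" unfolding L psi[symmetric] by blast
    qed
  qed
  moreover have "finite (\<Union>j. tangents E j)" by (simp add: fin)
  ultimately show ?thesis
    using even card_UN bij_betw_finite bij_betw_same_card by metis
qed

end
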